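(* Let $W=(V,\mathsf{w})$ be a weighted digraph of positive spectral radius $\rho$, with residual matrix $\Theta$, and let $x_0$ be a vertex such that all vertices of $W$ are accessible from $x_0$. Assume that all the basic classes of $W$ are aperiodic. Let $\mathsf{U}(x_0)$ be the umbrella digraph spanned by $x_0$. Then the sequence $(\mu_{x_0,k})_{k\ge0}$ of uniform distributions converges weakly, as $k\to\infty$, toward (the component starting from $x_0$ of) the complete cocycle measure on $\mathsf{U}(x_0)$ whose cocycle transition kernel is given on $\mathsf{U}(x_0)$ by $$q(x,y)=\rho^{-1}\mathsf{w}(x,y)\Gamma(x,y),\qquad \Gamma(x,y)=\frac{[\Theta\cdot 1]_y}{[\Theta\cdot 1]_x},$$ where $1$ denotes the column vector filled with $1$s.
   Context: A weighted digraph is a pair $W=(V,\mathsf{w})$ with $V$ a finite set of vertices and $\mathsf{w}:V\times V\to\mathbb{R}_{\ge0}$; its edges are the pairs $(x,y)$ with $\mathsf{w}(x,y)>0$. Its adjacency matrix $F$ is given by $[F]_{x,y}=\mathsf{w}(x,y)$, and its spectral radius is that of $F$. A subset of $V$ is seen as a sub-digraph by restricting $\mathsf{w}$. A finite path is a sequence $u=(x_0,\dots,x_k)$ of vertices with each $(x_i,x_{i+1})$ an edge; its length is $\ell(u)=k$, its final vertex $\kappa(u)=x_k$, its weight $\mathsf{w}(u)=\prod_{i<k}\mathsf{w}(x_i,x_{i+1})$ ($=1$ if $k=0$). $O_x$ is the set of finite paths starting at $x$, $O_x(k)$ the subset of those of length $k$; $\Omega_x$ is the set of infinite paths starting at $x$;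 $\overline{O}_x=O_x\cup\Omega_x$ is equipped with the (compact metrizable) product topology, finite paths being viewed as infinite sequences by padding with an extra symbol $\dagger\notin V$. For $u\in O_x$, $\uparrow u$ is the set of infinite paths with prefix $u$. Weak convergence is weak convergence of probability measures on $\overline{O}_x$, measures on $\Omega_x$ being viewed as measures on $\overline{O}_x$. Access: $x\Rightarrow y$ ($y$ accessible from $x$) means there is a finite path (possibly of length $0$) from $x$ to $y$; access classes are the equivalence classes of "$x\Rightarrow y$ and $y\Rightarrow x$", partially ordered by the induced relation $\Rightarrow$. The spectral radius of a class is that of the corresponding block of $F$; a class is basic if its spectral radius is that of the whole digraph, and final if it has access to no other class. A basic class is aperiodic if the gcd of the lengths of its cycles is $1$. A dominant chain is a chain $L_1\Rightarrow L_2\Rightarrow\cdots$ of distinct basic classes of maximal length (number of classes); the height is the length of the dominant chains. An umbrella digraph is a digraph of positive spectral radius whose basic classes coincide with its final classes. For a vertex $x$, $V(x)=\{y\in V: x\Rightarrow y\}$, seen as a sub-digraph, with spectral radius $\gamma(x)$ and height $h(x)$. If $\gamma(x)>0$, the umbrella digraph spanned by $x$, denoted $\mathsf{U}(x)$, is the sub-digraph of $V(x)$ whose vertices are the $y\in V(x)$ such that $y\Rightarrow L_1$ for some dominant chain $(L_1,\dots,L_{h(x)})$ of $V(x)$. (It is an umbrella digraph of spectral radius $\gamma(x)$.) Uniform distributions: if $\gamma(x)>0$, for $k\ge0$, $\mu_{x,k}=\frac1{Z_x(k)}\sum_{u\in O_x(k)}\mathsf{w}(u)\delta_{\{u\}}$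 with $Z_x(k)=\sum_{u\in O_x(k)}\mathsf{w}(u)$. Residual matrix: with $\mathsf{H}(z)=\sum_{k\ge0}F^kz^k$ and $\rho>0$ the spectral radius, there are a unique positive integer $h$ and a unique nonnegative nonzero matrix $\Theta$ with $\lim_{s\to\rho^{-1},\,s\in(0,\rho^{-1})}(1-\rho s)^h\mathsf{H}(s)=\Theta$; $\Theta$ is the residual matrix. A cocycle on a digraph is a function $\Gamma:\{(x,y):x\Rightarrow y\}\to\mathbb{R}_{\ge0}$ with $\Gamma(x,z)=\Gamma(x,y)\Gamma(y,z)$ whenever $x\Rightarrow y\Rightarrow z$. A cocycle measure is a family $\mu=(\mu_x)_x$ of probability measures, $\mu_x$ on the space of infinite paths of the digraph starting at $x$, such that for some real $\rho>0$ and some cocycle $\Gamma$, $\mu_x(\uparrow u)=\rho^{-\ell(u)}\mathsf{w}(u)\Gamma(x,\kappa(u))$ for all vertices $x$ and all finite paths $u$ of the digraph starting at $x$. It is complete if $\Gamma$ is positive everywhere on its domain. Under $\mu_x$ the sequence of visited vertices is a Markov chain started at $x$ with transition kernel $q(x,y)=\rho^{-1}\mathsf{w}(x,y)\Gamma(x,y)$, called the cocycle (transition) kernel; cocycle measures and cocycle kernels determine each other. *)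

theory Defs
  imports "HOL-Probability.Probability" "Jordan_Normal_Form.Spectral_Radius"
begin

text \<open>
  A weighted digraph is given by a finite vertex set \<open>V\<close> and a weight \<open>w\<close>, nonnegative on
  \<open>V \<times> V\<close>. The values of \<open>w\<close> outside \<open>V \<times> V\<close> are never used, so the sub-digraph on
  \<open>S \<subseteq> V\<close> is the digraph given by \<open>S\<close> and the same \<open>w\<close>.
\<close>

definition weighted_digraph :: "'v set \<Rightarrow> ('v \<Rightarrow> 'v \<Rightarrow> real) \<Rightarrow> bool" where
  "weighted_digraph V w \<longleftrightarrow> finite V \<and> (\<forall>x\<in>V. \<forall>y\<in>V. 0 \<le> w x y)"

text \<open>
  The finite set \<open>V\<close> is enumerated by the library bijection \<open>from_nat_into V\<close> from
  \<open>{..<card V}\<close> onto \<open>V\<close>, with inverse \<open>to_nat_on V\<close>; spectral radii and entries indexed by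
  vertices do not depend on the enumeration.
\<close>

definition adj_matrix :: "'v set \<Rightarrow> ('v \<Rightarrow> 'v \<Rightarrow> real) \<Rightarrow> real mat" where
  "adj_matrix V w =
     mat (card V) (card V) (\<lambda>(i, j). w (from_nat_into V i) (from_nat_into V j))"

definition mat_entry :: "'v set \<Rightarrow> real mat \<Rightarrow> 'v \<Rightarrow> 'v \<Rightarrow> real" where
  "mat_entry V A x y = A $$ (to_nat_on V x, to_nat_on V y)"

lemma mat_entry_adj_matrix:
  assumes "finite V" "x \<in> V" "y \<in> V"
  shows "mat_entry V (adj_matrix V w) x y = w x y"
proof -
  have "to_nat_on V z < card V" if "z \<in> V" for z
    using to_nat_on_finite[OF assms(1)] that by (auto simp: bij_betw_def)
  then show ?thesis
    using assms by (simp add: mat_entry_def adj_matrix_def countable_finite)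
qed

definition digraph_spectral_radius :: "'v set \<Rightarrow> ('v \<Rightarrow> 'v \<Rightarrow> real) \<Rightarrow> real" where
  "digraph_spectral_radius V w = spectral_radius (map_mat complex_of_real (adj_matrix V w))"


subsection \<open>Paths\<close>

text \<open>The path \<open>(x\<^sub>0, \<dots>, x\<^sub>k)\<close> is the list of its \<open>k + 1\<close> vertices.\<close>

definition finite_path :: "'v set \<Rightarrow> ('v \<Rightarrow> 'v \<Rightarrow> real) \<Rightarrow> 'v list \<Rightarrow> bool" where
  "finite_path V w u \<longleftrightarrow> u \<noteq> [] \<and> set u \<subseteq> V \<and> successively (\<lambda>x y. 0 < w x y) u"

definition path_len :: "'v list \<Rightarrow> nat" where
  "path_len u = length u - 1"

definition path_weight :: "('v \<Rightarrow> 'v \<Rightarrow> real) \<Rightarrow> 'v list \<Rightarrow> real" where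
  "path_weight w u = (\<Prod>i<path_len u. w (u ! i) (u ! Suc i))"

definition finite_paths_from :: "'v set \<Rightarrow> ('v \<Rightarrow> 'v \<Rightarrow> real) \<Rightarrow> 'v \<Rightarrow> 'v list set" where
  "finite_paths_from V w x = {u. finite_path V w u \<and> hd u = x}"

definition finite_paths_len :: "'v set \<Rightarrow> ('v \<Rightarrow> 'v \<Rightarrow> real) \<Rightarrow> 'v \<Rightarrow> nat \<Rightarrow> 'v list set" where
  "finite_paths_len V w x k = {u \<in> finite_paths_from V w x. path_len u = k}"

definition infinite_paths_from :: "'v set \<Rightarrow> ('v \<Rightarrow> 'v \<Rightarrow> real) \<Rightarrow> 'v \<Rightarrow> (nat \<Rightarrow> 'v) set" where
  "infinite_paths_from V w x =
     {\<omega>. \<omega> 0 = x \<and> (\<forall>i. \<omega> i \<in> V) \<and> (\<forall>i. 0 < w (\<omega> i) (\<omega> (Suc i)))}"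

definition cylinder :: "'v set \<Rightarrow> ('v \<Rightarrow> 'v \<Rightarrow> real) \<Rightarrow> 'v \<Rightarrow> 'v list \<Rightarrow> (nat \<Rightarrow> 'v) set" where
  "cylinder V w x u = {\<omega> \<in> infinite_paths_from V w x. \<forall>i<length u. \<omega> i = u ! i}"

text \<open>The padding symbol is \<open>None\<close>.\<close>

definition pad_finite :: "'v list \<Rightarrow> nat \<Rightarrow> 'v option" where
  "pad_finite u = (\<lambda>n. if n < length u then Some (u ! n) else None)"

definition embed_infinite :: "(nat \<Rightarrow> 'v) \<Rightarrow> nat \<Rightarrow> 'v option" where
  "embed_infinite \<omega> = (\<lambda>n. Some (\<omega> n))"

definition all_paths_from :: "'v set \<Rightarrow> ('v \<Rightarrow> 'v \<Rightarrow> real) \<Rightarrow> 'v \<Rightarrow> (nat \<Rightarrow> 'v option) set" where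
  "all_paths_from V w x =
     pad_finite ` finite_paths_from V w x \<union> embed_infinite ` infinite_paths_from V w x"

definition infinite_paths_topology ::
    "'v set \<Rightarrow> ('v \<Rightarrow> 'v \<Rightarrow> real) \<Rightarrow> 'v \<Rightarrow> (nat \<Rightarrow> 'v) topology" where
  "infinite_paths_topology V w x =
     subtopology (product_topology (\<lambda>_. discrete_topology V) UNIV) (infinite_paths_from V w x)"

definition all_paths_topology ::
    "'v set \<Rightarrow> ('v \<Rightarrow> 'v \<Rightarrow> real) \<Rightarrow> 'v \<Rightarrow> (nat \<Rightarrow> 'v option) topology" where
  "all_paths_topology V w x =
     subtopology (product_topology (\<lambda>_. discrete_topology (insert None (Some ` V))) UNIV)
       (all_paths_from V w x)"


subsection \<open>Probability measures and weak convergence\<close>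

definition borel_of_topology :: "'a topology \<Rightarrow> 'a measure" where
  "borel_of_topology X = sigma (topspace X) {S. openin X S}"

definition borel_prob_on :: "'a topology \<Rightarrow> 'a measure \<Rightarrow> bool" where
  "borel_prob_on X M \<longleftrightarrow> prob_space M \<and> sets M = sets (borel_of_topology X)"

definition weakly_converges ::
    "'a topology \<Rightarrow> (nat \<Rightarrow> 'a measure) \<Rightarrow> 'a measure \<Rightarrow> bool" where
  "weakly_converges X M N \<longleftrightarrow>
     (\<forall>k. borel_prob_on X (M k)) \<and> borel_prob_on X N \<and>
     (\<forall>f. continuous_map X euclideanreal f \<and> bounded (f ` topspace X) \<longrightarrow>
        (\<lambda>k. integral\<^sup>L (M k) f) \<longlonglongrightarrow> integral\<^sup>L N f)"

definition partition_fn :: "'v set \<Rightarrow> ('v \<Rightarrow> 'v \<Rightarrow> real) \<Rightarrow> 'v \<Rightarrow> nat \<Rightarrow> real" where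
  "partition_fn V w x k = (\<Sum>u\<in>finite_paths_len V w x k. path_weight w u)"

text \<open>
  The measure \<open>(1 / Z) \<Sum>\<^sub>u w(u) \<delta>\<^sub>u\<close> on the space of finite and infinite paths is the image
  under padding of the discrete measure with mass \<open>w(u) / Z\<close> at \<open>u\<close>.
\<close>

definition uniform_dist ::
    "'v set \<Rightarrow> ('v \<Rightarrow> 'v \<Rightarrow> real) \<Rightarrow> 'v \<Rightarrow> nat \<Rightarrow> (nat \<Rightarrow> 'v option) measure" where
  "uniform_dist V w x k =
     distr
       (point_measure (finite_paths_len V w x k)
          (\<lambda>u. ennreal (path_weight w u / partition_fn V w x k)))
       (borel_of_topology (all_paths_topology V w x)) pad_finite"

text \<open>
  A measure on the infinite paths from \<open>x\<close> of some sub-digraph, viewed as a measure on the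
  finite and infinite paths from \<open>x\<close> of the digraph \<open>(V, w)\<close>.
\<close>

definition view_on_all_paths ::
    "'v set \<Rightarrow> ('v \<Rightarrow> 'v \<Rightarrow> real) \<Rightarrow> 'v \<Rightarrow> (nat \<Rightarrow> 'v) measure \<Rightarrow> (nat \<Rightarrow> 'v option) measure" where
  "view_on_all_paths V w x M =
     distr M (borel_of_topology (all_paths_topology V w x)) embed_infinite"


subsection \<open>Access classes and the spanned umbrella digraph\<close>

definition accessible :: "'v set \<Rightarrow> ('v \<Rightarrow> 'v \<Rightarrow> real) \<Rightarrow> 'v \<Rightarrow> 'v \<Rightarrow> bool" where
  "accessible V w x y \<longleftrightarrow> (\<exists>u. finite_path V w u \<and> hd u = x \<and> last u = y)"

definition access_classes :: "'v set \<Rightarrow> ('v \<Rightarrow> 'v \<Rightarrow> real) \<Rightarrow> 'v set set" where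
  "access_classes V w = V // {(x, y). accessible V w x y \<and> accessible V w y x}"

definition class_accessible ::
    "'v set \<Rightarrow> ('v \<Rightarrow> 'v \<Rightarrow> real) \<Rightarrow> 'v set \<Rightarrow> 'v set \<Rightarrow> bool" where
  "class_accessible V w C D \<longleftrightarrow> (\<exists>x\<in>C. \<exists>y\<in>D. accessible V w x y)"

definition basic_class :: "'v set \<Rightarrow> ('v \<Rightarrow> 'v \<Rightarrow> real) \<Rightarrow> 'v set \<Rightarrow> bool" where
  "basic_class V w C \<longleftrightarrow>
     C \<in> access_classes V w \<and> digraph_spectral_radius C w = digraph_spectral_radius V w"

definition aperiodic_class :: "('v \<Rightarrow> 'v \<Rightarrow> real) \<Rightarrow> 'v set \<Rightarrow> bool" where
  "aperiodic_class w C \<longleftrightarrow>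
     Gcd {k. \<exists>u. finite_path C w u \<and> hd u = last u \<and> path_len u = k \<and> 0 < k} = 1"

definition basic_chain :: "'v set \<Rightarrow> ('v \<Rightarrow> 'v \<Rightarrow> real) \<Rightarrow> 'v set list \<Rightarrow> bool" where
  "basic_chain V w Ls \<longleftrightarrow>
     Ls \<noteq> [] \<and> distinct Ls \<and> (\<forall>L\<in>set Ls. basic_class V w L) \<and>
     successively (class_accessible V w) Ls"

definition dominant_chain :: "'v set \<Rightarrow> ('v \<Rightarrow> 'v \<Rightarrow> real) \<Rightarrow> 'v set list \<Rightarrow> bool" where
  "dominant_chain V w Ls \<longleftrightarrow>
     basic_chain V w Ls \<and> (\<forall>Ls'. basic_chain V w Ls' \<longrightarrow> length Ls' \<le> length Ls)"

definition reachable :: "'v set \<Rightarrow> ('v \<Rightarrow> 'v \<Rightarrow> real) \<Rightarrow> 'v \<Rightarrow> 'v set" where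
  "reachable V w x = {y \<in> V. accessible V w x y}"

definition spanned_umbrella :: "'v set \<Rightarrow> ('v \<Rightarrow> 'v \<Rightarrow> real) \<Rightarrow> 'v \<Rightarrow> 'v set" where
  "spanned_umbrella V w x =
     {y \<in> reachable V w x.
        \<exists>Ls. dominant_chain (reachable V w x) w Ls \<and>
             (\<exists>z\<in>hd Ls. accessible (reachable V w x) w y z)}"


subsection \<open>Residual matrix\<close>

definition path_gen_fun :: "'v set \<Rightarrow> ('v \<Rightarrow> 'v \<Rightarrow> real) \<Rightarrow> real \<Rightarrow> 'v \<Rightarrow> 'v \<Rightarrow> real" where
  "path_gen_fun V w s x y = (\<Sum>k. mat_entry V (adj_matrix V w ^\<^sub>m k) x y * s ^ k)"

text \<open>A \<open>V\<close>-indexed matrix is given by its entries at pairs of elements of \<open>V\<close>.\<close>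

definition is_residual_matrix ::
    "'v set \<Rightarrow> ('v \<Rightarrow> 'v \<Rightarrow> real) \<Rightarrow> ('v \<Rightarrow> 'v \<Rightarrow> real) \<Rightarrow> bool" where
  "is_residual_matrix V w \<Theta> \<longleftrightarrow>
     (\<forall>x\<in>V. \<forall>y\<in>V. 0 \<le> \<Theta> x y) \<and> (\<exists>x\<in>V. \<exists>y\<in>V. \<Theta> x y \<noteq> 0) \<and>
     (let \<rho> = digraph_spectral_radius V w in
      \<exists>h::nat. 0 < h \<and>
        (\<forall>x\<in>V. \<forall>y\<in>V.
           ((\<lambda>s. (1 - \<rho> * s) ^ h * path_gen_fun V w s x y) \<longlongrightarrow> \<Theta> x y)
             (at (inverse \<rho>) within {0<..<inverse \<rho>})))"

text \<open>The entries of the product of a \<open>V\<close>-indexed matrix with the column vector filled with 1s.\<close>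

definition mult_ones :: "'v set \<Rightarrow> ('v \<Rightarrow> 'v \<Rightarrow> real) \<Rightarrow> 'v \<Rightarrow> real" where
  "mult_ones V \<Theta> x = (\<Sum>y\<in>V. \<Theta> x y)"


subsection \<open>Cocycle measures\<close>

definition cocycle :: "'v set \<Rightarrow> ('v \<Rightarrow> 'v \<Rightarrow> real) \<Rightarrow> ('v \<Rightarrow> 'v \<Rightarrow> real) \<Rightarrow> bool" where
  "cocycle V w \<Gamma> \<longleftrightarrow>
     (\<forall>x y. accessible V w x y \<longrightarrow> 0 \<le> \<Gamma> x y) \<and>
     (\<forall>x y z. accessible V w x y \<and> accessible V w y z \<longrightarrow> \<Gamma> x z = \<Gamma> x y * \<Gamma> y z)"

text \<open>\<open>\<mu>\<close> is a cocycle measure on \<open>(V, w)\<close>, for the parameter \<open>\<rho>\<close> and the cocycle \<open>\<Gamma>\<close>.\<close>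

definition cocycle_measure ::
    "'v set \<Rightarrow> ('v \<Rightarrow> 'v \<Rightarrow> real) \<Rightarrow> real \<Rightarrow> ('v \<Rightarrow> 'v \<Rightarrow> real) \<Rightarrow>
     ('v \<Rightarrow> (nat \<Rightarrow> 'v) measure) \<Rightarrow> bool" where
  "cocycle_measure V w \<rho> \<Gamma> \<mu> \<longleftrightarrow>
     0 < \<rho> \<and> cocycle V w \<Gamma> \<and>
     (\<forall>x\<in>V. borel_prob_on (infinite_paths_topology V w x) (\<mu> x) \<and>
        (\<forall>u\<in>finite_paths_from V w x.
           measure (\<mu> x) (cylinder V w x u) =
             inverse \<rho> ^ path_len u * path_weight w u * \<Gamma> x (last u)))"

definition complete_cocycle_measure ::
    "'v set \<Rightarrow> ('v \<Rightarrow> 'v \<Rightarrow> real) \<Rightarrow> real \<Rightarrow> ('v \<Rightarrow> 'v \<Rightarrow> real) \<Rightarrow>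
     ('v \<Rightarrow> (nat \<Rightarrow> 'v) measure) \<Rightarrow> bool" where
  "complete_cocycle_measure V w \<rho> \<Gamma> \<mu> \<longleftrightarrow>
     cocycle_measure V w \<rho> \<Gamma> \<mu> \<and> (\<forall>x y. accessible V w x y \<longrightarrow> 0 < \<Gamma> x y)"

definition cocycle_kernel ::
    "('v \<Rightarrow> 'v \<Rightarrow> real) \<Rightarrow> real \<Rightarrow> ('v \<Rightarrow> 'v \<Rightarrow> real) \<Rightarrow> 'v \<Rightarrow> 'v \<Rightarrow> real" where
  "cocycle_kernel w \<rho> \<Gamma> x y = inverse \<rho> * w x y * \<Gamma> x y"

text \<open>
  \<open>\<mu>\<close> is a complete cocycle measure on \<open>(V, w)\<close> with transition kernel \<open>q\<close>. Where \<open>y\<close> is not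
  accessible from \<open>x\<close>, the junk value \<open>\<Gamma> x y\<close> is multiplied by \<open>w x y = 0\<close>.
\<close>

definition complete_cocycle_measure_with_kernel ::
    "'v set \<Rightarrow> ('v \<Rightarrow> 'v \<Rightarrow> real) \<Rightarrow> ('v \<Rightarrow> 'v \<Rightarrow> real) \<Rightarrow>
     ('v \<Rightarrow> (nat \<Rightarrow> 'v) measure) \<Rightarrow> bool" where
  "complete_cocycle_measure_with_kernel V w q \<mu> \<longleftrightarrow>
     (\<exists>\<rho> \<Gamma>. complete_cocycle_measure V w \<rho> \<Gamma> \<mu> \<and>
        (\<forall>x\<in>V. \<forall>y\<in>V. q x y = cocycle_kernel w \<rho> \<Gamma> x y))"

end

theory Submission
  imports Defs
begin

text \<open>
  Write \<open>z\<^sub>y(k)\<close> for the partition function from \<open>y\<close> divided by \<open>\<rho>\<^sup>k\<close>, and \<open>H\<^sub>y(t)\<close> for the power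
  series with these coefficients. An eigenvector of \<open>F\<close> for an eigenvalue of modulus \<open>\<rho>\<close>, restricted
  to a most downstream class that its support meets, is an eigenvector of a basic class, and its
  phase is multiplied by a constant along every edge; aperiodicity makes this constant \<open>1\<close>. Hence
  \<open>\<rho>\<close> is the only eigenvalue of modulus \<open>\<rho>\<close>, and by the Jordan form \<open>z\<^sub>y(k)\<close> is a polynomial in \<open>k\<close>
  up to an exponentially small error. Such sequences are governed by the singularity of \<open>H\<^sub>y\<close> at \<open>1\<close>.

  Pairing the equation for \<open>H\<close> on an access class with the left Perron vector of the class shows
  that a basic class raises the order of the singularity by one while other classes leave it unchanged.
  So the order at \<open>y\<close> is the largest number of classes in a chain of basic classes accessible from
  \<open>y\<close>. Therefore \<open>\<Theta>\<cdot>1\<close> is a \<open>\<rho>\<close>-harmonic vector whose support is the spanned umbrella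
  digraph, and ratios of partition functions converge to ratios of its entries. This gives convergence
  on cylinders, from which weak convergence follows by approximating a continuous function from below
  by locally constant ones.
\<close>

text \<open>The residual matrix is an Abelian datum, a limit of generating functions at their
  singularity, while the uniform distributions involve single coefficients. In a periodic digraph
  the coefficients can oscillate although the Abelian limit exists; the polynomial form of the
  coefficients is what closes this gap. In return all comparisons between classes are made on
  generating functions, where the class structure becomes a triangular system of scalar equations.
  The exponent \<open>h\<close> of the residual matrix is only given as existing. It gets identified
  because positivity of a row sum of \<Theta> travels backwards along edges up to \<open>x0\<close>;
  the two-sided bounds at \<open>x0\<close> then force \<open>h\<close> to be the height. At a
  vertex outside the umbrella digraph the same exponent gives the limit 0, so prefixes that leave it
  lose their mass. Words containing the padding symbol lose theirs as soon as \<open>k\<close> is at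
  least their length.\<close>

subsection \<open>Exponential polynomials\<close>

text \<open>The added term is the entry of the \<open>k\<close>-th power of a Jordan block with
  eigenvalue \<open>z\<close>, at distance \<open>d\<close> above the diagonal. Truncated
  subtraction is harmless: for \<open>k < d\<close> the binomial vanishes. For \<open>z = 0\<close>
  the term is the indicator of \<open>k = d\<close>.\<close>

inductive exp_poly :: "complex set \<Rightarrow> (nat \<Rightarrow> complex) \<Rightarrow> bool" for L where
  zero: "exp_poly L (\<lambda>_. 0)"
| step: "z \<in> L \<Longrightarrow> exp_poly L f \<Longrightarrow> exp_poly L (\<lambda>k. c * of_nat (k choose d) * z ^ (k - d) + f k)"

lemma exp_poly_add:
  assumes "exp_poly L f" "exp_poly L g"
  shows "exp_poly L (\<lambda>k. f k + g k)"
  using assms(1)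
proof induction
  case (step z f c d)
  then show ?case
    using exp_poly.step[OF step.hyps(1) step.IH, of c d] by (simp add: add.assoc)
qed (use assms(2) in simp)

lemma exp_poly_mult_left:
  assumes "exp_poly L f"
  shows "exp_poly L (\<lambda>k. a * f k)"
  using assms
proof induction
  case zero
  then show ?case by (simp add: exp_poly.zero)
next
  case (step z f c d)
  then show ?case
    using exp_poly.step[OF step.hyps(1) step.IH, of "a * c" d] by (simp add: algebra_simps)
qed

lemma exp_poly_sum:
  assumes "\<And>i. i \<in> I \<Longrightarrow> exp_poly L (f i)"
  shows "exp_poly L (\<lambda>k. \<Sum>i\<in>I. f i k)"
  using assms by (induction I rule: infinite_finite_induct) (auto intro: exp_poly.zero exp_poly_add)

lemma exp_poly_basis: "z \<in> L \<Longrightarrow> exp_poly L (\<lambda>k. of_nat (k choose d) * z ^ (k - d))"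
  using exp_poly.step[OF _ exp_poly.zero, of z L 1 d] by simp

text \<open>The generalized binomial series with exponent \<open>- (d + 1)\<close>, shifted by
  \<open>d\<close> places; the first \<open>d\<close> coefficients are 0. The exact rational form is
  the reason for expanding in binomials rather than in powers of \<open>k\<close>.\<close>

lemma binomial_powser_sums:
  fixes t :: real
  assumes "\<bar>t\<bar> < 1"
  shows "(\<lambda>k. real (k choose d) * t ^ k) sums (t ^ d / (1 - t) ^ Suc d)"
proof -
  have "(\<lambda>n. (- real (Suc d) gchoose n) * (- t) ^ n) sums (1 + (- t)) powr (- real (Suc d))"
    using assms by (intro gen_binomial_real) simp
  moreover have "(- real (Suc d) gchoose n) * (- t) ^ n = real ((n + d) choose d) * t ^ n" for n
  proof -
    have "(- real (Suc d) gchoose n) = (- 1) ^ n * (real (n + d) gchoose n)"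
      by (subst gbinomial_negated_upper) (simp add: algebra_simps)
    also have "real (n + d) gchoose n = real ((n + d) choose d)"
      using binomial_symmetric[of n "n + d"] by (simp add: binomial_gbinomial[symmetric] flip: of_nat_add)
    finally have "(- real (Suc d) gchoose n) * (- t) ^ n
        = ((- 1) ^ n * (- 1) ^ n) * (real ((n + d) choose d) * t ^ n)"
      by (simp only: power_minus[of t] ac_simps)
    also have "(- 1 :: real) ^ n * (- 1) ^ n = 1"
      by (simp only: power_mult_distrib[symmetric]) simp
    finally show ?thesis by simp
  qed
  moreover have "(1 + (- t)) powr (- real (Suc d)) = 1 / (1 - t) ^ Suc d"
    using assms by (simp add: powr_minus powr_realpow divide_inverse flip: of_nat_Suc del: of_nat_Suc power_Suc)
  ultimately have "(\<lambda>n. real ((n + d) choose d) * t ^ n) sums (1 / (1 - t) ^ Suc d)"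
    by simp
  then have "(\<lambda>n. t ^ d * (real ((n + d) choose d) * t ^ n)) sums (t ^ d * (1 / (1 - t) ^ Suc d))"
    by (rule sums_mult)
  then have "(\<lambda>n. real ((n + d) choose d) * t ^ (n + d)) sums (t ^ d / (1 - t) ^ Suc d)"
    by (simp add: power_add algebra_simps)
  moreover have "(\<Sum>k<d. real (k choose d) * t ^ k) = 0"
    by (intro sum.neutral) simp
  ultimately show ?thesis
    using sums_iff_shift[of "\<lambda>k. real (k choose d) * t ^ k" d] by simp
qed

text \<open>These are the terms of a convergent series, so they tend to 0.\<close>

lemma binomial_times_power_bounded:
  fixes q :: real
  assumes "0 \<le> q" "q < 1"
  obtains B where "B \<ge> 0" "\<And>k. real (k choose d) * q ^ k \<le> B"
proof -
  have "(\<lambda>k. real (k choose d) * q ^ k) \<longlonglongrightarrow> 0"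
    by (rule summable_LIMSEQ_zero) (use binomial_powser_sums[of q d] assms in \<open>auto simp: sums_iff\<close>)
  then have "Bseq (\<lambda>k. real (k choose d) * q ^ k)"
    by (intro convergent_imp_Bseq convergentI)
  then obtain B where B: "\<And>k. norm (real (k choose d) * q ^ k) \<le> B"
    unfolding Bseq_def by blast
  show ?thesis
    using that[of B] abs_le_D1[OF B[unfolded real_norm_def]] order_trans[OF norm_ge_zero B] by blast
qed

text \<open>The gap between \<open>norm z\<close> and \<open>r\<close> absorbs the polynomial
  factor.\<close>

lemma exp_poly_basis_bound:
  fixes z :: complex
  assumes "norm z < r"
  obtains B where "B \<ge> 0" "\<And>k. norm (of_nat (k choose d) * z ^ (k - d)) \<le> B * r ^ k"
proof (cases "z = 0")
  case True
  have r: "r > 0" using assms by (simp add: True)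
  show ?thesis
  \<comment> \<open>For \<open>z = 0\<close> only \<open>k = d\<close> gives a nonzero term, and
    there its value is 1.\<close>
  proof (rule that[of "1 / r ^ d"])
    fix k
    show "norm (of_nat (k choose d) * z ^ (k - d)) \<le> 1 / r ^ d * r ^ k"
      using r by (cases k d rule: linorder_cases) (auto simp: True binomial_eq_0 power_0_left)
  qed (use r in simp)
next
  case False
  have r: "r > 0" using assms norm_ge_zero[of z] by linarith
  define q where "q = norm z / r"
  have q: "0 \<le> q" "q < 1" using r assms by (auto simp: q_def)
  obtain B where B: "B \<ge> 0" "\<And>k. real (k choose d) * q ^ k \<le> B"
    using binomial_times_power_bounded[OF q] by blast
  show ?thesis
  proof (rule that[of "B / norm z ^ d"])
    fix k
    show "norm (of_nat (k choose d) * z ^ (k - d)) \<le> B / norm z ^ d * r ^ k"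
    proof (cases "d \<le> k")
      case True
      have "norm (of_nat (k choose d) * z ^ (k - d)) = real (k choose d) * norm z ^ k / norm z ^ d"
        using True False by (simp add: norm_mult norm_divide norm_power power_diff)
      also have "\<dots> = (real (k choose d) * q ^ k) * r ^ k / norm z ^ d"
        using r by (simp add: q_def power_divide)
      also have "\<dots> \<le> B * r ^ k / norm z ^ d"
        using B(2)[of k] r by (intro divide_right_mono mult_right_mono) auto
      finally show ?thesis by simp
    next
      case F: False
      then show ?thesis using B(1) r by (simp add: binomial_eq_0)
    qed
  qed (use B(1) in simp)
qed

lemma exp_poly_bound:
  assumes "exp_poly L f" "\<And>z. z \<in> L \<Longrightarrow> norm z < r"
  shows "\<exists>B\<ge>0. \<forall>k. norm (f k) \<le> B * r ^ k"
  using assms(1)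
proof induction
  case zero
  then show ?case by (auto intro!: exI[of _ 0])
next
  case (step z f c d)
  obtain B where B: "B \<ge> 0" "\<And>k. norm (f k) \<le> B * r ^ k"
    using step.IH by blast
  obtain B' where B': "B' \<ge> 0" "\<And>k. norm (of_nat (k choose d) * z ^ (k - d)) \<le> B' * r ^ k"
    using exp_poly_basis_bound[OF assms(2)[OF step.hyps(1)]] by metis
  show ?case
  proof (intro exI[of _ "norm c * B' + B"] conjI allI)
    fix k
    have "norm (c * of_nat (k choose d) * z ^ (k - d) + f k)
        \<le> norm c * norm (of_nat (k choose d) * z ^ (k - d)) + norm (f k)"
      by (metis norm_triangle_ineq norm_mult mult.assoc)
    also have "\<dots> \<le> norm c * (B' * r ^ k) + B * r ^ k"
      by (intro add_mono mult_left_mono B B') auto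
    finally show "norm (c * of_nat (k choose d) * z ^ (k - d) + f k) \<le> (norm c * B' + B) * r ^ k"
      by (simp add: algebra_simps)
  qed (use B(1) B'(1) in auto)
qed

text \<open>After division by \<rho> to the power \<open>k\<close>, each term with
  \<open>z = \<rho>\<close> is a constant multiple of a binomial, and each remaining term decays
  geometrically.\<close>

lemma exp_poly_dominant:
  assumes "exp_poly L f" and \<rho>: "0 < \<rho>"
    and L: "\<And>z. z \<in> L \<Longrightarrow> z = complex_of_real \<rho> \<or> norm z < \<rho>"
  shows "\<exists>I a r B. finite I \<and> 0 < r \<and> r < 1 \<and>
    (\<forall>k. norm (f k / of_real \<rho> ^ k - (\<Sum>d\<in>I. a d * of_nat (k choose d))) \<le> B * r ^ k)"
  using assms(1)
proof induction
  case zero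
  show ?case by (intro exI[of _ "{}"] exI[of _ "\<lambda>_. 0"] exI[of _ "1/2"] exI[of _ 0]) auto
next
  case (step z f c d)
  from step.IH obtain I a r B where IH: "finite I" "0 < r" "r < 1"
    "\<And>k. norm (f k / of_real \<rho> ^ k - (\<Sum>d\<in>I. a d * of_nat (k choose d))) \<le> B * r ^ k"
    by blast
  show ?case
  proof (cases "z = of_real \<rho>")
    case True
    define c' where "c' = c / of_real \<rho> ^ d"
    \<comment> \<open>The degree \<open>d\<close> may already occur in \<open>I\<close>, so the two
      coefficients are added; outside \<open>I\<close> the value of \<open>a\<close> is arbitrary
      and must count as 0.\<close>
    define a' where "a' e = (if e \<in> I then a e else 0) + (if e = d then c' else 0)" for e
    have eq: "(c * of_nat (k choose d) * z ^ (k - d) + f k) / of_real \<rho> ^ k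
        - (\<Sum>d\<in>insert d I. a' d * of_nat (k choose d))
       = f k / of_real \<rho> ^ k - (\<Sum>d\<in>I. a d * of_nat (k choose d))" for k
    proof -
      have 1: "c * of_nat (k choose d) * z ^ (k - d) / of_real \<rho> ^ k = c' * of_nat (k choose d)"
      proof (cases "d \<le> k")
        case le: True
        then show ?thesis using \<rho>
          by (simp add: True c'_def power_diff)
      qed (simp add: binomial_eq_0)
      have "(\<Sum>e\<in>insert d I. a' e * of_nat (k choose e))
          = (\<Sum>e\<in>insert d I. (if e \<in> I then a e * of_nat (k choose e) else 0))
            + (\<Sum>e\<in>insert d I. (if e = d then c' * of_nat (k choose e) else 0))"
        unfolding sum.distrib[symmetric] by (intro sum.cong) (auto simp: a'_def algebra_simps)
      also have "(\<Sum>e\<in>insert d I. (if e \<in> I then a e * of_nat (k choose e) else 0))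
          = (\<Sum>e\<in>I. a e * of_nat (k choose e))"
        using IH(1) by (intro sum.mono_neutral_cong_right) auto
      also have "(\<Sum>e\<in>insert d I. (if e = d then c' * of_nat (k choose e) else 0)) = c' * of_nat (k choose d)"
        using IH(1) by (subst sum.delta) auto
      finally show ?thesis
        by (simp add: add_divide_distrib 1)
    qed
    show ?thesis
      by (intro exI[of _ "insert d I"] exI[of _ a'] exI[of _ r] exI[of _ B])
        (use IH eq in auto)
  next
    case False
    then have "norm z < \<rho>" using L step.hyps by blast
    then obtain r0 where r0: "norm z < r0" "r0 < \<rho>" using dense by blast
    have r0p: "0 < r0" using r0 norm_ge_zero[of z] by linarith
    obtain B' where B': "B' \<ge> 0" "\<And>k. norm (of_nat (k choose d) * z ^ (k - d)) \<le> B' * r0 ^ k"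
      using exp_poly_basis_bound[OF r0(1)] by metis
    \<comment> \<open>A common decay rate for the old error and the new term. The sign of
      \<open>B\<close> is not recorded, hence its absolute value in the bound.\<close>
    define s where "s = max r (r0 / \<rho>)"
    have s: "0 < s" "s < 1" using IH r0 \<rho> by (auto simp: s_def)
    have "norm ((c * of_nat (k choose d) * z ^ (k - d) + f k) / of_real \<rho> ^ k
        - (\<Sum>d\<in>I. a d * of_nat (k choose d))) \<le> (norm c * B' + \<bar>B\<bar>) * s ^ k" for k
    proof -
      have "norm ((c * of_nat (k choose d) * z ^ (k - d) + f k) / of_real \<rho> ^ k
          - (\<Sum>d\<in>I. a d * of_nat (k choose d)))
          = norm (c * (of_nat (k choose d) * z ^ (k - d)) / of_real \<rho> ^ k
            + (f k / of_real \<rho> ^ k - (\<Sum>d\<in>I. a d * of_nat (k choose d))))"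
        by (simp add: algebra_simps add_divide_distrib)
      also have "\<dots> \<le> norm c * norm (of_nat (k choose d) * z ^ (k - d)) / \<rho> ^ k + B * r ^ k"
        using \<rho> by (intro order_trans[OF norm_triangle_ineq] add_mono IH)
          (simp add: norm_mult norm_divide norm_power)
      also have "\<dots> \<le> norm c * (B' * r0 ^ k) / \<rho> ^ k + \<bar>B\<bar> * s ^ k"
        using \<rho> s IH
        by (intro add_mono divide_right_mono mult_left_mono B' mult_mono power_mono) (auto simp: s_def)
      also have "norm c * (B' * r0 ^ k) / \<rho> ^ k = norm c * B' * (r0 / \<rho>) ^ k"
        by (simp add: power_divide)
      also have "\<dots> \<le> norm c * B' * s ^ k"
        using B'(1) r0p \<rho> by (intro mult_left_mono power_mono) (auto simp: s_def)
      finally show ?thesis by (simp add: algebra_simps)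
    qed
    then show ?thesis
      using IH(1) s by (intro exI[of _ I] exI[of _ a] exI[of _ s] exI[of _ "norm c * B' + \<bar>B\<bar>"]) auto
  qed
qed

subsection \<open>From Abelian to coefficient asymptotics\<close>

lemma real_exp_poly_dominant:
  fixes f :: "nat \<Rightarrow> real"
  assumes "exp_poly L (\<lambda>k. complex_of_real (f k))" and \<rho>: "0 < \<rho>"
    and L: "\<And>z. z \<in> L \<Longrightarrow> z = complex_of_real \<rho> \<or> norm z < \<rho>"
  obtains I a r B where "finite I" "0 < r" "r < 1"
    "\<And>k. \<bar>f k / \<rho> ^ k - (\<Sum>d\<in>I. a d * real (k choose d))\<bar> \<le> B * r ^ k"
proof -
  obtain I a r B where *: "finite I" "0 < r" "r < 1"
    "\<And>k. norm (complex_of_real (f k) / of_real \<rho> ^ k - (\<Sum>d\<in>I. a d * of_nat (k choose d))) \<le> B * r ^ k"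
    using exp_poly_dominant[OF assms] by blast
  show ?thesis
  proof (rule that[OF *(1-3)])
    fix k
    have "f k / \<rho> ^ k - (\<Sum>d\<in>I. Re (a d) * real (k choose d))
      = Re (complex_of_real (f k) / of_real \<rho> ^ k - (\<Sum>d\<in>I. a d * of_nat (k choose d)))"
      by (simp flip: of_real_power of_real_divide)
    also have "\<bar>\<dots>\<bar> \<le> B * r ^ k"
      using *(4)[of k] abs_Re_le_cmod order_trans by blast
    finally show "\<bar>f k / \<rho> ^ k - (\<Sum>d\<in>I. Re (a d) * real (k choose d))\<bar> \<le> B * r ^ k" .
  qed
qed

text \<open>Induction through \<open>(d + 1) * (k choose (d + 1)) = (k - d) * (k choose d)\<close>,
  read over the reals.\<close>

lemma binomial_over_power_tendsto:
  "(\<lambda>k. real (k choose d) / real k ^ d) \<longlonglongrightarrow> 1 / fact d"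
proof (induction d)
  case (Suc d)
  have "(\<lambda>k. (real k - real d) / real k / real (Suc d)) \<longlonglongrightarrow> 1 / real (Suc d)"
  proof (rule tendsto_divide)
    show "(\<lambda>k. (real k - real d) / real k) \<longlonglongrightarrow> 1" by real_asymp
  qed simp_all
  from tendsto_mult[OF Suc this]
  have "(\<lambda>k. real (k choose d) / real k ^ d * ((real k - real d) / real k / real (Suc d)))
      \<longlonglongrightarrow> 1 / fact (Suc d)"
    by (simp only: fact_Suc of_nat_mult divide_inverse mult_1 inverse_mult_distrib ac_simps)
  moreover have "real (k choose d) / real k ^ d * ((real k - real d) / real k / real (Suc d))
      = real (k choose Suc d) / real k ^ Suc d" for k
  proof -
    have "real (Suc d) * real (k choose Suc d) = (real k - real d) * real (k choose d)"
    proof (cases "d \<le> k")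
      case True
      then show ?thesis
        using binomial_absorb_comp[of k d] binomial_absorption[of d k]
        by (metis of_nat_diff of_nat_mult)
    qed (simp add: binomial_eq_0)
    then have "(real k - real d) * real (k choose d) / real (Suc d) = real (k choose Suc d)"
      by (metis nonzero_mult_div_cancel_left of_nat_neq_0)
    moreover have "x / y * (u / v / s) = u * x / s / (y * v)" for x y u v s :: real
      by (simp add: divide_inverse ac_simps)
    ultimately show ?thesis by (simp only: power_Suc2)
  qed
  ultimately show ?case by simp
qed simp

lemma binomial_over_larger_power_tendsto:
  assumes "d < n"
  shows "(\<lambda>k. real (k choose d) / real k ^ n) \<longlonglongrightarrow> 0"
proof -
  have "(\<lambda>k. (1 / real k) ^ (n - d)) \<longlonglongrightarrow> 0 ^ (n - d)"
    by (intro tendsto_power lim_1_over_n)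
  then have "(\<lambda>k. (1 / real k) ^ (n - d)) \<longlonglongrightarrow> 0"
    using assms by (simp add: power_0_left)
  from tendsto_mult[OF binomial_over_power_tendsto[of d] this]
  have "(\<lambda>k. real (k choose d) / real k ^ d * (1 / real k) ^ (n - d)) \<longlonglongrightarrow> 0"
    by simp
  moreover have "real (k choose d) / real k ^ d * (1 / real k) ^ (n - d) = real (k choose d) / real k ^ n" for k
    using assms by (simp add: power_one_over flip: power_add)
  ultimately show ?thesis by simp
qed

text \<open>A polynomial in the binomial basis plus an exponentially small error. Coefficients
  \<open>a d\<close> may be 0 for \<open>d \<in> I\<close>, so the degree is not read off from
  \<open>I\<close>.\<close>

locale dominant_expansion =
  fixes z :: "nat \<Rightarrow> real" and I :: "nat set" and a :: "nat \<Rightarrow> real" and r B :: real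
  assumes fin: "finite I" and r: "0 < r" "r < 1"
    and bound: "\<And>k. \<bar>z k - (\<Sum>d\<in>I. a d * real (k choose d))\<bar> \<le> B * r ^ k"
begin

definition "err k = z k - (\<Sum>d\<in>I. a d * real (k choose d))"

lemma B_nonneg: "0 \<le> B"
  using bound[of 0] by simp

text \<open>The error is dominated by a geometric series with ratio \<open>r < 1\<close>, uniformly
  in \<open>t\<close>. It thus contributes a bounded function near 1 and cannot influence a pole
  there.\<close>

lemma err_summable:
  assumes "0 \<le> t" "t < 1"
  shows "summable (\<lambda>k. err k * t ^ k)" and "\<bar>\<Sum>k. err k * t ^ k\<bar> \<le> B / (1 - r)"
proof -
  have le: "norm (err k * t ^ k) \<le> B * r ^ k" for k
  proof -
    have "\<bar>err k\<bar> * t ^ k \<le> (B * r ^ k) * 1"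
      using bound[of k] assms B_nonneg r by (intro mult_mono) (auto simp: err_def power_le_one)
    then show ?thesis using assms by (simp add: abs_mult)
  qed
  have s: "(\<lambda>k. B * r ^ k) sums (B * (1 / (1 - r)))"
    using r by (intro sums_mult geometric_sums) auto
  show "summable (\<lambda>k. err k * t ^ k)"
    by (rule summable_comparison_test'[OF sums_summable[OF s] le])
  have "norm (\<Sum>k. err k * t ^ k) \<le> (\<Sum>k. B * r ^ k)"
    by (rule norm_suminf_le) (use le s in \<open>auto simp: sums_iff\<close>)
  also have "\<dots> = B / (1 - r)" using s by (simp add: sums_iff)
  finally show "\<bar>\<Sum>k. err k * t ^ k\<bar> \<le> B / (1 - r)" by simp
qed

lemma gen_fun_sums:
  assumes "0 \<le> t" "t < 1"
  shows "(\<lambda>k. z k * t ^ k) sums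
    ((\<Sum>d\<in>I. a d * (t ^ d / (1 - t) ^ Suc d)) + (\<Sum>k. err k * t ^ k))"
proof -
  have "(\<lambda>k. \<Sum>d\<in>I. a d * (real (k choose d) * t ^ k)) sums (\<Sum>d\<in>I. a d * (t ^ d / (1 - t) ^ Suc d))"
    using assms by (intro sums_sum sums_mult binomial_powser_sums) auto
  from sums_add[OF this summable_sums[OF err_summable(1)[OF assms]]]
  show ?thesis
    by (rule back_subst[where P = "\<lambda>f. f sums _"])
      (auto simp: err_def sum_distrib_right sum_distrib_left algebra_simps)
qed

lemma summable_gen_fun: "0 \<le> t \<Longrightarrow> t < 1 \<Longrightarrow> summable (\<lambda>k. z k * t ^ k)"
  using gen_fun_sums by (auto simp: sums_iff)

text \<open>A nonzero term of degree \<open>d\<close> has a pole of order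
  \<open>d + 1 \<le> n\<close> at 1, so the factor \<open>(1 - t) ^ n\<close> kills everything
  except the term of degree \<open>n - 1\<close>. If that term is missing, the order is below
  \<open>n\<close> and the limit is 0.\<close>

lemma top_coefficient_tendsto:
  assumes n: "\<And>d. d \<in> I \<Longrightarrow> a d \<noteq> 0 \<Longrightarrow> d < n" "0 < n"
  shows "((\<lambda>t. (1 - t) ^ n * (\<Sum>k. z k * t ^ k)) \<longlongrightarrow> (if n - 1 \<in> I then a (n - 1) else 0)) (at_left 1)"
proof -
  have ev: "\<forall>\<^sub>F t::real in at_left 1. 0 \<le> t \<and> t < 1"
    using eventually_at_left_real[of 0 1] by (auto elim: eventually_mono)
  have one: "((\<lambda>t::real. 1 - t) \<longlongrightarrow> 0) (at_left 1)"
    by (rule tendsto_eq_intros refl | simp)+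
  have err: "((\<lambda>t. (1 - t) ^ n * (\<Sum>k. err k * t ^ k)) \<longlongrightarrow> 0) (at_left 1)"
  proof (rule Lim_null_comparison)
    show "\<forall>\<^sub>F t in at_left 1. norm ((1 - t) ^ n * (\<Sum>k. err k * t ^ k)) \<le> (1 - t) ^ n * (B / (1 - r))"
      using ev
    proof eventually_elim
      case (elim t)
      then have "(1 - t) ^ n * \<bar>\<Sum>k. err k * t ^ k\<bar> \<le> (1 - t) ^ n * (B / (1 - r))"
        by (intro mult_left_mono err_summable(2)) auto
      then show ?case using elim by (simp add: abs_mult)
    qed
    show "((\<lambda>t. (1 - t) ^ n * (B / (1 - r))) \<longlongrightarrow> 0) (at_left 1)"
      using n(2) r by (auto intro!: tendsto_eq_intros one simp: power_0_left)
  qed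
  have main: "((\<lambda>t. \<Sum>d\<in>I. a d * t ^ d * (1 - t) ^ (n - Suc d)) \<longlongrightarrow>
      (\<Sum>d\<in>I. a d * 1 ^ d * 0 ^ (n - Suc d))) (at_left 1)"
    by (intro tendsto_sum tendsto_mult tendsto_power one tendsto_const tendsto_ident_at)
  have "(\<Sum>d\<in>I. a d * 1 ^ d * 0 ^ (n - Suc d)) = (\<Sum>d\<in>I. if d = n - 1 then a d else 0)"
  proof (rule sum.cong)
    fix d assume "d \<in> I"
    then show "a d * 1 ^ d * 0 ^ (n - Suc d) = (if d = n - 1 then a d else 0)"
      using n(1)[of d] n(2) by (cases "a d = 0") (auto simp: power_0_left)
  qed simp
  also have "\<dots> = (if n - 1 \<in> I then a (n - 1) else 0)"
    using fin by (simp add: sum.delta')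
  finally have main': "((\<lambda>t. (\<Sum>d\<in>I. a d * t ^ d * (1 - t) ^ (n - Suc d))
      + (1 - t) ^ n * (\<Sum>k. err k * t ^ k)) \<longlongrightarrow> (if n - 1 \<in> I then a (n - 1) else 0)) (at_left 1)"
    using tendsto_add[OF main err] by simp
  show ?thesis
  proof (rule Lim_transform_eventually[OF main'], use ev in eventually_elim)
    case (elim t)
    have "(\<Sum>d\<in>I. a d * t ^ d * (1 - t) ^ (n - Suc d))
        = (1 - t) ^ n * (\<Sum>d\<in>I. a d * (t ^ d / (1 - t) ^ Suc d))"
      unfolding sum_distrib_left
    proof (rule sum.cong)
      fix d assume "d \<in> I"
      then show "a d * t ^ d * (1 - t) ^ (n - Suc d) = (1 - t) ^ n * (a d * (t ^ d / (1 - t) ^ Suc d))"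
        using n(1)[of d] elim by (cases "a d = 0") (auto simp: power_diff simp del: power_Suc)
    qed simp
    then show ?case
      using gen_fun_sums[of t] elim by (simp add: sums_iff distrib_left)
  qed
qed

text \<open>The passage from Abelian to coefficient asymptotics. If some nonzero term had degree at
  least \<open>h\<close>, the largest such degree \<open>m\<close> would make the limit at order
  \<open>m + 1\<close> equal to \<open>a m \<noteq> 0\<close>, while the finite limit at the smaller
  order \<open>h\<close> makes it 0. So all degrees are below \<open>h\<close>, and \<open>c\<close>
  is the coefficient of degree \<open>h - 1\<close>, possibly 0.\<close>

lemma coefficient_tendsto:
  assumes lim: "((\<lambda>t. (1 - t) ^ h * (\<Sum>k. z k * t ^ k)) \<longlongrightarrow> c) (at_left 1)" and h: "0 < h"
  shows "(\<lambda>k. z k / real k ^ (h - 1)) \<longlonglongrightarrow> c / fact (h - 1)"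
proof -
  have small: "d < h" if "d \<in> I" "a d \<noteq> 0" for d
  proof (rule ccontr)
    assume "\<not> d < h"
    define S where "S = {d \<in> I. a d \<noteq> 0}"
    define m where "m = Max S"
    have S: "finite S" "d \<in> S" using fin that by (auto simp: S_def)
    then have m: "m \<in> S" "\<And>e. e \<in> S \<Longrightarrow> e \<le> m" unfolding m_def by (auto intro: Max_in)
    have "h \<le> m" using m(2)[OF S(2)] \<open>\<not> d < h\<close> by simp
    have "((\<lambda>t. (1 - t) ^ Suc m * (\<Sum>k. z k * t ^ k)) \<longlongrightarrow> (if Suc m - 1 \<in> I then a (Suc m - 1) else 0)) (at_left 1)"
      by (rule top_coefficient_tendsto) (use m in \<open>auto simp: S_def less_Suc_eq_le\<close>)
    then have "((\<lambda>t. (1 - t) ^ Suc m * (\<Sum>k. z k * t ^ k)) \<longlongrightarrow> a m) (at_left 1)"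
      using m(1) by (simp add: S_def)
    moreover have "((\<lambda>t. (1 - t) ^ (Suc m - h) * ((1 - t) ^ h * (\<Sum>k. z k * t ^ k))) \<longlongrightarrow>
        (1 - 1) ^ (Suc m - h) * c) (at_left 1)"
      by (intro tendsto_mult lim tendsto_power tendsto_diff tendsto_const tendsto_ident_at)
    moreover have "(1 - t) ^ (Suc m - h) * ((1 - t) ^ h * x) = (1 - t) ^ Suc m * x" for t x :: real
      using \<open>h \<le> m\<close> by (simp flip: power_add mult.assoc del: power_Suc)
    ultimately have "a m = (1 - 1) ^ (Suc m - h) * c"
      by (metis (no_types, lifting) tendsto_unique trivial_limit_at_left_real ext)
    then show False
      using m(1) \<open>h \<le> m\<close> by (simp add: S_def power_0_left)
  qed
  have c: "c = (if h - 1 \<in> I then a (h - 1) else 0)"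
    using tendsto_unique[OF _ lim top_coefficient_tendsto[OF small h]] by simp
  have "(\<lambda>k. B * r ^ k) \<longlonglongrightarrow> B * 0"
    using r by (intro tendsto_mult LIMSEQ_power_zero tendsto_const) auto
  then have "(\<lambda>k. B * r ^ k) \<longlonglongrightarrow> 0" by simp
  then have err: "(\<lambda>k. err k / real k ^ (h - 1)) \<longlonglongrightarrow> 0"
  proof (rule Lim_null_comparison[rotated])
    show "\<forall>\<^sub>F k in sequentially. norm (err k / real k ^ (h - 1)) \<le> B * r ^ k"
      using eventually_gt_at_top[of 0]
    proof eventually_elim
      case (elim k)
      then have "1 \<le> real k ^ (h - 1)" by (intro one_le_power) simp
      then have "\<bar>err k\<bar> / real k ^ (h - 1) \<le> \<bar>err k\<bar> / 1"
        using elim by (intro divide_left_mono) auto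
      then show ?case using bound[of k] by (simp add: err_def)
    qed
  qed
  have "(\<lambda>k. a d * (real (k choose d) / real k ^ (h - 1))) \<longlonglongrightarrow> (if d = h - 1 then a d / fact d else 0)"
    if "d \<in> I" for d
  proof (cases "a d = 0")
    case True
    then show ?thesis by (cases "d = h - 1") auto
  next
    case False
    from small[OF that False] h consider "d = h - 1" | "d < h - 1" by linarith
    then show ?thesis
    proof cases
      case 1
      then show ?thesis
        using tendsto_mult[OF tendsto_const[of "a d"] binomial_over_power_tendsto[of d]] by simp
    next
      case 2
      then show ?thesis
        using tendsto_mult[OF tendsto_const[of "a d"] binomial_over_larger_power_tendsto[OF 2]] by simp
    qed
  qed
  then have "(\<lambda>k. \<Sum>d\<in>I. a d * (real (k choose d) / real k ^ (h - 1))) \<longlonglongrightarrow>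
      (\<Sum>d\<in>I. if d = h - 1 then a d / fact d else 0)"
    by (rule tendsto_sum)
  from tendsto_add[OF this err]
  have "(\<lambda>k. (\<Sum>d\<in>I. a d * (real (k choose d) / real k ^ (h - 1))) + err k / real k ^ (h - 1))
      \<longlonglongrightarrow> c / fact (h - 1)"
    using fin by (auto simp: c split: if_splits)
  moreover have "(\<Sum>d\<in>I. a d * (real (k choose d) / real k ^ (h - 1))) + err k / real k ^ (h - 1)
      = z k / real k ^ (h - 1)" for k
    by (simp add: err_def sum_divide_distrib diff_divide_distrib)
  ultimately show ?thesis by simp
qed

end

subsection \<open>The adjacency operator\<close>

text \<open>Acting on functions of vertices confines the enumeration of \<open>S\<close> to the
  lemmas on matrix powers and spectra.\<close>

definition adj_op :: "'v set \<Rightarrow> ('v \<Rightarrow> 'v \<Rightarrow> real) \<Rightarrow> ('v \<Rightarrow> real) \<Rightarrow> 'v \<Rightarrow> real" where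
  "adj_op S w g x = (\<Sum>y\<in>S. w x y * g y)"

definition adj_spectrum :: "'v set \<Rightarrow> ('v \<Rightarrow> 'v \<Rightarrow> real) \<Rightarrow> complex set" where
  "adj_spectrum S w = spectrum (map_mat complex_of_real (adj_matrix S w))"

lemma adj_matrix_carrier [simp]: "adj_matrix S w \<in> carrier_mat (card S) (card S)"
  by (simp add: adj_matrix_def)

lemma sum_enumeration:
  assumes "finite S"
  shows "(\<Sum>i<card S. f (from_nat_into S i)) = (\<Sum>y\<in>S. f y)"
proof -
  have b: "bij_betw (to_nat_on S) S {..<card S}"
    by (rule to_nat_on_finite[OF assms])
  have "(\<Sum>i<card S. f (from_nat_into S i)) = (\<Sum>y\<in>S. f (from_nat_into S (to_nat_on S y)))"
    by (rule sum.reindex_bij_betw[OF b, symmetric])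
  also have "\<dots> = (\<Sum>y\<in>S. f y)"
    using assms by (intro sum.cong) (auto simp: countable_finite)
  finally show ?thesis .
qed

lemma to_nat_on_less_card: "finite S \<Longrightarrow> x \<in> S \<Longrightarrow> to_nat_on S x < card S"
  using to_nat_on_finite[of S] by (auto simp: bij_betw_def)

lemma from_nat_into_less_card: "finite S \<Longrightarrow> i < card S \<Longrightarrow> from_nat_into S i \<in> S"
  by (metis card.empty from_nat_into not_less_zero)

lemma to_nat_on_from_nat_into_less: "finite S \<Longrightarrow> i < card S \<Longrightarrow> to_nat_on S (from_nat_into S i) = i"
  using to_nat_on_finite[of S] by (auto simp: bij_betw_def intro!: to_nat_on_from_nat_into)

text \<open>The induction peels off the innermost application of the operator, because
  \<open>^\<^sub>m\<close> multiplies the new factor on the right.\<close>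

lemma funpow_adj_op:
  assumes fin: "finite S" and x: "x \<in> S"
  shows "((adj_op S w) ^^ k) g x = (\<Sum>y\<in>S. mat_entry S (adj_matrix S w ^\<^sub>m k) x y * g y)"
proof (induction k arbitrary: g)
  case 0
  have "mat_entry S (adj_matrix S w ^\<^sub>m 0) x y = (if x = y then 1 else 0)" if "y \<in> S" for y
    using x that fin to_nat_on_less_card[OF fin] countable_finite[OF fin]
    by (auto simp: mat_entry_def adj_matrix_def)
  then show ?case
    using fin x by (simp add: if_distrib[of "\<lambda>c. c * _"] sum.delta cong: if_cong sum.cong)
next
  case (Suc k)
  have entry: "mat_entry S (adj_matrix S w ^\<^sub>m Suc k) x z
      = (\<Sum>y\<in>S. mat_entry S (adj_matrix S w ^\<^sub>m k) x y * w y z)" if z: "z \<in> S" for z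
  proof -
    have "mat_entry S (adj_matrix S w ^\<^sub>m Suc k) x z
        = (\<Sum>i<card S. (adj_matrix S w ^\<^sub>m k) $$ (to_nat_on S x, i) * adj_matrix S w $$ (i, to_nat_on S z))"
      using to_nat_on_less_card[OF fin x] to_nat_on_less_card[OF fin z]
      by (simp add: mat_entry_def scalar_prod_def lessThan_atLeast0 adj_matrix_def)
    also have "\<dots> = (\<Sum>i<card S. mat_entry S (adj_matrix S w ^\<^sub>m k) x (from_nat_into S i) * w (from_nat_into S i) z)"
      using to_nat_on_less_card[OF fin z] z fin countable_finite[OF fin]
      by (intro sum.cong) (auto simp: mat_entry_def adj_matrix_def to_nat_on_from_nat_into_less)
    also have "\<dots> = (\<Sum>y\<in>S. mat_entry S (adj_matrix S w ^\<^sub>m k) x y * w y z)"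
      by (rule sum_enumeration[OF fin])
    finally show ?thesis .
  qed
  have "((adj_op S w) ^^ Suc k) g x = ((adj_op S w) ^^ k) (adj_op S w g) x"
    by (simp add: funpow_swap1)
  also have "\<dots> = (\<Sum>y\<in>S. \<Sum>z\<in>S. mat_entry S (adj_matrix S w ^\<^sub>m k) x y * (w y z * g z))"
    by (simp add: Suc adj_op_def sum_distrib_left)
  also have "\<dots> = (\<Sum>z\<in>S. \<Sum>y\<in>S. mat_entry S (adj_matrix S w ^\<^sub>m k) x y * (w y z * g z))"
    by (rule sum.swap)
  also have "\<dots> = (\<Sum>z\<in>S. mat_entry S (adj_matrix S w ^\<^sub>m Suc k) x z * g z)"
    by (intro sum.cong) (auto simp: entry sum_distrib_right mult.assoc simp del: pow_mat.simps)
  finally show ?case .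
qed

section \<open>Matrix powers through the Jordan form\<close>

lemma exp_poly_mono: "exp_poly L f \<Longrightarrow> L \<subseteq> L' \<Longrightarrow> exp_poly L' f"
  by (induction rule: exp_poly.induct) (auto intro: exp_poly.intros)

lemma exp_poly_jordan_matrix_power:
  assumes "i < sum_list (map fst n_as)" "j < sum_list (map fst n_as)"
  shows "exp_poly (snd ` set n_as) (\<lambda>k. (jordan_matrix n_as ^\<^sub>m k) $$ (i, j))"
  using assms unfolding jordan_matrix_pow
proof (induction n_as arbitrary: i j)
  case (Cons na n_as)
  obtain n a where na: "na = (n, a)" by force
  have dim: "dim_row (diag_block_mat (map (\<lambda>(n, a). jordan_block n a ^\<^sub>m k) n_as)) = sum_list (map fst n_as)"
    "dim_col (diag_block_mat (map (\<lambda>(n, a). jordan_block n a ^\<^sub>m k) n_as)) = sum_list (map fst n_as)" for k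
    by (simp_all add: dim_diag_block_mat comp_def case_prod_beta if_distrib cong: if_cong)
  consider "i < n" "j < n" | "i \<ge> n" "j \<ge> n" | "(i < n) \<noteq> (j < n)" by linarith
  then show ?case
  proof cases
    case 1
    have "exp_poly (snd ` set (na # n_as)) (\<lambda>k. if i \<le> j then of_nat (k choose (j - i)) * a ^ (k - (j - i)) else 0)"
      using exp_poly_basis[of a "snd ` set (na # n_as)" "j - i"]
      by (cases "i \<le> j") (auto simp: na exp_poly.zero)
    then show ?thesis
      using 1 Cons.prems by (simp add: na Let_def dim jordan_block_pow cong: if_cong)
  next
    case 2
    then have "i - n < sum_list (map fst n_as)" "j - n < sum_list (map fst n_as)"
      using Cons.prems by (auto simp: na)
    from exp_poly_mono[OF Cons.IH[OF this], of "snd ` set (na # n_as)"] 2 show ?thesis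
      using Cons.prems by (auto simp: na Let_def dim cong: if_cong)
  next
    case 3
    then show ?thesis
      using Cons.prems by (auto simp: na Let_def dim exp_poly.zero cong: if_cong)
  qed
qed simp

text \<open>Over the complex numbers the characteristic polynomial splits, so a Jordan form exists
  and the entries of the powers are fixed linear combinations of entries of powers of Jordan
  blocks.\<close>

lemma exp_poly_pow_mat_entry:
  fixes A :: "complex mat"
  assumes A: "A \<in> carrier_mat n n" and ij: "i < n" "j < n"
  shows "exp_poly (spectrum A) (\<lambda>k. (A ^\<^sub>m k) $$ (i, j))"
proof -
  obtain as where "char_poly A = (\<Prod>a\<leftarrow>as. [:- a, 1:])"
    using char_poly_factorized[OF A] by blast
  then obtain n_as where jnf: "jordan_nf A n_as"
    using jordan_nf_exists[OF A] by blast
  obtain P Q where PQ: "P \<in> carrier_mat n n" "Q \<in> carrier_mat n n"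
    and char: "char_poly A = (\<Prod>(na, a)\<leftarrow>n_as. [:- a, 1:] ^ na)"
    and pow: "\<And>k. A ^\<^sub>m k = P * (jordan_matrix n_as)^\<^sub>m k * Q"
    using jordan_nf_powE[OF A jnf] by metis
  have spec: "snd ` set n_as \<subseteq> spectrum A"
  proof
    fix a assume "a \<in> snd ` set n_as"
    then obtain m where m: "(m, a) \<in> set n_as" by force
    \<comment> \<open>A block of size 0 would contribute no root; \<open>jordan_nf\<close> excludes
      such blocks.\<close>
    then have "m \<noteq> 0" using jnf unfolding jordan_nf_def by force
    then have "poly ([:- a, 1:] ^ m) a = 0" by simp
    then have "poly (char_poly A) a = 0"
      unfolding char poly_prod_list prod_list_zero_iff using m by force
    then show "a \<in> spectrum A" by (simp add: spectrum_root_char_poly[OF A])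
  qed
  have n: "n = sum_list (map fst n_as)"
  proof -
    have "similar_mat A (jordan_matrix n_as)" using jnf by (simp add: jordan_nf_def)
    then obtain m where "{A, jordan_matrix n_as} \<subseteq> carrier_mat m m"
      using similar_matD by blast
    then show ?thesis
      using A by (metis carrier_matD(1) insert_subset jordan_matrix_dim(1))
  qed
  have entry: "(A ^\<^sub>m k) $$ (i, j) = (\<Sum>a<n. \<Sum>b<n. P $$ (i, a) * Q $$ (b, j) * (jordan_matrix n_as ^\<^sub>m k) $$ (a, b))" for k
  proof -
    have J: "jordan_matrix n_as ^\<^sub>m k \<in> carrier_mat n n"
      unfolding n by (rule pow_carrier_mat) simp
    show ?thesis
      unfolding pow using ij PQ J
      by (auto simp: scalar_prod_def lessThan_atLeast0 sum_distrib_left intro!: sum.cong)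
  qed
  show ?thesis
    unfolding entry
    by (intro exp_poly_sum exp_poly_mult_left exp_poly_mono[OF exp_poly_jordan_matrix_power spec])
      (auto simp: n)
qed

lemma exp_poly_funpow_adj_op:
  assumes fin: "finite S" and x: "x \<in> S"
  shows "exp_poly (adj_spectrum S w) (\<lambda>k. complex_of_real (((adj_op S w) ^^ k) g x))"
proof -
  let ?A = "map_mat complex_of_real (adj_matrix S w)"
  have eq: "complex_of_real (((adj_op S w) ^^ k) g x)
      = (\<Sum>y\<in>S. of_real (g y) * (?A ^\<^sub>m k) $$ (to_nat_on S x, to_nat_on S y))" for k
  proof -
    have A: "adj_matrix S w ^\<^sub>m k \<in> carrier_mat (card S) (card S)"
      by (rule pow_carrier_mat) simp
    show ?thesis
      using to_nat_on_less_card[OF fin] x A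
      by (auto simp: funpow_adj_op[OF fin x] mat_entry_def mult.commute carrier_matD[OF A]
          carrier_matD[OF adj_matrix_carrier] intro!: sum.cong
          simp flip: of_real_hom.mat_hom_pow[OF adj_matrix_carrier])
  qed
  show ?thesis
    unfolding eq adj_spectrum_def
    by (intro exp_poly_sum exp_poly_mult_left exp_poly_pow_mat_entry[where n = "card S"])
      (auto simp: to_nat_on_less_card[OF fin] x)
qed

lemma adj_spectrum_norm_le:
  assumes "finite S" "S \<noteq> {}" "z \<in> adj_spectrum S w"
  shows "norm z \<le> digraph_spectral_radius S w"
  unfolding digraph_spectral_radius_def
  by (rule spectral_radius_mem_max(2)[of _ "card S"]) (use assms in \<open>auto simp: adj_spectrum_def card_gt_0_iff\<close>)

lemma digraph_spectral_radius_attained: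
  assumes "finite S" "S \<noteq> {}"
  obtains z where "z \<in> adj_spectrum S w" "norm z = digraph_spectral_radius S w"
proof -
  have "digraph_spectral_radius S w \<in> norm ` adj_spectrum S w"
    unfolding digraph_spectral_radius_def adj_spectrum_def
    by (rule spectral_radius_mem_max(1)[of _ "card S"]) (use assms in \<open>auto simp: card_gt_0_iff\<close>)
  then show ?thesis using that by (elim imageE) simp
qed

lemma adj_spectrum_eigenvector:
  assumes fin: "finite S" and "z \<in> adj_spectrum S w"
  obtains v where "\<exists>x\<in>S. v x \<noteq> 0" "\<And>x. x \<in> S \<Longrightarrow> (\<Sum>y\<in>S. complex_of_real (w x y) * v y) = z * v x"
proof -
  let ?A = "map_mat complex_of_real (adj_matrix S w)"
  have dim: "dim_row ?A = card S" "dim_col ?A = card S" by (auto simp: adj_matrix_def)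
  obtain u where u: "u \<in> carrier_vec (card S)" "u \<noteq> 0\<^sub>v (card S)" "?A *\<^sub>v u = z \<cdot>\<^sub>v u"
    using assms(2) unfolding adj_spectrum_def spectrum_def eigenvalue_def eigenvector_def dim by auto
  define v where "v x = u $ to_nat_on S x" for x
  show ?thesis
  proof (rule that)
    obtain i where i: "i < card S" "u $ i \<noteq> 0"
      using u(1,2) by (metis carrier_vecD eq_vecI index_zero_vec(1) index_zero_vec(2))
    then show "\<exists>x\<in>S. v x \<noteq> 0"
      by (intro bexI[of _ "from_nat_into S i"])
        (auto simp: v_def to_nat_on_from_nat_into_less[OF fin] from_nat_into_less_card[OF fin])
  next
    fix x assume x: "x \<in> S"
    let ?i = "to_nat_on S x"
    have i: "?i < card S" by (rule to_nat_on_less_card[OF fin x])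
    have "z * v x = (?A *\<^sub>v u) $ ?i"
      using i u by (simp add: v_def)
    also have "\<dots> = (\<Sum>j<card S. complex_of_real (w x (from_nat_into S j)) * u $ j)"
      using i u(1) x countable_finite[OF fin]
      by (auto simp: scalar_prod_def lessThan_atLeast0 adj_matrix_def intro!: sum.cong)
    also have "\<dots> = (\<Sum>j<card S. complex_of_real (w x (from_nat_into S j)) * v (from_nat_into S j))"
      by (intro sum.cong) (auto simp: v_def to_nat_on_from_nat_into_less[OF fin])
    also have "\<dots> = (\<Sum>y\<in>S. complex_of_real (w x y) * v y)"
      by (rule sum_enumeration[OF fin])
    finally show "(\<Sum>y\<in>S. complex_of_real (w x y) * v y) = z * v x" by simp
  qed
qed

text \<open>The strict inequality leaves room for the polynomial factors of nontrivial Jordan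
  blocks.\<close>

lemma funpow_adj_op_bound:
  assumes fin: "finite S" and ne: "S \<noteq> {}" and r: "digraph_spectral_radius S w < r"
  obtains B where "B \<ge> 0" "\<And>k x. x \<in> S \<Longrightarrow> \<bar>((adj_op S w) ^^ k) g x\<bar> \<le> B * r ^ k"
proof -
  have lt: "norm z < r" if "z \<in> adj_spectrum S w" for z
    using adj_spectrum_norm_le[OF fin ne that] r by simp
  have "\<forall>x\<in>S. \<exists>B. B \<ge> 0 \<and> (\<forall>k. \<bar>((adj_op S w) ^^ k) g x\<bar> \<le> B * r ^ k)"
    using exp_poly_bound[OF exp_poly_funpow_adj_op[OF fin] lt] by (auto simp flip: of_real_power)
  then obtain B where B: "\<And>x. x \<in> S \<Longrightarrow> B x \<ge> 0"
    "\<And>x k. x \<in> S \<Longrightarrow> \<bar>((adj_op S w) ^^ k) g x\<bar> \<le> B x * r ^ k"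
    by metis
  have r0: "0 < r"
    using digraph_spectral_radius_attained[OF fin ne] r by (metis le_less_trans norm_ge_zero)
  show ?thesis
  proof (rule that[of "sum B S"])
    show "0 \<le> sum B S" using B(1) by (rule sum_nonneg)
    fix k x assume x: "x \<in> S"
    have "B x \<le> sum B S" using B(1) x fin by (intro member_le_sum) auto
    then show "\<bar>((adj_op S w) ^^ k) g x\<bar> \<le> sum B S * r ^ k"
      using B(2)[OF x, of k] r0 by (meson mult_right_mono order_trans zero_le_power less_imp_le)
  qed
qed

lemma adj_op_nonneg:
  assumes "weighted_digraph S w" "x \<in> S" "\<And>y. y \<in> S \<Longrightarrow> 0 \<le> g y"
  shows "0 \<le> adj_op S w g x"
  using assms by (auto simp: adj_op_def weighted_digraph_def intro!: sum_nonneg)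

lemma adj_op_mono:
  assumes "weighted_digraph S w" "x \<in> S" "\<And>y. y \<in> S \<Longrightarrow> f y \<le> g y"
  shows "adj_op S w f x \<le> adj_op S w g x"
  using assms by (auto simp: adj_op_def weighted_digraph_def intro!: sum_mono mult_left_mono)

lemma adj_op_cong: "(\<And>y. y \<in> S \<Longrightarrow> f y = g y) \<Longrightarrow> adj_op S w f x = adj_op S w g x"
  by (simp add: adj_op_def)

lemma adj_op_cmult: "adj_op S w (\<lambda>y. c * g y) x = c * adj_op S w g x"
  by (simp add: adj_op_def sum_distrib_left mult.left_commute)

lemma funpow_adj_op_nonneg:
  assumes "weighted_digraph S w" "x \<in> S" "\<And>y. y \<in> S \<Longrightarrow> 0 \<le> g y"
  shows "0 \<le> ((adj_op S w) ^^ k) g x"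
  using assms(2) by (induction k arbitrary: x) (auto intro: adj_op_nonneg[OF assms(1)] assms(3))

lemma funpow_adj_op_ge:
  assumes wd: "weighted_digraph S w" and "0 \<le> r" and g: "\<And>x. x \<in> S \<Longrightarrow> r * g x \<le> adj_op S w g x"
    and x: "x \<in> S"
  shows "r ^ k * g x \<le> ((adj_op S w) ^^ k) g x"
  using x
proof (induction k arbitrary: x)
  case (Suc k)
  have "r ^ Suc k * g x = r ^ k * (r * g x)" by simp
  also have "\<dots> \<le> r ^ k * adj_op S w g x"
    using assms Suc.prems by (intro mult_left_mono) auto
  also have "\<dots> = adj_op S w (\<lambda>y. r ^ k * g y) x"
    by (simp add: adj_op_cmult)
  also have "\<dots> \<le> adj_op S w (((adj_op S w) ^^ k) g) x"
    using Suc by (intro adj_op_mono[OF wd])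
  finally show ?case by simp
qed simp

lemma funpow_adj_op_eigen:
  assumes g: "\<And>x. x \<in> S \<Longrightarrow> adj_op S w g x = r * g x" and x: "x \<in> S"
  shows "((adj_op S w) ^^ k) g x = r ^ k * g x"
  using x
proof (induction k arbitrary: x)
  case (Suc k)
  have "((adj_op S w) ^^ Suc k) g x = adj_op S w (\<lambda>y. r ^ k * g y) x"
    using Suc by (auto intro: adj_op_cong)
  also have "\<dots> = r ^ k * (r * g x)"
    using g[OF Suc.prems] by (simp add: adj_op_cmult)
  finally show ?case by simp
qed simp

subsection \<open>Accessibility\<close>

definition edges :: "'v set \<Rightarrow> ('v \<Rightarrow> 'v \<Rightarrow> real) \<Rightarrow> ('v \<times> 'v) set" where
  "edges S w = {(x, y). x \<in> S \<and> y \<in> S \<and> 0 < w x y}"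

lemma finite_path_Cons:
  "finite_path S w (x # u) \<longleftrightarrow> x \<in> S \<and> (u = [] \<or> (finite_path S w u \<and> 0 < w x (hd u)))"
  by (cases u) (auto simp: finite_path_def)

lemma finite_path_edges:
  "finite_path S w u \<Longrightarrow> hd u \<in> S \<and> last u \<in> S \<and> (hd u, last u) \<in> (edges S w)\<^sup>*"
proof (induction u)
  case (Cons x u)
  show ?case
  proof (cases "u = []")
    case False
    then have "finite_path S w u" "0 < w x (hd u)" "x \<in> S"
      using Cons.prems by (auto simp: finite_path_Cons)
    then show ?thesis
      using False Cons.IH by (auto simp: edges_def intro: converse_rtrancl_into_rtrancl)
  qed (use Cons.prems in \<open>auto simp: finite_path_Cons\<close>)
qed (simp add: finite_path_def)

text \<open>The conjunct \<open>x \<in> S\<close> excludes the trivial path at a vertex outside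
  \<open>S\<close>, which the reflexive closure would accept.\<close>

lemma accessible_iff_edges: "accessible S w x y \<longleftrightarrow> x \<in> S \<and> (x, y) \<in> (edges S w)\<^sup>*"
proof
  assume "accessible S w x y"
  then show "x \<in> S \<and> (x, y) \<in> (edges S w)\<^sup>*"
    using finite_path_edges by (auto simp: accessible_def)
next
  assume xy: "x \<in> S \<and> (x, y) \<in> (edges S w)\<^sup>*"
  then have "(x, y) \<in> (edges S w)\<^sup>*" "y \<in> S \<or> x = y"
    by (auto elim: rtranclE simp: edges_def)
  then have "(x, y) \<in> (edges S w)\<^sup>*" "y \<in> S" using xy by auto
  then show "accessible S w x y"
  proof (induction rule: converse_rtrancl_induct)
    case base
    then show ?case
      by (auto simp: accessible_def finite_path_def intro!: exI[of _ "[y]"])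
  next
    case (step x z)
    then obtain u where u: "finite_path S w u" "hd u = z" "last u = y"
      by (auto simp: accessible_def)
    moreover have "u \<noteq> []" using u(1) by (simp add: finite_path_def)
    ultimately show ?case
      using step.hyps(1) unfolding accessible_def
      by (intro exI[of _ "x # u"]) (auto simp: finite_path_Cons edges_def)
  qed
qed

lemma accessible_refl: "x \<in> S \<Longrightarrow> accessible S w x x"
  by (simp add: accessible_iff_edges)

lemma accessible_trans: "accessible S w x y \<Longrightarrow> accessible S w y z \<Longrightarrow> accessible S w x z"
  by (auto simp: accessible_iff_edges)

lemma accessible_edge: "x \<in> S \<Longrightarrow> y \<in> S \<Longrightarrow> 0 < w x y \<Longrightarrow> accessible S w x y"
  by (auto simp: accessible_iff_edges edges_def)

lemma accessible_in: "accessible S w x y \<Longrightarrow> x \<in> S \<and> y \<in> S"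
  by (auto simp: accessible_iff_edges edges_def elim: rtranclE)

lemma accessible_transpose: "accessible S (\<lambda>x y. w y x) x y \<longleftrightarrow> accessible S w y x"
proof -
  have "edges S (\<lambda>x y. w y x) = (edges S w)\<inverse>" by (auto simp: edges_def)
  then show ?thesis
    using accessible_in[of S w y x] accessible_in[of S "\<lambda>x y. w y x" x y]
    by (auto simp: accessible_iff_edges rtrancl_converse)
qed

text \<open>The target stays fixed and an edge is added at the source: positivity and lower bounds
  travel backwards along edges.\<close>

lemma accessible_induct [consumes 1, case_names refl edge]:
  assumes "accessible S w x y"
    and "P y"
    and "\<And>x z. x \<in> S \<Longrightarrow> z \<in> S \<Longrightarrow> 0 < w x z \<Longrightarrow> accessible S w z y \<Longrightarrow> P z \<Longrightarrow> P x"
  shows "P x"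
proof -
  have "(x, y) \<in> (edges S w)\<^sup>*" "y \<in> S"
    using assms(1) accessible_in[OF assms(1)] by (auto simp: accessible_iff_edges)
  then show ?thesis
    by (induction rule: converse_rtrancl_induct)
      (use assms(2,3) in \<open>auto simp: accessible_iff_edges edges_def\<close>)
qed

text \<open>Paths of length 0 count, so a single vertex without loop is irreducible, with spectral
  radius 0. This makes every access class irreducible.\<close>

definition irreducible_on :: "'v set \<Rightarrow> ('v \<Rightarrow> 'v \<Rightarrow> real) \<Rightarrow> bool" where
  "irreducible_on S w \<longleftrightarrow> (\<forall>x\<in>S. \<forall>y\<in>S. accessible S w x y)"

text \<open>Mass at \<open>y\<close> moves one edge backwards with each application. The exponent
  depends on \<open>x\<close>; in a periodic digraph there may be no common one.\<close>

lemma funpow_adj_op_pos: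
  assumes wd: "weighted_digraph S w" and acc: "accessible S w x y"
    and g: "\<And>y. y \<in> S \<Longrightarrow> 0 \<le> g y" "0 < g y"
  shows "\<exists>k. 0 < ((adj_op S w) ^^ k) g x"
  using acc
proof (induction rule: accessible_induct)
  case refl
  show ?case by (intro exI[of _ 0]) (simp add: g)
next
  case (edge x z)
  then obtain k where k: "0 < ((adj_op S w) ^^ k) g z" by blast
  have "0 < w x z * ((adj_op S w) ^^ k) g z"
    using edge k by simp
  also have "\<dots> \<le> adj_op S w (((adj_op S w) ^^ k) g) x"
    unfolding adj_op_def[of S w "((adj_op S w) ^^ k) g"] using wd edge.hyps
    by (intro member_le_sum[of z S "\<lambda>z. w x z * ((adj_op S w) ^^ k) g z"])
      (auto simp: weighted_digraph_def intro!: mult_nonneg_nonneg funpow_adj_op_nonneg wd g)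
  finally show ?case by (intro exI[of _ "Suc k"]) simp
qed

subsection \<open>Perron eigenvectors\<close>

lemma digraph_spectral_radius_nonneg:
  assumes "finite S" "S \<noteq> {}"
  shows "0 \<le> digraph_spectral_radius S w"
  using digraph_spectral_radius_attained[OF assms] by (metis norm_ge_zero)

text \<open>The lower Collatz-Wielandt bound. With a smaller spectral radius, the iterates of
  \<open>g\<close> at \<open>x\<close> would be at least \<open>r ^ k * g x\<close> and at most
  \<open>B * r' ^ k\<close> for some \<open>r' < r\<close>.\<close>

lemma digraph_spectral_radius_ge:
  assumes wd: "weighted_digraph S w" and r: "0 \<le> r"
    and g: "\<And>x. x \<in> S \<Longrightarrow> r * g x \<le> adj_op S w g x" and x: "x \<in> S" "0 < g x"
  shows "r \<le> digraph_spectral_radius S w"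
proof (rule ccontr)
  have fin: "finite S" and ne: "S \<noteq> {}"
    using wd x by (auto simp: weighted_digraph_def)
  assume "\<not> r \<le> digraph_spectral_radius S w"
  then obtain r' where r': "digraph_spectral_radius S w < r'" "r' < r"
    using dense[of "digraph_spectral_radius S w" r] by (auto simp: not_le)
  have r'0: "0 < r'"
    using r'(1) digraph_spectral_radius_nonneg[OF fin ne, of w] by linarith
  obtain B where B: "\<And>k x. x \<in> S \<Longrightarrow> \<bar>((adj_op S w) ^^ k) g x\<bar> \<le> B * r' ^ k"
    using funpow_adj_op_bound[OF fin ne r'(1)] by metis
  have "1 < r / r'" using r' r'0 by simp
  then obtain k where k: "B / g x < (r / r') ^ k"
    using real_arch_pow by blast
  have "r ^ k * g x \<le> B * r' ^ k"
    using funpow_adj_op_ge[OF wd r g x(1), of k] B[OF x(1), of k] by simp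
  then have "(r / r') ^ k \<le> B / g x"
    using x(2) r'0 by (simp add: power_divide field_simps)
  with k show False by simp
qed

text \<open>
  If \<open>a\<close> is subinvariant but not an eigenvector, then a sum of iterates of \<open>a\<close> satisfies the
  inequality strictly at every vertex, which exceeds the spectral radius.
\<close>

lemma subinvariant_eigen:
  assumes wd: "weighted_digraph S w" and irr: "irreducible_on S w"
    and a: "\<And>x. x \<in> S \<Longrightarrow> 0 \<le> a x" "y0 \<in> S" "a y0 \<noteq> 0"
    and sub: "\<And>x. x \<in> S \<Longrightarrow> digraph_spectral_radius S w * a x \<le> adj_op S w a x"
    and x: "x \<in> S"
  shows "adj_op S w a x = digraph_spectral_radius S w * a x" and "0 < a x"
proof -
  define \<rho> where "\<rho> = digraph_spectral_radius S w"
  let ?T = "adj_op S w"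
  have fin: "finite S" and ne: "S \<noteq> {}"
    using wd x by (auto simp: weighted_digraph_def)
  have \<rho>: "0 \<le> \<rho>" unfolding \<rho>_def by (rule digraph_spectral_radius_nonneg[OF fin ne])
  \<comment> \<open>The defect of \<open>a\<close>. The operator commutes with forming it, so
    iterates of \<open>d\<close> are defects of iterates of \<open>a\<close>.\<close>
  define d where "d x = ?T a x - \<rho> * a x" for x
  have d0: "0 \<le> d x" if "x \<in> S" for x using sub[OF that] by (simp add: d_def \<rho>_def)
  have Td: "(?T ^^ m) d x = (?T ^^ Suc m) a x - \<rho> * (?T ^^ m) a x" for m x
  proof (induction m arbitrary: x)
    case (Suc m)
    have "(?T ^^ Suc m) d x = ?T (\<lambda>x. (?T ^^ Suc m) a x - \<rho> * (?T ^^ m) a x) x"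
      using Suc by (auto intro: adj_op_cong)
    also have "\<dots> = ?T ((?T ^^ Suc m) a) x - \<rho> * ?T ((?T ^^ m) a) x"
      by (simp add: adj_op_def right_diff_distrib sum_subtractf sum_distrib_left mult.left_commute)
    finally show ?case by simp
  qed (simp add: d_def)
  have d_zero: "d y = 0" if y: "y \<in> S" for y
  proof (rule ccontr)
    assume "d y \<noteq> 0"
    then have dy: "0 < d y" using d0[OF y] by simp
    have "\<forall>x\<in>S. \<exists>k. 0 < (?T ^^ k) d x"
      using funpow_adj_op_pos[where g = d and y = y, OF wd _ d0 dy] irr y by (auto simp: irreducible_on_def)
    then obtain k where k: "\<And>x. x \<in> S \<Longrightarrow> 0 < (?T ^^ k x) d x" by metis
    \<comment> \<open>The exponents \<open>k x\<close> differ from vertex to vertex; a sum up to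
      their maximum contains a positive term at each vertex.\<close>
    define N where "N = Max (k ` S)"
    have kN: "k x \<le> N" if "x \<in> S" for x using that fin by (simp add: N_def)
    define b where "b x = (\<Sum>m\<le>N. (?T ^^ m) a x)" for x
    define D where "D x = (\<Sum>m\<le>N. (?T ^^ m) d x)" for x
    have Tb: "?T b x = \<rho> * b x + D x" for x
    proof -
      have "?T b x = (\<Sum>m\<le>N. (?T ^^ Suc m) a x)"
        by (simp add: adj_op_def b_def sum_distrib_left sum.swap[of _ S])
      then show ?thesis
        by (simp only: D_def b_def Td sum_subtractf sum_distrib_left)
    qed
    have Dpos: "0 < D x" if x: "x \<in> S" for x
    proof -
      have "(?T ^^ k x) d x \<le> D x"
        unfolding D_def using kN[OF x]
        by (intro member_le_sum) (auto intro!: funpow_adj_op_nonneg[OF wd x] d0)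
      then show ?thesis using k[OF x] by linarith
    qed
    have ab: "a x \<le> b x" if x: "x \<in> S" for x
    proof -
      have "(?T ^^ 0) a x \<le> b x"
        unfolding b_def
        by (rule member_le_sum) (auto intro!: funpow_adj_op_nonneg[OF wd x] a)
      then show ?thesis by simp
    qed
    \<comment> \<open>Adding 1 makes the denominator positive, as \<open>b\<close> is only known to
      be nonnegative. The minimum gives one gain valid at all vertices, and
      \<open>\<rho> + \<epsilon>\<close> contradicts
      \<open>digraph_spectral_radius_ge\<close>.\<close>
    define \<epsilon> where "\<epsilon> = Min ((\<lambda>x. D x / (b x + 1)) ` S)"
    have b0: "0 \<le> b x" if "x \<in> S" for x using ab[OF that] a(1)[OF that] by linarith
    have "\<epsilon> \<in> (\<lambda>x. D x / (b x + 1)) ` S"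
      unfolding \<epsilon>_def using fin ne by (intro Min_in) auto
    then have \<epsilon>: "0 < \<epsilon>" using Dpos b0 by (auto intro!: divide_pos_pos add_nonneg_pos)
    have "\<rho> + \<epsilon> \<le> digraph_spectral_radius S w"
    proof (rule digraph_spectral_radius_ge[OF wd, of _ b y0])
      fix x assume x: "x \<in> S"
      have "\<epsilon> \<le> D x / (b x + 1)" unfolding \<epsilon>_def using fin x by (intro Min_le) auto
      then have "\<epsilon> * (b x + 1) \<le> D x" using b0[OF x] by (simp add: field_simps)
      then have "\<epsilon> * b x \<le> D x" using \<epsilon> by (simp add: distrib_left)
      then show "(\<rho> + \<epsilon>) * b x \<le> ?T b x" unfolding Tb by (simp add: distrib_right)
    next
      show "0 < b y0" using ab[OF a(2)] a by (metis less_eq_real_def less_le_trans)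
    qed (use \<rho> \<epsilon> a(2) in auto)
    then show False using \<epsilon> by (simp add: \<rho>_def)
  qed
  show eig: "adj_op S w a x = digraph_spectral_radius S w * a x"
    using d_zero[OF x] by (simp add: d_def \<rho>_def)
  have "\<And>x. x \<in> S \<Longrightarrow> ?T a x = \<rho> * a x" using d_zero by (simp add: d_def)
  then have pow: "(?T ^^ k) a x = \<rho> ^ k * a x" for k
    by (rule funpow_adj_op_eigen[OF _ x])
  have "0 < a y0" using a by (metis less_eq_real_def)
  then obtain k where "0 < (?T ^^ k) a x"
    using funpow_adj_op_pos[where g = a and y = y0, OF wd _ a(1)] irr x a(2) unfolding irreducible_on_def by blast
  then have "a x \<noteq> 0" by (auto simp: pow)
  then show "0 < a x" using a(1)[OF x] by simp
qed

lemma adj_spectrum_transpose: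
  assumes "finite S"
  shows "adj_spectrum S (\<lambda>x y. w y x) = adj_spectrum S w"
proof -
  let ?A = "map_mat complex_of_real (adj_matrix S w)"
  have A: "?A \<in> carrier_mat (card S) (card S)" by simp
  have "map_mat complex_of_real (adj_matrix S (\<lambda>x y. w y x)) = transpose_mat ?A"
    by (rule eq_matI) (auto simp: adj_matrix_def)
  then show ?thesis
    using char_poly_transpose_mat[OF A] A
    by (simp add: adj_spectrum_def spectrum_root_char_poly[of _ "card S"])
qed

lemma digraph_spectral_radius_transpose:
  "finite S \<Longrightarrow> digraph_spectral_radius S (\<lambda>x y. w y x) = digraph_spectral_radius S w"
  using adj_spectrum_transpose[of S w]
  by (simp add: digraph_spectral_radius_def spectral_radius_def adj_spectrum_def)

lemma norm_eigenvector_subinvariant: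
  assumes wd: "weighted_digraph S w" and x: "x \<in> S"
    and v: "(\<Sum>y\<in>S. complex_of_real (w x y) * v y) = z * v x"
  shows "norm z * norm (v x) \<le> adj_op S w (\<lambda>y. norm (v y)) x"
proof -
  have "norm z * norm (v x) = norm (\<Sum>y\<in>S. complex_of_real (w x y) * v y)"
    by (simp add: v norm_mult)
  also have "\<dots> \<le> (\<Sum>y\<in>S. norm (complex_of_real (w x y) * v y))"
    by (rule norm_sum)
  also have "\<dots> = adj_op S w (\<lambda>y. norm (v y)) x"
    unfolding adj_op_def using wd x
    by (intro sum.cong) (auto simp: norm_mult weighted_digraph_def)
  finally show ?thesis .
qed

text \<open>Some complex eigenvector belongs to an eigenvalue of maximal modulus. Its vector of
  moduli is subinvariant by the triangle inequality, hence a positive eigenvector by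
  \<open>subinvariant_eigen\<close>.\<close>

lemma perron_right:
  assumes wd: "weighted_digraph S w" and irr: "irreducible_on S w" and ne: "S \<noteq> {}"
  obtains a where "\<And>x. x \<in> S \<Longrightarrow> 0 < a x"
    "\<And>x. x \<in> S \<Longrightarrow> adj_op S w a x = digraph_spectral_radius S w * a x"
proof -
  have fin: "finite S" using wd by (simp add: weighted_digraph_def)
  obtain z where z: "z \<in> adj_spectrum S w" "norm z = digraph_spectral_radius S w"
    using digraph_spectral_radius_attained[OF fin ne] by blast
  obtain v y where v: "y \<in> S" "v y \<noteq> 0"
    "\<And>x. x \<in> S \<Longrightarrow> (\<Sum>y\<in>S. complex_of_real (w x y) * v y) = z * v x"
    using adj_spectrum_eigenvector[OF fin z(1)] by metis
  have sub: "digraph_spectral_radius S w * norm (v x) \<le> adj_op S w (\<lambda>y. norm (v y)) x" if "x \<in> S" for x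
    using norm_eigenvector_subinvariant[OF wd that v(3)[OF that]] z(2) by simp
  show ?thesis
    using that[of "\<lambda>y. norm (v y)"] subinvariant_eigen[OF wd irr norm_ge_zero v(1) _ sub] v(2) by simp
qed

lemma perron_left:
  assumes wd: "weighted_digraph S w" and irr: "irreducible_on S w" and ne: "S \<noteq> {}"
  obtains p where "\<And>x. x \<in> S \<Longrightarrow> 0 < p x"
    "\<And>y. y \<in> S \<Longrightarrow> (\<Sum>x\<in>S. p x * w x y) = digraph_spectral_radius S w * p y"
proof -
  have "weighted_digraph S (\<lambda>x y. w y x)" "irreducible_on S (\<lambda>x y. w y x)"
    using wd irr accessible_transpose[of S w] by (auto simp: weighted_digraph_def irreducible_on_def)
  from perron_right[OF this ne] show ?thesis
    using that wd digraph_spectral_radius_transpose[of S w]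
    by (auto simp: adj_op_def weighted_digraph_def mult.commute)
qed

text \<open>The moduli of a dominant eigenvector on \<open>S\<close>, extended by 0 to
  \<open>V\<close>, satisfy the inequality required by
  \<open>digraph_spectral_radius_ge\<close>.\<close>

lemma digraph_spectral_radius_mono:
  assumes wd: "weighted_digraph V w" and S: "S \<subseteq> V" "S \<noteq> {}"
  shows "digraph_spectral_radius S w \<le> digraph_spectral_radius V w"
proof -
  have fin: "finite V" "finite S" using wd S(1) by (auto simp: weighted_digraph_def intro: finite_subset)
  have wdS: "weighted_digraph S w" using wd S fin by (auto simp: weighted_digraph_def)
  obtain z where z: "z \<in> adj_spectrum S w" "norm z = digraph_spectral_radius S w"
    using digraph_spectral_radius_attained[OF fin(2) S(2)] by blast
  obtain v y where v: "y \<in> S" "v y \<noteq> 0"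
    "\<And>x. x \<in> S \<Longrightarrow> (\<Sum>y\<in>S. complex_of_real (w x y) * v y) = z * v x"
    using adj_spectrum_eigenvector[OF fin(2) z(1)] by metis
  define g where "g x = (if x \<in> S then norm (v x) else 0)" for x
  show ?thesis
  proof (rule digraph_spectral_radius_ge[OF wd, of _ g y])
    show "0 \<le> digraph_spectral_radius S w" by (rule digraph_spectral_radius_nonneg[OF fin(2) S(2)])
    show "y \<in> V" "0 < g y" using v S by (auto simp: g_def)
    fix x assume x: "x \<in> V"
    have eq: "adj_op V w g x = adj_op S w (\<lambda>y. norm (v y)) x"
      unfolding adj_op_def using fin S by (intro sum.mono_neutral_cong_right) (auto simp: g_def)
    show "digraph_spectral_radius S w * g x \<le> adj_op V w g x"
    proof (cases "x \<in> S")
      case True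
      then show ?thesis
        using norm_eigenvector_subinvariant[OF wdS True v(3)] unfolding eq by (simp add: g_def z(2))
    next
      case False
      then show ?thesis
        using wd x by (auto simp: g_def adj_op_def weighted_digraph_def intro!: sum_nonneg)
    qed
  qed
qed

subsection \<open>Access classes\<close>

definition access_class :: "'v set \<Rightarrow> ('v \<Rightarrow> 'v \<Rightarrow> real) \<Rightarrow> 'v \<Rightarrow> 'v set" where
  "access_class V w x = {y. accessible V w x y \<and> accessible V w y x}"

lemma access_classes_eq: "access_classes V w = access_class V w ` V"
  by (auto simp: access_classes_def access_class_def quotient_def)

lemma access_class_subset: "access_class V w x \<subseteq> V"
  by (auto simp: access_class_def dest: accessible_in)

lemma access_class_self: "x \<in> V \<Longrightarrow> x \<in> access_class V w x"
  by (auto simp: access_class_def accessible_refl)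

lemma access_class_eq: "y \<in> access_class V w x \<Longrightarrow> access_class V w y = access_class V w x"
  by (auto simp: access_class_def intro: accessible_trans)

text \<open>Accessibility within the class must be derived from accessibility in \<open>V\<close>: a
  path between two members never leaves the class, since each vertex on it is accessible from one
  member and has access to another.\<close>

lemma irreducible_access_class: "irreducible_on (access_class V w x) w"
  unfolding irreducible_on_def
proof (intro ballI)
  fix y z assume y: "y \<in> access_class V w x" and z: "z \<in> access_class V w x"
  have "accessible V w y z" using y z by (auto simp: access_class_def intro: accessible_trans)
  then have "y \<in> access_class V w x \<longrightarrow> accessible (access_class V w x) w y z"
  proof (induction rule: accessible_induct)
    case refl
    then show ?case by (simp add: accessible_refl)
  next
    case (edge u t)
    show ?case
    proof
      assume u: "u \<in> access_class V w x"
      have "accessible V w u t" using edge.hyps by (intro accessible_edge)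
      then have t: "t \<in> access_class V w x"
        using u z edge.hyps unfolding access_class_def by (blast intro: accessible_trans)
      then show "accessible (access_class V w x) w u z"
        using accessible_edge[where w = w and x = u and y = t, OF u t edge.hyps(3)] edge.IH by (blast intro: accessible_trans)
    qed
  qed
  then show "accessible (access_class V w x) w y z" using y by blast
qed

lemma weighted_digraph_subset: "weighted_digraph V w \<Longrightarrow> S \<subseteq> V \<Longrightarrow> weighted_digraph S w"
  by (auto simp: weighted_digraph_def intro: finite_subset)

subsection \<open>Peripheral eigenvalues\<close>

text \<open>The least positive exponent \<open>d\<close> with \<open>\<zeta> ^ d = 1\<close> divides
  every element of \<open>K\<close> by division with remainder, hence divides
  \<open>Gcd K\<close>.\<close>

lemma root_of_unity_Gcd:
  fixes \<zeta> :: complex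
  assumes K: "Gcd K = (1::nat)" "\<And>k. k \<in> K \<Longrightarrow> 0 < k \<and> \<zeta> ^ k = 1"
  shows "\<zeta> = 1"
proof -
  obtain k where "k \<in> K" using K(1) by (metis Gcd_empty ex_in_conv zero_neq_one)
  then have ex: "\<exists>d. 0 < d \<and> \<zeta> ^ d = 1" using K(2) by blast
  define d where "d = (LEAST d. 0 < d \<and> \<zeta> ^ d = 1)"
  have d: "0 < d" "\<zeta> ^ d = 1" using LeastI_ex[OF ex] by (auto simp: d_def)
  have "d dvd k" if k: "k \<in> K" for k
  proof (rule ccontr)
    assume "\<not> d dvd k"
    then have pos: "0 < k mod d" by (simp add: mod_greater_zero_iff_not_dvd)
    have "\<zeta> ^ k = (\<zeta> ^ d) ^ (k div d) * \<zeta> ^ (k mod d)"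
      by (simp flip: power_mult power_add)
    then have "\<zeta> ^ (k mod d) = 1" using K(2)[OF k] d by simp
    then have "d \<le> k mod d" unfolding d_def using pos by (intro Least_le) (simp add: d_def)
    then show False using mod_less_divisor[OF d(1), of k] by linarith
  qed
  then have "d dvd Gcd K" by (rule Gcd_greatest)
  then show ?thesis using d K(1) by simp
qed

lemma complex_eq_norm_if_Re: "Re x = norm x \<Longrightarrow> x = complex_of_real (norm x)"
  using cmod_power2[of x] by (simp add: complex_eq_iff)

lemma aperiodic_unimodular_eigenvalue:
  assumes wd: "weighted_digraph C w" and ap: "aperiodic_class w C" and \<rho>: "0 < \<rho>"
    and z: "norm z = \<rho>"
    and v: "\<And>x. x \<in> C \<Longrightarrow> (\<Sum>y\<in>C. complex_of_real (w x y) * v y) = z * v x"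
    and eig: "\<And>x. x \<in> C \<Longrightarrow> adj_op C w (\<lambda>y. norm (v y)) x = \<rho> * norm (v x)"
    and nz: "\<And>x. x \<in> C \<Longrightarrow> v x \<noteq> 0"
  shows "z = complex_of_real \<rho>"
proof -
  define \<zeta> where "\<zeta> = z / complex_of_real \<rho>"
  define \<phi> where "\<phi> x = v x / complex_of_real (norm (v x))" for x
  have step: "\<phi> y = \<zeta> * \<phi> x" if x: "x \<in> C" and y: "y \<in> C" and wxy: "0 < w x y" for x y
  proof -
    \<comment> \<open>The phase expected at all successors of \<open>x\<close>. Multiplication by
      \<open>cnj \<psi>\<close> rotates the eigenvalue equation at \<open>x\<close> so that its
      right-hand side becomes real and positive; real parts can then be compared with the equation
      for the moduli.\<close>
    define \<psi> where "\<psi> = \<zeta> * \<phi> x"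
    have "norm \<psi> = 1"
      using nz[OF x] \<rho> z by (simp add: \<psi>_def \<zeta>_def \<phi>_def norm_mult norm_divide)
    then have \<psi>: "\<psi> * cnj \<psi> = 1" "norm \<psi> = 1"
      using complex_norm_square[of \<psi>] by simp_all
    have "z * v x = \<psi> * complex_of_real (\<rho> * norm (v x))"
      using nz[OF x] \<rho> by (simp add: \<psi>_def \<zeta>_def \<phi>_def)
    then have "(\<Sum>y\<in>C. complex_of_real (w x y) * (v y * cnj \<psi>)) = complex_of_real (\<rho> * norm (v x))"
      using v[OF x] \<psi> by (simp add: sum_distrib_right[symmetric] mult.assoc[symmetric] mult.commute[of \<psi>])
    then have "Re (\<Sum>y\<in>C. complex_of_real (w x y) * (v y * cnj \<psi>)) = \<rho> * norm (v x)"
      by (simp only: Re_complex_of_real)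
    moreover have "Re (\<Sum>y\<in>C. complex_of_real (w x y) * (v y * cnj \<psi>)) = (\<Sum>y\<in>C. w x y * Re (v y * cnj \<psi>))"
      by (simp only: Re_sum times_complex.sel Re_complex_of_real Im_complex_of_real mult_zero_left diff_zero)
    ultimately have "(\<Sum>y\<in>C. w x y * Re (v y * cnj \<psi>)) = \<rho> * norm (v x)"
      by simp
    then have "(\<Sum>y\<in>C. w x y * (norm (v y) - Re (v y * cnj \<psi>))) = 0"
      using eig[OF x] by (simp add: adj_op_def right_diff_distrib sum_subtractf)
    moreover have "0 \<le> w x y * (norm (v y) - Re (v y * cnj \<psi>))" if "y \<in> C" for y
      using wd x that complex_Re_le_cmod[of "v y * cnj \<psi>"] \<psi>(2)
      by (auto simp: weighted_digraph_def norm_mult)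
    \<comment> \<open>equality in the triangle inequality aligns the phases of all successors of \<open>x\<close>\<close>
    ultimately have "w x y * (norm (v y) - Re (v y * cnj \<psi>)) = 0"
      using wd y by (subst (asm) sum_nonneg_eq_0_iff) (auto simp: weighted_digraph_def)
    then have "Re (v y * cnj \<psi>) = norm (v y * cnj \<psi>)" using wxy \<psi>(2) by (simp add: norm_mult)
    then have "v y * cnj \<psi> = complex_of_real (norm (v y))"
      using complex_eq_norm_if_Re \<psi>(2) by (metis complex_mod_cnj mult.right_neutral norm_mult)
    then have "v y * (\<psi> * cnj \<psi>) = \<psi> * complex_of_real (norm (v y))" by (simp add: mult_ac)
    then have "v y = \<psi> * complex_of_real (norm (v y))" by (simp only: \<psi>(1) mult_1_right)
    then show ?thesis using nz[OF y] unfolding \<psi>_def[symmetric]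
      by (metis \<phi>_def nonzero_mult_div_cancel_right norm_eq_zero of_real_eq_0_iff)
  qed
  \<comment> \<open>Along a closed path the phase returns to its value, so \<zeta> to the power of
    the length is 1.\<close>
  have path: "\<phi> (last u) = \<zeta> ^ path_len u * \<phi> (hd u)" if "finite_path C w u" for u
    using that
  proof (induction u)
    case (Cons x u)
    show ?case
    proof (cases "u = []")
      case False
      then have u: "finite_path C w u" "x \<in> C" "0 < w x (hd u)" "hd u \<in> C"
        using Cons.prems finite_path_edges[of C w u] by (auto simp: finite_path_Cons)
      have "path_len (x # u) = Suc (path_len u)" using False by (cases u) (auto simp: path_len_def)
      then show ?thesis using False Cons.IH[OF u(1)] step[OF u(2,4,3)] by (simp add: mult_ac)
    qed (simp add: path_len_def)
  qed (simp add: finite_path_def)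
  have "\<zeta> = 1"
  proof (rule root_of_unity_Gcd)
    show "Gcd {k. \<exists>u. finite_path C w u \<and> hd u = last u \<and> path_len u = k \<and> 0 < k} = 1"
      using ap by (simp add: aperiodic_class_def)
    fix k assume "k \<in> {k. \<exists>u. finite_path C w u \<and> hd u = last u \<and> path_len u = k \<and> 0 < k}"
    then obtain u where u: "finite_path C w u" "hd u = last u" "path_len u = k" "0 < k" by blast
    have "hd u \<in> C" using finite_path_edges[OF u(1)] by blast
    then have "\<phi> (hd u) \<noteq> 0" using nz by (auto simp: \<phi>_def)
    moreover have "\<phi> (hd u) = \<zeta> ^ k * \<phi> (hd u)"
      using path[OF u(1)] unfolding u(3) u(2)[symmetric] .
    ultimately show "0 < k \<and> \<zeta> ^ k = 1" using u(4) by simp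
  qed
  then show ?thesis using \<rho> by (simp add: \<zeta>_def)
qed

lemma peripheral_eigenvalue:
  assumes wd: "weighted_digraph V w" and \<rho>: "0 < digraph_spectral_radius V w"
    and ap: "\<And>C. basic_class V w C \<Longrightarrow> aperiodic_class w C"
    and z: "z \<in> adj_spectrum V w" "norm z = digraph_spectral_radius V w"
  shows "z = complex_of_real (digraph_spectral_radius V w)"
proof -
  have fin: "finite V" using wd by (simp add: weighted_digraph_def)
  obtain v y where v: "y \<in> V" "v y \<noteq> 0"
    "\<And>x. x \<in> V \<Longrightarrow> (\<Sum>y\<in>V. complex_of_real (w x y) * v y) = z * v x"
    using adj_spectrum_eigenvector[OF fin z(1)] by metis
  \<comment> \<open>A vertex of the support with the fewest support vertices accessible from it lies
    in a most downstream class that the support meets.\<close>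
  define R where "R x = {y. accessible V w x y \<and> v y \<noteq> 0}" for x
  have finR: "finite (R x)" for x
    using fin by (rule finite_subset[rotated]) (auto simp: R_def dest: accessible_in)
  obtain x where x: "x \<in> V" "v x \<noteq> 0"
    "\<And>y. y \<in> V \<Longrightarrow> v y \<noteq> 0 \<Longrightarrow> card (R x) \<le> card (R y)"
    using ex_has_least_nat[of "\<lambda>x. x \<in> V \<and> v x \<noteq> 0" y "\<lambda>x. card (R x)"] v(1,2) by blast
  define C where "C = access_class V w x"
  have C: "C \<subseteq> V" "x \<in> C" unfolding C_def by (rule access_class_subset, rule access_class_self[OF x(1)])
  have wdC: "weighted_digraph C w" using weighted_digraph_subset[OF wd C(1)] .
  \<comment> \<open>An edge from \<open>C\<close> to a support vertex \<open>y\<close> outside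
    \<open>C\<close> would give \<open>R y\<close> strictly inside \<open>R x\<close>, as
    \<open>y\<close> has no access back to \<open>x\<close>. So the eigenvalue equation restricts to
    \<open>C\<close>.\<close>
  have outside: "w u y = 0 \<or> v y = 0" if u: "u \<in> C" and y: "y \<in> V - C" for u y
  proof (rule ccontr)
    assume "\<not> ?thesis"
    then have "0 < w u y" "v y \<noteq> 0"
      using wd u y C by (auto simp: weighted_digraph_def less_le)
    then have xy: "accessible V w x y"
      using u y C accessible_edge[of u V y w] accessible_trans[of V w x u y]
      by (auto simp: C_def access_class_def)
    then have "\<not> accessible V w y x" using y by (auto simp: C_def access_class_def)
    moreover have "R y \<subseteq> R x" using xy by (auto simp: R_def intro: accessible_trans)
    moreover have "x \<in> R x" using x by (simp add: R_def accessible_refl)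
    ultimately have "R y \<subset> R x" by (auto simp: R_def)
    then have "card (R y) < card (R x)" using finR by (rule psubset_card_mono[rotated])
    then show False using x(3)[of y] y \<open>v y \<noteq> 0\<close> by auto
  qed
  have vC: "(\<Sum>y\<in>C. complex_of_real (w u y) * v y) = z * v u" if u: "u \<in> C" for u
  proof -
    have "(\<Sum>y\<in>C. complex_of_real (w u y) * v y) = (\<Sum>y\<in>V. complex_of_real (w u y) * v y)"
      using fin C outside[OF u] by (intro sum.mono_neutral_left) auto
    then show ?thesis using v(3) u C by auto
  qed
  \<comment> \<open>The restricted eigenvector shows that the radius of \<open>C\<close> is at least
    that of \<open>V\<close>; monotonicity gives equality, so \<open>C\<close> is basic and its
    aperiodicity is available.\<close>
  have sub: "digraph_spectral_radius V w * norm (v u) \<le> adj_op C w (\<lambda>y. norm (v y)) u" if "u \<in> C" for u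
    using norm_eigenvector_subinvariant[OF wdC that vC[OF that]] z(2) by simp
  have "digraph_spectral_radius V w \<le> digraph_spectral_radius C w"
    by (rule digraph_spectral_radius_ge[OF wdC _ sub C(2)]) (use \<rho> x in auto)
  moreover have "digraph_spectral_radius C w \<le> digraph_spectral_radius V w"
    using digraph_spectral_radius_mono[OF wd C(1)] C(2) by blast
  ultimately have eq: "digraph_spectral_radius C w = digraph_spectral_radius V w" by simp
  then have basic: "basic_class V w C"
    using x(1) by (simp add: basic_class_def access_classes_eq C_def)
  have irr: "irreducible_on C w" unfolding C_def by (rule irreducible_access_class)
  note eig = subinvariant_eigen[of C w "\<lambda>y. norm (v y)" x, OF wdC irr _ C(2)]
  show ?thesis
  proof (rule aperiodic_unimodular_eigenvalue[OF wdC ap[OF basic] \<rho> z(2) vC])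
    fix u assume u: "u \<in> C"
    show "adj_op C w (\<lambda>y. norm (v y)) u = digraph_spectral_radius V w * norm (v u)"
      using eig(1)[of u] x(2) sub u by (simp add: eq)
    show "v u \<noteq> 0"
      using eig(2)[of u] x(2) sub u by (simp add: eq)
  qed
qed

subsection \<open>Generating functions of the partition functions\<close>

locale aperiodic_digraph =
  fixes V :: "'v set" and w :: "'v \<Rightarrow> 'v \<Rightarrow> real"
  assumes wd: "weighted_digraph V w" and radius_pos: "0 < digraph_spectral_radius V w"
    and ap: "\<And>C. basic_class V w C \<Longrightarrow> aperiodic_class w C"
begin

abbreviation \<rho> :: real where "\<rho> \<equiv> digraph_spectral_radius V w"

definition z :: "'v \<Rightarrow> nat \<Rightarrow> real" where
  "z x k = ((adj_op V w) ^^ k) (\<lambda>_. 1) x / \<rho> ^ k"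

definition H :: "'v \<Rightarrow> real \<Rightarrow> real" where
  "H x t = (\<Sum>k. z x k * t ^ k)"

lemma fin: "finite V"
  using wd by (simp add: weighted_digraph_def)

lemma w_nonneg: "x \<in> V \<Longrightarrow> y \<in> V \<Longrightarrow> 0 \<le> w x y"
  using wd by (simp add: weighted_digraph_def)

lemma z_0 [simp]: "z x 0 = 1"
  by (simp add: z_def)

lemma z_Suc: "z x (Suc k) = (\<Sum>y\<in>V. w x y * z y k) / \<rho>"
  by (simp add: z_def adj_op_def sum_divide_distrib field_simps)

lemma z_nonneg: "x \<in> V \<Longrightarrow> 0 \<le> z x k"
  using radius_pos by (auto simp: z_def intro!: divide_nonneg_nonneg funpow_adj_op_nonneg[OF wd])

lemma z_expansion:
  assumes x: "x \<in> V"
  obtains I a r B where "dominant_expansion (z x) I a r B"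
proof -
  have ne: "V \<noteq> {}" using x by auto
  have "u = complex_of_real \<rho> \<or> norm u < \<rho>" if "u \<in> adj_spectrum V w" for u
    using adj_spectrum_norm_le[OF fin ne that] peripheral_eigenvalue[OF wd radius_pos ap that]
    by (auto simp: less_le)
  note L = this
  obtain I a r B where "finite I" "0 < r" "r < 1"
    "\<And>k. \<bar>((adj_op V w) ^^ k) (\<lambda>_. 1) x / \<rho> ^ k - (\<Sum>d\<in>I. a d * real (k choose d))\<bar> \<le> B * r ^ k"
    by (rule real_exp_poly_dominant[OF exp_poly_funpow_adj_op[OF fin x] radius_pos L]) (assumption, rule that)
  then show ?thesis
    by (intro that[of I a r B]) (unfold_locales, auto simp: z_def)
qed

lemma summable_z: "x \<in> V \<Longrightarrow> 0 \<le> t \<Longrightarrow> t < 1 \<Longrightarrow> summable (\<lambda>k. z x k * t ^ k)"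
  using z_expansion dominant_expansion.summable_gen_fun by metis

text \<open>Decomposition of a path by its first step; the 1 is the path of length 0.\<close>

lemma H_rec:
  assumes x: "x \<in> V" and t: "0 \<le> t" "t < 1"
  shows "H x t = 1 + t / \<rho> * (\<Sum>y\<in>V. w x y * H y t)"
proof -
  have "H x t - 1 = (\<Sum>k. z x (Suc k) * t ^ Suc k)"
    using suminf_split_head[OF summable_z[OF assms]] by (simp add: H_def)
  also have "\<dots> = (\<Sum>k. \<Sum>y\<in>V. t / \<rho> * (w x y * (z y k * t ^ k)))"
    by (simp add: z_Suc sum_distrib_left sum_distrib_right sum_divide_distrib mult_ac)
  also have "\<dots> = (\<Sum>y\<in>V. \<Sum>k. t / \<rho> * (w x y * (z y k * t ^ k)))"
    using t by (intro suminf_sum summable_mult summable_z)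
  also have "\<dots> = (\<Sum>y\<in>V. t / \<rho> * (w x y * H y t))"
    unfolding H_def using t
    by (intro sum.cong refl trans[OF suminf_mult] arg_cong[where f = "\<lambda>u. t / \<rho> * u"] suminf_mult summable_mult summable_z)
  finally show ?thesis by (simp add: sum_distrib_left)
qed

lemma H_ge_1: "x \<in> V \<Longrightarrow> 0 \<le> t \<Longrightarrow> t < 1 \<Longrightarrow> 1 \<le> H x t"
  using sum_le_suminf[OF summable_z, of x t "{0}"] z_nonneg by (simp add: H_def)

lemma H_nonneg: "x \<in> V \<Longrightarrow> 0 \<le> t \<Longrightarrow> t < 1 \<Longrightarrow> 0 \<le> H x t"
  using H_ge_1 by force

text \<open>Each edge keeps one term of \<open>H_rec\<close>, at the cost of a factor containing
  \<open>t\<close>. Staying above \<open>1/2\<close> bounds this factor away from 0; only the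
  behaviour near 1 matters in the end.\<close>

lemma H_accessible:
  assumes "accessible V w x y"
  shows "\<exists>c>0. \<forall>t\<in>{1/2..<1}. c * H y t \<le> H x t"
  using assms
proof (induction rule: accessible_induct)
  case refl
  show ?case by (intro exI[of _ 1]) auto
next
  case (edge x u)
  then obtain c where c: "c > 0" "\<And>t. t \<in> {1/2..<1} \<Longrightarrow> c * H y t \<le> H u t" by blast
  show ?case
  proof (intro exI[of _ "1 / 2 / \<rho> * w x u * c"] conjI ballI)
    show "0 < 1 / 2 / \<rho> * w x u * c" using c edge radius_pos by simp
    fix t :: real assume t: "t \<in> {1/2..<1}"
    have "1 / 2 / \<rho> * w x u * c * H y t = 1 / 2 / \<rho> * (w x u * (c * H y t))" by simp
    also have "\<dots> \<le> t / \<rho> * (w x u * H u t)"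
      using t c(2)[OF t] edge.hyps radius_pos H_nonneg[of u t]
        H_nonneg[OF conjunct2[OF accessible_in[OF edge.hyps(4)]], of t] c(1)
      by (intro mult_mono divide_right_mono mult_left_mono) auto
    also have "w x u * H u t \<le> (\<Sum>y\<in>V. w x y * H y t)"
      using t edge.hyps fin by (intro member_le_sum[of u V "\<lambda>y. w x y * H y t"]) (auto intro!: mult_nonneg_nonneg H_nonneg w_nonneg)
    then have "t / \<rho> * (w x u * H u t) \<le> t / \<rho> * (\<Sum>y\<in>V. w x y * H y t)"
      using t radius_pos by (intro mult_left_mono) auto
    also have "\<dots> \<le> H x t" using H_rec[of x t] edge.hyps t by simp
    finally show "1 / 2 / \<rho> * w x u * c * H y t \<le> H x t" .
  qed
qed

text \<open>Weighting by a left eigenvector collapses the terms inside \<open>C\<close> to the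
  spectral radius of \<open>C\<close> times the weighted sum itself. The prefactor is
  \<open>1 - t\<close> when \<open>C\<close> is basic and stays bounded away from 0 otherwise; the
  double sum is the contribution of strictly downstream vertices.\<close>

lemma perron_access_class:
  assumes x: "x \<in> V" and C: "C = access_class V w x"
  obtains p where "\<And>x. x \<in> C \<Longrightarrow> 0 < p x"
    "\<And>t. 0 \<le> t \<Longrightarrow> t < 1 \<Longrightarrow>
      (1 - t * digraph_spectral_radius C w / \<rho>) * (\<Sum>x\<in>C. p x * H x t)
      = (\<Sum>x\<in>C. p x) + t / \<rho> * (\<Sum>x\<in>C. \<Sum>y\<in>V - C. p x * (w x y * H y t))"
proof -
  have CV: "C \<subseteq> V" "C \<noteq> {}" 
    using access_class_subset[of V w x] access_class_self[OF x] by (auto simp: C)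
  have wdC: "weighted_digraph C w" by (rule weighted_digraph_subset[OF wd CV(1)])
  obtain p where p: "\<And>x. x \<in> C \<Longrightarrow> 0 < p x"
    "\<And>y. y \<in> C \<Longrightarrow> (\<Sum>x\<in>C. p x * w x y) = digraph_spectral_radius C w * p y"
    using perron_left[OF wdC _ CV(2)] irreducible_access_class unfolding C by metis
  show ?thesis
  proof (rule that[OF p(1)])
    fix t :: real assume t: "0 \<le> t" "t < 1"
    have "(\<Sum>x\<in>C. p x * H x t) = (\<Sum>x\<in>C. p x + t / \<rho> * ((\<Sum>y\<in>C. p x * (w x y * H y t)) + (\<Sum>y\<in>V - C. p x * (w x y * H y t))))"
    proof (rule sum.cong)
      fix u assume u: "u \<in> C"
      have "(\<Sum>y\<in>V. w u y * H y t) = (\<Sum>y\<in>C. w u y * H y t) + (\<Sum>y\<in>V - C. w u y * H y t)"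
        using sum.subset_diff[OF CV(1) fin] by (simp add: add.commute)
      then have "H u t = 1 + t / \<rho> * ((\<Sum>y\<in>C. w u y * H y t) + (\<Sum>y\<in>V - C. w u y * H y t))"
        using H_rec[of u t] u CV t by auto
      then have "p u * H u t = p u + t / \<rho> * (p u * (\<Sum>y\<in>C. w u y * H y t) + p u * (\<Sum>y\<in>V - C. w u y * H y t))"
        by (simp only: distrib_left mult_1_right mult.left_commute[of "p u"])
      then show "p u * H u t = p u + t / \<rho> * ((\<Sum>y\<in>C. p u * (w u y * H y t)) + (\<Sum>y\<in>V - C. p u * (w u y * H y t)))"
        by (simp only: sum_distrib_left)
    qed simp
    also have "\<dots> = (\<Sum>x\<in>C. p x) + t / \<rho> * (\<Sum>x\<in>C. \<Sum>y\<in>C. p x * (w x y * H y t))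
        + t / \<rho> * (\<Sum>x\<in>C. \<Sum>y\<in>V - C. p x * (w x y * H y t))"
      by (simp add: sum.distrib sum_distrib_left distrib_left)
    also have "(\<Sum>x\<in>C. \<Sum>y\<in>C. p x * (w x y * H y t)) = (\<Sum>y\<in>C. (\<Sum>x\<in>C. p x * w x y) * H y t)"
      by (subst sum.swap) (simp add: sum_distrib_right mult.assoc)
    also have "\<dots> = digraph_spectral_radius C w * (\<Sum>x\<in>C. p x * H x t)"
      by (simp add: p(2) sum_distrib_left mult.assoc)
    finally have eq: "(\<Sum>x\<in>C. p x * H x t) = (\<Sum>x\<in>C. p x)
        + t / \<rho> * (digraph_spectral_radius C w * (\<Sum>x\<in>C. p x * H x t))
        + t / \<rho> * (\<Sum>x\<in>C. \<Sum>y\<in>V - C. p x * (w x y * H y t))" .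
    have *: "(1 - t * c / r) * g = P + X" if "g = P + t / r * (c * g) + X" for g P X c r :: real
      using that by (simp add: left_diff_distrib)
    show "(1 - t * digraph_spectral_radius C w / \<rho>) * (\<Sum>x\<in>C. p x * H x t)
      = (\<Sum>x\<in>C. p x) + t / \<rho> * (\<Sum>x\<in>C. \<Sum>y\<in>V - C. p x * (w x y * H y t))"
      by (rule *[OF eq])
  qed
qed

subsection \<open>Chains of basic classes and the order of the singularity\<close>

text \<open>The empty chain is allowed: it describes a vertex without access to a basic class, where
  \<open>H\<close> stays bounded, and it starts the inductions.\<close>

definition chain_from :: "'v \<Rightarrow> 'v set list \<Rightarrow> bool" where
  "chain_from y Ls \<longleftrightarrow> Ls = [] \<or> basic_chain V w Ls \<and> (\<exists>u\<in>hd Ls. accessible V w y u)"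

text \<open>The edge produced is the first one by which a path leaves \<open>C\<close>.\<close>

lemma accessible_exit:
  assumes "accessible V w u v" "u \<in> C" "v \<notin> C"
  shows "\<exists>x\<in>C. \<exists>y\<in>V - C. x \<in> V \<and> 0 < w x y \<and> accessible V w u x \<and> accessible V w y v"
proof -
  have "u \<in> C \<longrightarrow> (\<exists>x\<in>C. \<exists>y\<in>V - C. x \<in> V \<and> 0 < w x y \<and> accessible V w u x \<and> accessible V w y v)"
    using assms(1)
  proof (induction rule: accessible_induct)
    case refl
    then show ?case using assms(3) by simp
  next
    case (edge x y)
    show ?case
    proof
      assume x: "x \<in> C"
      show "\<exists>x'\<in>C. \<exists>y\<in>V - C. x' \<in> V \<and> 0 < w x' y \<and> accessible V w x x' \<and> accessible V w y v"
      proof (cases "y \<in> C")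
        case True
        with edge.IH obtain x' y' where "x' \<in> C" "y' \<in> V - C" "x' \<in> V" "0 < w x' y'"
          "accessible V w y x'" "accessible V w y' v" by blast
        moreover have "accessible V w x x'"
          using accessible_edge[where w = w, OF edge.hyps(1-3)] \<open>accessible V w y x'\<close> by (rule accessible_trans)
        ultimately show ?thesis by blast
      next
        case False
        then show ?thesis using edge.hyps x accessible_refl[of x V w] by blast
      qed
    qed
  qed
  then show ?thesis using assms(2) by blast
qed

lemma basic_class_eq_access_class:
  "basic_class V w L \<Longrightarrow> x \<in> L \<Longrightarrow> x \<in> V \<and> L = access_class V w x"
  by (auto simp: basic_class_def access_classes_eq access_class_eq dest: subsetD[OF access_class_subset])

lemma basic_class_nonempty: "basic_class V w L \<Longrightarrow> L \<noteq> {}"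
  using access_class_self by (fastforce simp: basic_class_def access_classes_eq)

lemma basic_class_radius: "basic_class V w L \<Longrightarrow> digraph_spectral_radius L w = \<rho>"
  by (simp add: basic_class_def)

text \<open>Induction along the chain. For the first class \<open>L\<close>, the product
  \<open>(1 - t) * G t\<close> exceeds the constant term, which suffices if the chain ends there,
  and also the contribution of an edge from \<open>L\<close> towards the rest of the chain, to which
  the induction hypothesis applies. Dividing by \<open>1 - t\<close> adds one to the order.\<close>

lemma H_lower_bound:
  assumes "y \<in> V" "chain_from y Ls"
  shows "\<exists>a>0. \<forall>t\<in>{1/2..<1}. a \<le> (1 - t) ^ length Ls * H y t"
  using assms
proof (induction Ls arbitrary: y)
  case Nil
  then show ?case by (intro exI[of _ 1]) (auto intro!: H_ge_1)
next
  case (Cons L Ls)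
  then have chain: "basic_chain V w (L # Ls)" and "\<exists>u\<in>L. accessible V w y u"
    by (auto simp: chain_from_def)
  then obtain u where u: "u \<in> L" "accessible V w y u" by blast
  have basic: "basic_class V w L" using chain by (simp add: basic_chain_def)
  have uV: "u \<in> V" and L: "L = access_class V w u"
    using basic_class_eq_access_class[OF basic u(1)] by auto
  have LV: "L \<subseteq> V" unfolding L by (rule access_class_subset)
  have finL: "finite L" using LV fin by (rule finite_subset)
  obtain p where p: "\<And>x. x \<in> L \<Longrightarrow> 0 < p x"
    "\<And>t. 0 \<le> t \<Longrightarrow> t < 1 \<Longrightarrow>
      (1 - t * digraph_spectral_radius L w / \<rho>) * (\<Sum>x\<in>L. p x * H x t)
      = (\<Sum>x\<in>L. p x) + t / \<rho> * (\<Sum>x\<in>L. \<Sum>y\<in>V - L. p x * (w x y * H y t))"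
    by (rule perron_access_class[OF uV L]) (rule that)
  define G where "G t = (\<Sum>x\<in>L. p x * H x t)" for t
  have G: "(1 - t) * G t = (\<Sum>x\<in>L. p x) + t / \<rho> * (\<Sum>x\<in>L. \<Sum>y\<in>V - L. p x * (w x y * H y t))"
    if "t \<in> {1/2..<1}" for t
    using p(2)[of t] that radius_pos basic_class_radius[OF basic] by (simp add: G_def)
  have terms: "0 \<le> p x * (w x y * H y t)" if "t \<in> {1/2..<1}" "x \<in> L" "y \<in> V - L" for t x y
    using that LV p(1)[of x] by (auto intro!: mult_nonneg_nonneg H_nonneg w_nonneg)
  have psum: "0 < (\<Sum>x\<in>L. p x)" using p(1) finL u(1) by (intro sum_pos) auto
  have "\<exists>a>0. \<forall>t\<in>{1/2..<1}. a \<le> (1 - t) ^ length Ls * ((1 - t) * G t)"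
  proof (cases "Ls = []")
    case True
    have "(\<Sum>x\<in>L. p x) \<le> (1 - t) * G t" if t: "t \<in> {1/2..<1}" for t
      unfolding G[OF t] using t radius_pos
      by (auto intro!: mult_nonneg_nonneg divide_nonneg_nonneg sum_nonneg terms[OF t])
    then show ?thesis using True psum by auto
  next
    case False
    then have chain': "basic_chain V w Ls" and acc: "class_accessible V w L (hd Ls)" and ne: "hd Ls \<noteq> L"
      and basic': "basic_class V w (hd Ls)"
      using chain by (cases Ls; auto simp: basic_chain_def)+
    obtain s v where sv: "s \<in> L" "v \<in> hd Ls" "accessible V w s v"
      using acc by (auto simp: class_accessible_def)
    have "v \<notin> L"
      using basic_class_eq_access_class[OF basic', of v] basic_class_eq_access_class[OF basic, of v] sv(2) ne by auto
    then obtain x' y' where xy: "x' \<in> L" "y' \<in> V - L" "0 < w x' y'" "accessible V w y' v"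
      using accessible_exit[OF sv(3,1)] by blast
    have "chain_from y' Ls" using chain' sv(2) xy(4) by (auto simp: chain_from_def)
    then obtain a where a: "a > 0" "\<And>t. t \<in> {1/2..<1} \<Longrightarrow> a \<le> (1 - t) ^ length Ls * H y' t"
      using Cons.IH[of y'] xy(2) by blast
    show ?thesis
    proof (intro exI[of _ "1 / 2 / \<rho> * (p x' * w x' y') * a"] conjI ballI)
      show "0 < 1 / 2 / \<rho> * (p x' * w x' y') * a"
        using a xy p(1)[of x'] radius_pos by simp
      fix t :: real assume t: "t \<in> {1/2..<1}"
      have "1 / 2 / \<rho> * (p x' * w x' y') * a \<le> t / \<rho> * (p x' * w x' y') * ((1 - t) ^ length Ls * H y' t)"
        using t a(2)[OF t] xy p(1)[of x'] radius_pos a(1)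
        by (intro mult_mono divide_right_mono) (auto intro!: mult_nonneg_nonneg H_nonneg)
      also have "\<dots> = (1 - t) ^ length Ls * (t / \<rho> * (p x' * (w x' y' * H y' t)))"
        by simp
      also have "\<dots> \<le> (1 - t) ^ length Ls * ((1 - t) * G t)"
      proof (intro mult_left_mono)
        have "p x' * (w x' y' * H y' t) \<le> (\<Sum>y\<in>V - L. p x' * (w x' y * H y t))"
          using xy fin by (intro member_le_sum[of y' "V - L" "\<lambda>y. p x' * (w x' y * H y t)"]) (auto intro: terms[OF t])
        also have "\<dots> \<le> (\<Sum>x\<in>L. \<Sum>y\<in>V - L. p x * (w x y * H y t))"
          using xy finL
          by (intro member_le_sum[of x' L "\<lambda>x. \<Sum>y\<in>V - L. p x * (w x y * H y t)"]) (auto intro!: sum_nonneg terms[OF t])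
        finally show "t / \<rho> * (p x' * (w x' y' * H y' t)) \<le> (1 - t) * G t"
          unfolding G[OF t] using t radius_pos psum by (intro add_increasing mult_left_mono) auto
      qed (use t in auto)
      finally show "1 / 2 / \<rho> * (p x' * w x' y') * a \<le> (1 - t) ^ length Ls * ((1 - t) * G t)" .
    qed
  qed
  then obtain a where a: "a > 0" "\<And>t. t \<in> {1/2..<1} \<Longrightarrow> a \<le> (1 - t) ^ length Ls * ((1 - t) * G t)"
    by blast
  have "\<forall>x\<in>L. \<exists>c>0. \<forall>t\<in>{1/2..<1}. c * H x t \<le> H y t"
  proof
    fix x assume "x \<in> L"
    then have "accessible V w y x"
      using u(2) unfolding L access_class_def by (auto intro: accessible_trans)
    then show "\<exists>c>0. \<forall>t\<in>{1/2..<1}. c * H x t \<le> H y t" by (rule H_accessible)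
  qed
  then obtain c where c: "\<And>x. x \<in> L \<Longrightarrow> c x > 0" "\<And>x t. x \<in> L \<Longrightarrow> t \<in> {1/2..<1} \<Longrightarrow> c x * H x t \<le> H y t"
    by metis
  \<comment> \<open>Every vertex of \<open>L\<close> is accessible from \<open>y\<close>, so each
    \<open>H x\<close> is bounded by a multiple of \<open>H y\<close>; \<open>K\<close> collects the
    constants.\<close>
  define K where "K = (\<Sum>x\<in>L. p x / c x)"
  have K: "0 < K" unfolding K_def using p(1) c(1) finL u(1) by (intro sum_pos) auto
  have GK: "G t \<le> K * H y t" if t: "t \<in> {1/2..<1}" for t
    unfolding G_def K_def sum_distrib_right
  proof (rule sum_mono)
    fix x assume x: "x \<in> L"
    have "p x / c x * (c x * H x t) \<le> p x / c x * H y t"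
      using c(2)[OF x t] c(1)[OF x] p(1)[OF x] by (intro mult_left_mono) auto
    then show "p x * H x t \<le> p x / c x * H y t" using c(1)[OF x] by simp
  qed
  show ?case
  proof (intro exI[of _ "a / K"] conjI ballI)
    show "0 < a / K" using a(1) K by simp
    fix t :: real assume t: "t \<in> {1/2..<1}"
    have "a \<le> (1 - t) ^ Suc (length Ls) * G t" using a(2)[OF t] by (simp add: mult_ac)
    also have "\<dots> \<le> (1 - t) ^ Suc (length Ls) * (K * H y t)"
      using GK[OF t] t by (intro mult_left_mono) auto
    finally show "a / K \<le> (1 - t) ^ length (L # Ls) * H y t"
      using K by (simp add: field_simps)
  qed
qed

text \<open>Within a class all vertices are mutually accessible, so access to one vertex of the
  first class propagates down the chain. This shows later that the class of \<open>y\<close> cannot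
  reappear in a chain starting strictly downstream of \<open>y\<close>.\<close>

lemma chain_from_member:
  assumes "basic_chain V w Ls" "u \<in> hd Ls" "accessible V w y u" "L \<in> set Ls" "x \<in> L"
  shows "accessible V w y x"
  using assms
proof (induction Ls arbitrary: y u)
  case (Cons L' Ls)
  have L': "accessible V w y x'" if "x' \<in> L'" for x'
  proof -
    have "x' \<in> access_class V w u"
      using basic_class_eq_access_class[of L' u] Cons.prems(1,2) that by (auto simp: basic_chain_def)
    then show ?thesis using Cons.prems(3) by (auto simp: access_class_def intro: accessible_trans)
  qed
  show ?case
  proof (cases "L = L'")
    case True
    then show ?thesis using L' Cons.prems by simp
  next
    case False
    then have "L \<in> set Ls" "Ls \<noteq> []" using Cons.prems by auto
    then have "basic_chain V w Ls" "class_accessible V w L' (hd Ls)"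
      using Cons.prems(1) by (cases Ls; auto simp: basic_chain_def)+
    then obtain s v where "s \<in> L'" "v \<in> hd Ls" "accessible V w s v" by (auto simp: class_accessible_def)
    then show ?thesis
      using Cons.IH[OF \<open>basic_chain V w Ls\<close>, of v y] L'[of s] Cons.prems \<open>L \<in> set Ls\<close>
      by (blast intro: accessible_trans)
  qed
qed (simp add: basic_chain_def)

text \<open>Induction on the number of reachable vertices, which drops strictly when the class of
  \<open>y\<close> is left. The chain is constructed along with its bound, so its maximality need
  not be known beforehand; the lower bound supplies it afterwards.\<close>

lemma H_upper_bound:
  assumes "y \<in> V"
  shows "\<exists>Ls b. chain_from y Ls \<and> (\<forall>t\<in>{1/2..<1}. (1 - t) ^ length Ls * H y t \<le> b)"
  using assms
proof (induction "card (reachable V w y)" arbitrary: y rule: less_induct)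
  case less
  define C where "C = access_class V w y"
  have yC: "y \<in> C" unfolding C_def by (rule access_class_self[OF less.prems])
  have CV: "C \<subseteq> V" unfolding C_def by (rule access_class_subset)
  have finC: "finite C" using CV fin by (rule finite_subset)
  obtain p where p: "\<And>x. x \<in> C \<Longrightarrow> 0 < p x"
    "\<And>t. 0 \<le> t \<Longrightarrow> t < 1 \<Longrightarrow>
      (1 - t * digraph_spectral_radius C w / \<rho>) * (\<Sum>x\<in>C. p x * H x t)
      = (\<Sum>x\<in>C. p x) + t / \<rho> * (\<Sum>x\<in>C. \<Sum>y\<in>V - C. p x * (w x y * H y t))"
    by (rule perron_access_class[OF less.prems C_def]) (rule that)
  define G where "G t = (\<Sum>x\<in>C. p x * H x t)" for t
  \<comment> \<open>The vertices outside \<open>C\<close> entered by an edge from \<open>C\<close>: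
    the only sources of terms in the double sum.\<close>
  define D where "D = {v \<in> V - C. \<exists>x\<in>C. 0 < w x v}"
  have finD: "finite D" using fin by (simp add: D_def)
  have accD: "accessible V w y v" "\<not> accessible V w v y" "v \<in> V" if v: "v \<in> D" for v
  proof -
    obtain x where x: "x \<in> C" "0 < w x v" using v by (auto simp: D_def)
    show "v \<in> V" using v by (simp add: D_def)
    have "accessible V w y x" using x(1) by (simp add: C_def access_class_def)
    then show "accessible V w y v"
      using accessible_edge[of x V v w] x CV \<open>v \<in> V\<close> by (blast intro: accessible_trans)
    then show "\<not> accessible V w v y" using v by (auto simp: D_def C_def access_class_def)
  qed
  have "\<forall>v\<in>D. \<exists>Ls b. chain_from v Ls \<and> (\<forall>t\<in>{1/2..<1}. (1 - t) ^ length Ls * H v t \<le> b)"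
  proof
    fix v assume v: "v \<in> D"
    have "reachable V w v \<subset> reachable V w y"
      using accD[OF v] less.prems accessible_refl[of y V w]
      by (auto simp: reachable_def intro: accessible_trans)
    then have "card (reachable V w v) < card (reachable V w y)"
      using fin by (intro psubset_card_mono) (auto simp: reachable_def)
    then show "\<exists>Ls b. chain_from v Ls \<and> (\<forall>t\<in>{1/2..<1}. (1 - t) ^ length Ls * H v t \<le> b)"
      using less.hyps accD(3)[OF v] by blast
  qed
  then obtain Lf bf where Lf: "\<And>v. v \<in> D \<Longrightarrow> chain_from v (Lf v)"
    "\<And>v t. v \<in> D \<Longrightarrow> t \<in> {1/2..<1} \<Longrightarrow> (1 - t) ^ length (Lf v) * H v t \<le> bf v"
    by metis
  \<comment> \<open>The longest of the chains chosen at the exits dominates all their orders.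
    Without exits it is empty.\<close>
  obtain Ls where Ls: "Ls = [] \<or> (\<exists>v\<in>D. Ls = Lf v)" "\<And>v. v \<in> D \<Longrightarrow> length (Lf v) \<le> length Ls"
  proof (cases "D = {}")
    case True
    then show ?thesis using that[of "[]"] by simp
  next
    case False
    have "Max ((length \<circ> Lf) ` D) \<in> (length \<circ> Lf) ` D" using False finD by (intro Max_in) auto
    then obtain v where v: "v \<in> D" "length (Lf v) = Max ((length \<circ> Lf) ` D)" by auto
    have "length (Lf u) \<le> Max ((length \<circ> Lf) ` D)" if "u \<in> D" for u
      using that finD by (intro Max_ge) auto
    then show ?thesis using that[of "Lf v"] v by auto
  qed
  let ?n = "length Ls"
  \<comment> \<open>For \<open>y\<close> outside \<open>D\<close> the value \<open>bf y\<close> is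
    arbitrary, but then \<open>w x y = 0\<close> for all \<open>x \<in> C\<close>.\<close>
  define b' where "b' = (\<Sum>x\<in>C. p x) + 1 / \<rho> * (\<Sum>x\<in>C. \<Sum>y\<in>V - C. p x * (w x y * bf y))"
  have bf0: "0 \<le> bf v" if "v \<in> D" for v
    using Lf(2)[OF that, of "1/2"] H_nonneg[OF accD(3)[OF that], of "1/2"]
    by (auto intro: order_trans[rotated])
  have Gle: "(1 - t) ^ ?n * ((1 - t * digraph_spectral_radius C w / \<rho>) * G t) \<le> b'" if t: "t \<in> {1/2..<1}" for t
  proof -
    have le1: "(1 - t) ^ ?n \<le> 1" using t by (intro power_le_one) auto
    have tle: "(1 - t) ^ ?n * (p x * (w x v * H v t)) \<le> p x * (w x v * bf v)" and
      tle0: "0 \<le> p x * (w x v * bf v)"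
      if x: "x \<in> C" and v: "v \<in> V - C" for x v
    proof -
      show "(1 - t) ^ ?n * (p x * (w x v * H v t)) \<le> p x * (w x v * bf v)"
      proof (cases "v \<in> D")
        case True
        have "(1 - t) ^ ?n \<le> (1 - t) ^ length (Lf v)"
          using t Ls(2)[OF True] by (intro power_decreasing) auto
        then have "(1 - t) ^ ?n * H v t \<le> (1 - t) ^ length (Lf v) * H v t"
          using H_nonneg[of v t] v t by (intro mult_right_mono) auto
        then have "(1 - t) ^ ?n * H v t \<le> bf v" using Lf(2)[OF True t] by linarith
        then have "p x * w x v * ((1 - t) ^ ?n * H v t) \<le> p x * w x v * bf v"
          using x v CV p(1)[OF x] w_nonneg[of x v] by (intro mult_left_mono) auto
        then show ?thesis by (simp add: mult_ac)
      next
        case False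
        then have "w x v = 0" using x v CV w_nonneg[of x v] by (force simp: D_def)
        then show ?thesis by simp
      qed
      show "0 \<le> p x * (w x v * bf v)"
      proof (cases "v \<in> D")
        case True
        then show ?thesis using x v CV p(1)[OF x] w_nonneg[of x v] bf0 by auto
      next
        case False
        then have "w x v = 0" using x v CV w_nonneg[of x v] by (force simp: D_def)
        then show ?thesis by simp
      qed
    qed
    have "(1 - t) ^ ?n * ((1 - t * digraph_spectral_radius C w / \<rho>) * G t)
       = (1 - t) ^ ?n * (\<Sum>x\<in>C. p x) + t / \<rho> * (\<Sum>x\<in>C. \<Sum>v\<in>V - C. (1 - t) ^ ?n * (p x * (w x v * H v t)))"
      using p(2)[of t] t by (simp add: G_def distrib_left sum_distrib_left mult_ac)
    also have "\<dots> \<le> 1 * (\<Sum>x\<in>C. p x) + 1 / \<rho> * (\<Sum>x\<in>C. \<Sum>y\<in>V - C. p x * (w x y * bf y))"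
    proof (intro add_mono mult_right_mono le1)
      show "0 \<le> (\<Sum>x\<in>C. p x)" using p(1) by (intro sum_nonneg) (simp add: less_imp_le)
      have "t / \<rho> * (\<Sum>x\<in>C. \<Sum>v\<in>V - C. (1 - t) ^ ?n * (p x * (w x v * H v t)))
          \<le> t / \<rho> * (\<Sum>x\<in>C. \<Sum>y\<in>V - C. p x * (w x y * bf y))"
        using t radius_pos by (intro mult_left_mono sum_mono tle) auto
      also have "\<dots> \<le> 1 / \<rho> * (\<Sum>x\<in>C. \<Sum>y\<in>V - C. p x * (w x y * bf y))"
        using t radius_pos by (intro mult_right_mono divide_right_mono sum_nonneg tle0) auto
      finally show "t / \<rho> * (\<Sum>x\<in>C. \<Sum>v\<in>V - C. (1 - t) ^ ?n * (p x * (w x v * H v t)))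
          \<le> 1 / \<rho> * (\<Sum>x\<in>C. \<Sum>y\<in>V - C. p x * (w x y * bf y))" .
    qed
    finally show ?thesis by (simp add: b'_def)
  qed
  have HG: "p y * H y t \<le> G t" if t: "t \<in> {1/2..<1}" for t
    unfolding G_def using yC finC t CV p(1)
    by (intro member_le_sum[of y C "\<lambda>x. p x * H x t"]) (auto intro!: mult_nonneg_nonneg H_nonneg simp: less_imp_le)
  have py: "0 < p y" using p(1)[OF yC] .
  \<comment> \<open>If \<open>C\<close> occurred in the chain of an exit \<open>v\<close>, then
    \<open>v\<close> would have access back to \<open>y\<close>. This makes \<open>C # Ls\<close>
    distinct when \<open>C\<close> is basic.\<close>
  have LsC: "C \<notin> set Ls" "Ls = [] \<or> (basic_chain V w Ls \<and> (\<exists>u\<in>hd Ls. accessible V w y u))"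
  proof -
    show "C \<notin> set Ls"
    proof
      assume "C \<in> set Ls"
      then obtain v where v: "v \<in> D" "Ls = Lf v" using Ls(1) by auto
      then obtain u where "basic_chain V w Ls" "u \<in> hd Ls" "accessible V w v u"
        using Lf(1)[OF v(1)] \<open>C \<in> set Ls\<close> by (auto simp: chain_from_def)
      from chain_from_member[OF this \<open>C \<in> set Ls\<close> yC] show False using accD(2)[OF v(1)] by simp
    qed
    show "Ls = [] \<or> (basic_chain V w Ls \<and> (\<exists>u\<in>hd Ls. accessible V w y u))"
    proof (cases "Ls = []")
      case False
      then obtain v where v: "v \<in> D" "Ls = Lf v" using Ls(1) by auto
      then show ?thesis
        using False Lf(1)[OF v(1)] accD(1)[OF v(1)] unfolding chain_from_def
        by (blast intro: accessible_trans)
    qed simp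
  qed
  show ?case
  proof (cases "basic_class V w C")
    case True
    have "class_accessible V w C (hd Ls)" if "Ls \<noteq> []"
      using LsC(2) that yC by (auto simp: class_accessible_def)
    then have "basic_chain V w (C # Ls)"
      using True LsC by (cases Ls) (auto simp: basic_chain_def)
    then have "chain_from y (C # Ls)" using yC less.prems accessible_refl[of y V w] by (auto simp: chain_from_def)
    moreover have "(1 - t) ^ length (C # Ls) * H y t \<le> b' / p y" if t: "t \<in> {1/2..<1}" for t
    proof -
      have "(1 - t) ^ length (C # Ls) * (p y * H y t) \<le> (1 - t) ^ length (C # Ls) * G t"
        using HG[OF t] t by (intro mult_left_mono) auto
      also have "\<dots> = (1 - t) ^ ?n * ((1 - t * digraph_spectral_radius C w / \<rho>) * G t)"
        using basic_class_radius[OF True] radius_pos by (simp add: mult_ac)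
      also have "\<dots> \<le> b'" by (rule Gle[OF t])
      finally show ?thesis using py by (simp add: field_simps)
    qed
    ultimately show ?thesis by blast
  next
    case False
    then have "digraph_spectral_radius C w \<noteq> \<rho>"
      using less.prems by (simp add: basic_class_def access_classes_eq C_def)
    then have lt: "digraph_spectral_radius C w < \<rho>"
      using digraph_spectral_radius_mono[OF wd CV] yC by fastforce
    have r0: "0 \<le> digraph_spectral_radius C w" using digraph_spectral_radius_nonneg[OF finC] yC by blast
    \<comment> \<open>The value at \<open>t = 1\<close> bounds the prefactor from below for all
      smaller \<open>t\<close>. Since it is positive, a class that is not basic leaves the order
      unchanged.\<close>
    define \<delta> where "\<delta> = 1 - digraph_spectral_radius C w / \<rho>"
    have \<delta>: "0 < \<delta>" using lt radius_pos by (simp add: \<delta>_def)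
    have "(1 - t) ^ ?n * H y t \<le> b' / (\<delta> * p y)" if t: "t \<in> {1/2..<1}" for t
    proof -
      have G0: "0 \<le> G t" using HG[OF t] py H_nonneg[OF less.prems, of t] t
        by (smt (verit) atLeastLessThan_iff divide_nonneg_nonneg mult_nonneg_nonneg)
      have "t * digraph_spectral_radius C w / \<rho> \<le> 1 * digraph_spectral_radius C w / \<rho>"
        using t r0 radius_pos by (intro divide_right_mono mult_right_mono) auto
      then have d: "\<delta> \<le> 1 - t * digraph_spectral_radius C w / \<rho>" by (simp add: \<delta>_def)
      have "(1 - t) ^ ?n * (\<delta> * (p y * H y t)) \<le> (1 - t) ^ ?n * ((1 - t * digraph_spectral_radius C w / \<rho>) * G t)"
        using t d HG[OF t] \<delta> G0 py H_nonneg[OF less.prems, of t] by (intro mult_left_mono mult_mono) auto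
      also have "\<dots> \<le> b'" by (rule Gle[OF t])
      finally show ?thesis using py \<delta> by (simp add: field_simps)
    qed
    moreover have "chain_from y Ls" using LsC(2) by (auto simp: chain_from_def)
    ultimately show ?thesis by blast
  qed
qed

end

subsection \<open>The residual matrix\<close>

context aperiodic_digraph
begin

text \<open>The link between \<Theta> and \<open>H\<close>: summing a row of the path generating
  matrix at \<open>s = t / \<rho>\<close> counts paths with any end vertex.\<close>

lemma sum_path_gen_fun:
  assumes x: "x \<in> V" and t: "0 \<le> t" "t < 1"
  shows "(\<Sum>y\<in>V. path_gen_fun V w (t / \<rho>) x y) = H x t"
proof -
  let ?e = "\<lambda>k y. mat_entry V (adj_matrix V w ^\<^sub>m k) x y"
  have ne: "V \<noteq> {}" using x by auto
  \<comment> \<open>For \<open>t > 0\<close> this lies strictly between \<rho> and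
    \<open>\<rho> / t\<close>: above the spectral radius, yet with
    \<open>r * (t / \<rho>) < 1\<close>, so the comparison series is geometric and
    converges.\<close>
  define r where "r = 2 * \<rho> / (1 + t)"
  have r: "\<rho> < r" using t radius_pos by (simp add: r_def field_simps)
  have rt: "r * (t / \<rho>) = 2 * t / (1 + t)" using radius_pos by (simp add: r_def)
  have lt: "2 * t / (1 + t) < 1" "0 \<le> 2 * t / (1 + t)" using t by (simp_all add: field_simps)
  have summ: "summable (\<lambda>k. ?e k y * (t / \<rho>) ^ k)" if y: "y \<in> V" for y
  proof -
    have e: "?e k y = ((adj_op V w) ^^ k) (\<lambda>u. if u = y then 1 else 0) x" for k
      using fin y by (simp add: funpow_adj_op[OF fin x] if_distrib[of "\<lambda>c. _ * c"] cong: if_cong)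
    obtain B where B: "B \<ge> 0" "\<And>k x. x \<in> V \<Longrightarrow> \<bar>((adj_op V w) ^^ k) (\<lambda>u. if u = y then 1 else 0) x\<bar> \<le> B * r ^ k"
      by (rule funpow_adj_op_bound[OF fin ne r]) (rule that)
    show ?thesis
    proof (rule summable_comparison_test')
      show "summable (\<lambda>k. B * (2 * t / (1 + t)) ^ k)"
        using lt by (intro summable_mult summable_geometric) (simp only: real_norm_def abs_of_nonneg)
      fix k
      have "norm (?e k y * (t / \<rho>) ^ k) = \<bar>?e k y\<bar> * (t / \<rho>) ^ k"
        using t radius_pos by (simp add: abs_mult)
      also have "\<dots> \<le> B * r ^ k * (t / \<rho>) ^ k"
        unfolding e using t radius_pos by (intro mult_right_mono B(2)[OF x]) auto
      also have "\<dots> = B * (2 * t / (1 + t)) ^ k"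
        by (simp only: rt[symmetric] power_mult_distrib mult.assoc)
      finally show "norm (?e k y * (t / \<rho>) ^ k) \<le> B * (2 * t / (1 + t)) ^ k" .
    qed
  qed
  have "(\<Sum>y\<in>V. path_gen_fun V w (t / \<rho>) x y) = (\<Sum>k. \<Sum>y\<in>V. ?e k y * (t / \<rho>) ^ k)"
    unfolding path_gen_fun_def by (rule suminf_sum[symmetric]) (rule summ)
  also have "\<dots> = H x t"
    unfolding H_def
    by (intro suminf_cong)
      (simp add: z_def funpow_adj_op[OF fin x] power_divide sum_divide_distrib sum_distrib_right)
  finally show ?thesis .
qed

text \<open>A finite limit at order \<open>h\<close> forces the limit 0 at every higher order,
  against a positive lower bound there. At order \<open>h\<close> itself the lower bound passes to
  the limit.\<close>

lemma chain_from_order_le: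
  assumes y: "y \<in> V" "chain_from y Ls"
    and lim: "((\<lambda>t. (1 - t) ^ h * H y t) \<longlongrightarrow> c) (at_left 1)"
  shows "length Ls \<le> h" "length Ls = h \<Longrightarrow> 0 < c"
proof -
  obtain a where a: "0 < a" "\<And>t. t \<in> {1/2..<1} \<Longrightarrow> a \<le> (1 - t) ^ length Ls * H y t"
    using H_lower_bound[OF y] by blast
  have ev: "\<forall>\<^sub>F t::real in at_left 1. t \<in> {1/2..<1}"
    using eventually_at_left_real[of "1/2" 1] by (auto elim: eventually_mono)
  show "length Ls \<le> h"
  proof (rule ccontr)
    assume n: "\<not> length Ls \<le> h"
    have "((\<lambda>t. (1 - t) ^ (length Ls - h) * ((1 - t) ^ h * H y t)) \<longlongrightarrow> (1 - 1) ^ (length Ls - h) * c) (at_left 1)"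
      by (intro tendsto_mult lim tendsto_power tendsto_diff tendsto_const tendsto_ident_at)
    moreover have "\<forall>\<^sub>F t in at_left 1. a \<le> (1 - t) ^ (length Ls - h) * ((1 - t) ^ h * H y t)"
      using ev
    proof eventually_elim
      case (elim t)
      then show ?case using a(2)[OF elim] n by (simp add: mult.assoc[symmetric] flip: power_add)
    qed
    ultimately have "a \<le> (1 - 1) ^ (length Ls - h) * c"
      by (rule tendsto_lowerbound) simp
    then show False using a(1) n by (simp add: power_0_left)
  qed
  assume "length Ls = h"
  then have "\<forall>\<^sub>F t in at_left 1. a \<le> (1 - t) ^ h * H y t"
    using ev a(2) by (auto elim: eventually_mono)
  from tendsto_lowerbound[OF lim this] show "0 < c" using a(1) by simp
qed

text \<open>A chain shorter than \<open>h\<close> with a matching upper bound would force the limit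
  at order \<open>h\<close> to be 0.\<close>

lemma order_positive_chain_from:
  assumes y: "y \<in> V"
    and lim: "((\<lambda>t. (1 - t) ^ h * H y t) \<longlongrightarrow> c) (at_left 1)" and c: "0 < c"
  obtains Ls where "chain_from y Ls" "h \<le> length Ls"
proof -
  obtain Ls b where Ls: "chain_from y Ls" and b: "\<And>t. t \<in> {1/2..<1} \<Longrightarrow> (1 - t) ^ length Ls * H y t \<le> b"
    using H_upper_bound[OF y] by blast
  have ev: "\<forall>\<^sub>F t::real in at_left 1. t \<in> {1/2..<1}"
    using eventually_at_left_real[of "1/2" 1] by (auto elim: eventually_mono)
  have "h \<le> length Ls"
  proof (rule ccontr)
    assume n: "\<not> h \<le> length Ls"
    have "((\<lambda>t. (1 - t) ^ (h - length Ls) * b) \<longlongrightarrow> (1 - 1) ^ (h - length Ls) * b) (at_left 1)"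
      by (intro tendsto_mult tendsto_power tendsto_diff tendsto_const tendsto_ident_at)
    moreover have "\<forall>\<^sub>F t in at_left 1. (1 - t) ^ h * H y t \<le> (1 - t) ^ (h - length Ls) * b"
      using ev
    proof eventually_elim
      case (elim t)
      have "(1 - t) ^ h * H y t = (1 - t) ^ (h - length Ls) * ((1 - t) ^ length Ls * H y t)"
        using n by (simp add: mult.assoc[symmetric] flip: power_add)
      then show ?case using b[OF elim] elim by (auto intro!: mult_left_mono)
    qed
    ultimately have "c \<le> (1 - 1) ^ (h - length Ls) * b"
      by (intro tendsto_le[OF _ _ lim]) auto
    then show False using c n by (simp add: power_0_left)
  qed
  then show ?thesis using Ls that by blast
qed

end

section \<open>Row sums of the residual matrix as a harmonic vector\<close>

locale residual_digraph = aperiodic_digraph +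
  fixes \<Theta> :: "'a \<Rightarrow> 'a \<Rightarrow> real" and x0 :: 'a
  assumes residual: "is_residual_matrix V w \<Theta>" and x0: "x0 \<in> V"
    and all_accessible: "\<And>y. y \<in> V \<Longrightarrow> accessible V w x0 y"
begin

definition c :: "'a \<Rightarrow> real" where "c = mult_ones V \<Theta>"

lemma c_nonneg: "y \<in> V \<Longrightarrow> 0 \<le> c y"
  using residual by (auto simp: c_def mult_ones_def is_residual_matrix_def intro!: sum_nonneg)

lemma c_nonzero: "\<exists>y\<in>V. 0 < c y"
proof -
  obtain x y where xy: "x \<in> V" "y \<in> V" "\<Theta> x y \<noteq> 0" and nn: "\<And>x y. x \<in> V \<Longrightarrow> y \<in> V \<Longrightarrow> 0 \<le> \<Theta> x y"
    using residual by (auto simp: is_residual_matrix_def)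
  have "0 < c x"
    unfolding c_def mult_ones_def using fin xy nn by (intro sum_pos2[of _ y]) (auto simp: less_le)
  then show ?thesis using xy by blast
qed

text \<open>One exponent serves all vertices, so the limits are comparable with each other; where
  the order is lower, the limit is 0.\<close>

lemma H_residual:
  obtains h where "0 < h" "\<And>y. y \<in> V \<Longrightarrow> ((\<lambda>t. (1 - t) ^ h * H y t) \<longlongrightarrow> c y) (at_left 1)"
proof -
  obtain h :: nat where h: "0 < h" and lim: "\<And>x y. x \<in> V \<Longrightarrow> y \<in> V \<Longrightarrow>
      ((\<lambda>s. (1 - \<rho> * s) ^ h * path_gen_fun V w s x y) \<longlongrightarrow> \<Theta> x y) (at (inverse \<rho>) within {0<..<inverse \<rho>})"
    using residual by (auto simp: is_residual_matrix_def Let_def)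
  have ev: "\<forall>\<^sub>F t::real in at_left 1. 0 < t \<and> t < 1"
    using eventually_at_left_real[of 0 1] by (auto elim: eventually_mono)
  \<comment> \<open>The substitution \<open>s = t / \<rho>\<close> moves the singularity to
    1.\<close>
  have fl: "filterlim (\<lambda>t. t / \<rho>) (at (inverse \<rho>) within {0<..<inverse \<rho>}) (at_left 1)"
    unfolding filterlim_at
  proof
    show "\<forall>\<^sub>F t in at_left 1. t / \<rho> \<in> {0<..<inverse \<rho>} \<and> t / \<rho> \<noteq> inverse \<rho>"
      using ev by eventually_elim (use radius_pos in \<open>auto simp: field_simps\<close>)
    have "((\<lambda>t. t / \<rho>) \<longlongrightarrow> 1 / \<rho>) (at_left 1)"
      using radius_pos by (intro tendsto_divide tendsto_ident_at tendsto_const) auto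
    then show "((\<lambda>t. t / \<rho>) \<longlongrightarrow> inverse \<rho>) (at_left 1)" by (simp add: inverse_eq_divide)
  qed
  show ?thesis
  proof (rule that[OF h])
    fix x assume x: "x \<in> V"
    have "((\<lambda>t. \<Sum>y\<in>V. (1 - \<rho> * (t / \<rho>)) ^ h * path_gen_fun V w (t / \<rho>) x y) \<longlongrightarrow> c x) (at_left 1)"
      unfolding c_def mult_ones_def by (intro tendsto_sum filterlim_compose[OF lim fl] x)
    then show "((\<lambda>t. (1 - t) ^ h * H x t) \<longlongrightarrow> c x) (at_left 1)"
    proof (rule Lim_transform_eventually, use ev in eventually_elim)
      case (elim t)
      then show ?case
        using radius_pos sum_path_gen_fun[OF x, of t] by (simp flip: sum_distrib_left)
    qed
  qed
qed

text \<open>Multiply \<open>H_rec\<close> by \<open>(1 - t) ^ h\<close> and let \<open>t\<close>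
  tend to 1. The constant 1 disappears because \<open>h > 0\<close>.\<close>

lemma c_harmonic:
  assumes x: "x \<in> V"
  shows "\<rho> * c x = (\<Sum>y\<in>V. w x y * c y)"
proof -
  obtain h where h: "0 < h" and lim: "\<And>y. y \<in> V \<Longrightarrow> ((\<lambda>t. (1 - t) ^ h * H y t) \<longlongrightarrow> c y) (at_left 1)"
    by (rule H_residual) (rule that)
  have ev: "\<forall>\<^sub>F t::real in at_left 1. 0 < t \<and> t < 1"
    using eventually_at_left_real[of 0 1] by (auto elim: eventually_mono)
  have "((\<lambda>t. (1 - t) ^ h + t / \<rho> * (\<Sum>y\<in>V. w x y * ((1 - t) ^ h * H y t))) \<longlongrightarrow>
      (1 - 1) ^ h + 1 / \<rho> * (\<Sum>y\<in>V. w x y * c y)) (at_left 1)"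
    using radius_pos
    by (intro tendsto_add tendsto_power tendsto_diff tendsto_const tendsto_ident_at tendsto_mult tendsto_divide tendsto_sum lim) auto
  moreover have "\<forall>\<^sub>F t in at_left 1. (1 - t) ^ h + t / \<rho> * (\<Sum>y\<in>V. w x y * ((1 - t) ^ h * H y t)) = (1 - t) ^ h * H x t"
    using ev
  proof eventually_elim
    case (elim t)
    then have "(1 - t) ^ h * H x t = (1 - t) ^ h * (1 + t / \<rho> * (\<Sum>y\<in>V. w x y * H y t))"
      using H_rec[OF x, of t] by simp
    also have "\<dots> = (1 - t) ^ h + t / \<rho> * ((1 - t) ^ h * (\<Sum>y\<in>V. w x y * H y t))"
      by (simp add: distrib_left)
    finally show ?case by (simp add: sum_distrib_left mult.left_commute)
  qed
  ultimately have "((\<lambda>t. (1 - t) ^ h * H x t) \<longlongrightarrow> (1 - 1) ^ h + 1 / \<rho> * (\<Sum>y\<in>V. w x y * c y)) (at_left 1)"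
    by (rule Lim_transform_eventually)
  from tendsto_unique[OF _ this lim[OF x]] show ?thesis
    using radius_pos h by (auto simp: power_0_left field_simps)
qed

lemma c_pos_edge:
  assumes "x \<in> V" "y \<in> V" "0 < w x y" "0 < c y"
  shows "0 < c x"
proof -
  have "0 < (\<Sum>y\<in>V. w x y * c y)"
    using assms fin by (intro sum_pos2[of _ y]) (auto intro!: mult_nonneg_nonneg w_nonneg c_nonneg)
  then have "0 < \<rho> * c x" using c_harmonic[OF assms(1)] by simp
  then show ?thesis using radius_pos by (simp add: zero_less_mult_iff)
qed

lemma c_pos_accessible: "accessible V w x y \<Longrightarrow> 0 < c y \<Longrightarrow> 0 < c x"
  by (induction rule: accessible_induct) (auto intro: c_pos_edge)

lemma c_x0_pos: "0 < c x0"
  using c_nonzero c_pos_accessible all_accessible by blast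

text \<open>This identifies \<open>h\<close> with the height. Every basic chain is accessible from
  \<open>x0\<close>, so its length is at most \<open>h\<close>, and \<open>c x0 > 0\<close> yields a
  chain of length \<open>h\<close>. Hence the dominant chains are those of length \<open>h\<close>,
  and \<open>c\<close> is positive exactly at the vertices with access to one of them.\<close>

lemma spanned_umbrella_eq: "spanned_umbrella V w x0 = {y \<in> V. 0 < c y}"
proof -
  have R: "reachable V w x0 = V" using all_accessible by (auto simp: reachable_def)
  obtain h where h: "0 < h" and lim: "\<And>y. y \<in> V \<Longrightarrow> ((\<lambda>t. (1 - t) ^ h * H y t) \<longlongrightarrow> c y) (at_left 1)"
    by (rule H_residual) (rule that)
  have le: "length Ls \<le> h" if Ls: "basic_chain V w Ls" for Ls
  proof -
    have "basic_class V w (hd Ls)" using Ls by (auto simp: basic_chain_def)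
    then obtain u where u: "u \<in> hd Ls" "u \<in> V"
      using basic_class_nonempty basic_class_eq_access_class by blast
    then have "chain_from x0 Ls" using Ls all_accessible by (auto simp: chain_from_def)
    then show ?thesis using chain_from_order_le(1)[OF x0 _ lim[OF x0]] by blast
  qed
  have ex: "\<exists>Ls. basic_chain V w Ls \<and> length Ls = h \<and> (\<exists>u\<in>hd Ls. accessible V w y u)"
    if y: "y \<in> V" "0 < c y" for y
  proof -
    obtain Ls where Ls: "chain_from y Ls" "h \<le> length Ls"
      using order_positive_chain_from[OF y(1) lim[OF y(1)] y(2)] by blast
    then have "basic_chain V w Ls" "\<exists>u\<in>hd Ls. accessible V w y u"
      using h by (auto simp: chain_from_def)
    then show ?thesis using Ls(2) le[of Ls] by (intro exI[of _ Ls]) auto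
  qed
  obtain Ls0 where "basic_chain V w Ls0" "length Ls0 = h"
    using ex[OF x0 c_x0_pos] by blast
  then have dom: "dominant_chain V w Ls \<longleftrightarrow> basic_chain V w Ls \<and> length Ls = h" for Ls
    using le by (auto simp: dominant_chain_def intro: le_antisym)
  show ?thesis
  proof (intro equalityI subsetI)
    fix y assume "y \<in> spanned_umbrella V w x0"
    then obtain Ls where y: "y \<in> V" "dominant_chain V w Ls" "\<exists>u\<in>hd Ls. accessible V w y u"
      by (auto simp: spanned_umbrella_def R)
    then have "chain_from y Ls" "length Ls = h" by (auto simp: chain_from_def dom)
    then show "y \<in> {y \<in> V. 0 < c y}"
      using chain_from_order_le(2)[OF y(1) _ lim[OF y(1)]] y(1) by blast
  next
    fix y assume "y \<in> {y \<in> V. 0 < c y}"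
    then show "y \<in> spanned_umbrella V w x0"
      using ex[of y] by (auto simp: spanned_umbrella_def R dom)
  qed
qed

text \<open>Both sequences are compared with the same power of \<open>k\<close>. The shift
  \<open>n\<close> is the length of a fixed prefix: a path of length \<open>k + n\<close> from
  \<open>x0\<close> continues the prefix by \<open>k\<close> further steps.\<close>

lemma z_ratio_tendsto:
  assumes y: "y \<in> V"
  shows "(\<lambda>k. z y k / z x0 (k + n)) \<longlonglongrightarrow> c y / c x0"
proof -
  obtain h where h: "0 < h" and lim: "\<And>y. y \<in> V \<Longrightarrow> ((\<lambda>t. (1 - t) ^ h * H y t) \<longlongrightarrow> c y) (at_left 1)"
    by (rule H_residual) (rule that)
  have asym: "(\<lambda>k. z u k / real k ^ (h - 1)) \<longlonglongrightarrow> c u / fact (h - 1)" if u: "u \<in> V" for u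
  proof -
    obtain I a r B where "dominant_expansion (z u) I a r B" using z_expansion[OF u] by blast
    then show ?thesis
      using dominant_expansion.coefficient_tendsto h lim[OF u] unfolding H_def by blast
  qed
  have "(\<lambda>k. real (k + n) / real k) \<longlonglongrightarrow> 1" by real_asymp
  then have "(\<lambda>k. (real (k + n) / real k) ^ (h - 1)) \<longlonglongrightarrow> 1 ^ (h - 1)" by (rule tendsto_power)
  moreover have "(\<lambda>k. z x0 (k + n) / real (k + n) ^ (h - 1)) \<longlonglongrightarrow> c x0 / fact (h - 1)"
    using LIMSEQ_ignore_initial_segment[OF asym[OF x0]] .
  moreover have "c x0 / fact (h - 1) * 1 ^ (h - 1) \<noteq> 0" using c_x0_pos by simp
  ultimately have "(\<lambda>k. (z y k / real k ^ (h - 1)) /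
      ((z x0 (k + n) / real (k + n) ^ (h - 1)) * (real (k + n) / real k) ^ (h - 1)))
      \<longlonglongrightarrow> (c y / fact (h - 1)) / ((c x0 / fact (h - 1)) * 1 ^ (h - 1))"
    by (intro tendsto_divide[OF asym[OF y]] tendsto_mult)
  then have "(\<lambda>k. (z y k / real k ^ (h - 1)) /
      ((z x0 (k + n) / real (k + n) ^ (h - 1)) * (real (k + n) / real k) ^ (h - 1)))
      \<longlonglongrightarrow> c y / c x0" by simp
  then show ?thesis
  proof (rule Lim_transform_eventually)
    show "\<forall>\<^sub>F k in sequentially. (z y k / real k ^ (h - 1)) /
      ((z x0 (k + n) / real (k + n) ^ (h - 1)) * (real (k + n) / real k) ^ (h - 1)) = z y k / z x0 (k + n)"
      using eventually_gt_at_top[of 0]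
    proof eventually_elim
      case (elim k)
      define A where "A = real k ^ (h - 1)"
      define B where "B = real (k + n) ^ (h - 1)"
      have "A \<noteq> 0" "B \<noteq> 0" using elim by (auto simp: A_def B_def)
      then have "(z y k / A) / ((z x0 (k + n) / B) * (B / A)) = z y k / z x0 (k + n)" by simp
      then show ?case by (simp only: A_def B_def power_divide)
    qed
  qed
qed

text \<open>Harmonicity propagates \<open>c y \<le> M * z y k\<close> from \<open>k\<close> to
  \<open>k + 1\<close>. Weak convergence asks for probability measures at every \<open>k\<close>,
  not only for large \<open>k\<close>, so no partition function at \<open>x0\<close> may
  vanish.\<close>

lemma z_x0_pos: "0 < z x0 k"
proof -
  define M where "M = Max (c ` V)"
  have cM: "c y \<le> M" if "y \<in> V" for y using that fin by (simp add: M_def)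
  have M: "0 < M" using cM[OF x0] c_x0_pos by simp
  have "c y \<le> M * z y k" if "y \<in> V" for y
    using that
  proof (induction k arbitrary: y)
    case 0
    then show ?case using cM by simp
  next
    case (Suc k)
    have "\<rho> * c y \<le> (\<Sum>u\<in>V. w y u * (M * z u k))"
      unfolding c_harmonic[OF Suc.prems] using Suc by (intro sum_mono mult_left_mono w_nonneg) auto
    also have "\<dots> = M * (\<rho> * z y (Suc k))"
    proof -
      have "\<rho> * z y (Suc k) = (\<Sum>u\<in>V. w y u * z u k)" using radius_pos by (simp add: z_Suc)
      then show ?thesis by (simp add: sum_distrib_left mult.left_commute)
    qed
    finally show ?case using radius_pos by (simp add: mult.left_commute)
  qed
  from this[OF x0] have "0 < M * z x0 k" using c_x0_pos by simp
  then show ?thesis using M by (simp add: zero_less_mult_iff)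
qed

end

subsection \<open>Borel sets of spaces of sequences over a finite alphabet\<close>

lemma sets_borel_of_topology: "sets (borel_of_topology X) = sigma_sets (topspace X) {S. openin X S}"
  by (auto simp: borel_of_topology_def intro!: sets_measure_of dest: openin_subset)

lemma space_borel_of_topology [simp]: "space (borel_of_topology X) = topspace X"
  by (simp add: borel_of_topology_def space_measure_of_conv)

lemma openin_sets_borel_of_topology: "openin X S \<Longrightarrow> S \<in> sets (borel_of_topology X)"
  by (auto simp: sets_borel_of_topology)

lemma continuous_map_borel_measurable:
  assumes "continuous_map X euclideanreal f"
  shows "f \<in> borel_measurable (borel_of_topology X)"
proof (rule borel_measurableI)
  fix S :: "real set" assume "open S"
  moreover have "f -` S \<inter> topspace X = {x \<in> topspace X. f x \<in> S}" by auto
  ultimately show "f -` S \<inter> space (borel_of_topology X) \<in> sets (borel_of_topology X)"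
    using assms by (auto simp: continuous_map_def intro: openin_sets_borel_of_topology)
qed

text \<open>A common form of the two path topologies: over \<open>V\<close> for infinite paths, and
  over \<open>V\<close> with the padding symbol for all paths.\<close>

definition seq_topology :: "'a set \<Rightarrow> (nat \<Rightarrow> 'a) set \<Rightarrow> (nat \<Rightarrow> 'a) topology" where
  "seq_topology A P = subtopology (product_topology (\<lambda>_. discrete_topology A) UNIV) P"

definition seq_cylinder :: "(nat \<Rightarrow> 'a) set \<Rightarrow> 'a list \<Rightarrow> (nat \<Rightarrow> 'a) set" where
  "seq_cylinder P l = {\<omega> \<in> P. \<forall>i<length l. \<omega> i = l ! i}"

locale seq_space =
  fixes A :: "'a set" and P :: "(nat \<Rightarrow> 'a) set"
  assumes finite_alphabet: "finite A" and seqs: "\<And>\<omega> i. \<omega> \<in> P \<Longrightarrow> \<omega> i \<in> A"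
begin

lemma topspace_seq_topology: "topspace (seq_topology A P) = P"
  using seqs by (auto simp: seq_topology_def PiE_def)

lemma openin_seq_cylinder: "openin (seq_topology A P) (seq_cylinder P l)"
proof -
  define X where "X i = (if i < length l then {l ! i} \<inter> A else A)" for i
  have "openin (product_topology (\<lambda>_. discrete_topology A) UNIV) (\<Pi>\<^sub>E i\<in>UNIV. X i)"
  proof (rule product_topology_basis)
    show "finite {i. X i \<noteq> topspace (discrete_topology A)}"
      by (rule finite_subset[of _ "{..<length l}"]) (auto simp: X_def)
  qed (auto simp: X_def)
  moreover have "seq_cylinder P l = (\<Pi>\<^sub>E i\<in>UNIV. X i) \<inter> P"
    using seqs by (auto simp: seq_cylinder_def X_def PiE_def Pi_def split: if_splits)
  ultimately show ?thesis
    unfolding seq_topology_def by (auto simp: openin_subtopology)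
qed

lemma openin_contains_cylinder:
  assumes "openin (seq_topology A P) S" "\<omega> \<in> S"
  obtains n where "\<And>\<omega>'. \<omega>' \<in> P \<Longrightarrow> (\<And>i. i < n \<Longrightarrow> \<omega>' i = \<omega> i) \<Longrightarrow> \<omega>' \<in> S"
proof -
  obtain T where T: "openin (product_topology (\<lambda>_. discrete_topology A) UNIV) T" "S = T \<inter> P"
    using assms(1) by (auto simp: seq_topology_def openin_subtopology)
  obtain X where X: "\<omega> \<in> (\<Pi>\<^sub>E i\<in>UNIV. X i)" "finite {i. X i \<noteq> A}" "(\<Pi>\<^sub>E i\<in>UNIV. X i) \<subseteq> T"
    using product_topology_open_contains_basis[OF T(1), of \<omega>] assms(2) T(2) by auto
  obtain n where n: "\<And>i. X i \<noteq> A \<Longrightarrow> i < n"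
    using finite_nat_set_iff_bounded[of "{i. X i \<noteq> A}"] X(2) by auto
  show ?thesis
  proof (rule that[of n])
    fix \<omega>' assume \<omega>': "\<omega>' \<in> P" "\<And>i. i < n \<Longrightarrow> \<omega>' i = \<omega> i"
    have "\<omega>' i \<in> X i" for i
      using n[of i] \<omega>'(2)[of i] X(1) seqs[OF \<omega>'(1), of i] by (cases "X i = A") (auto simp: PiE_def)
    then show "\<omega>' \<in> S" using X(3) T(2) \<omega>'(1) by auto
  qed
qed

lemma seq_cylinder_map: "\<omega> \<in> P \<Longrightarrow> \<omega> \<in> seq_cylinder P (map \<omega> [0..<n])"
  by (simp add: seq_cylinder_def)

text \<open>Words over a finite alphabet are countable in number, so every open set is a countable
  union of cylinders.\<close>

lemma sets_seq_topology:
  "sets (borel_of_topology (seq_topology A P)) = sigma_sets P (range (seq_cylinder P))"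
  unfolding sets_borel_of_topology topspace_seq_topology
proof (rule sigma_sets_eqI)
  fix S assume "S \<in> {S. openin (seq_topology A P) S}"
  then have S: "openin (seq_topology A P) S" by simp
  let ?L = "{l \<in> lists A. seq_cylinder P l \<subseteq> S}"
  have "S = (\<Union>l\<in>?L. seq_cylinder P l)"
  proof (intro equalityI subsetI)
    fix \<omega> assume \<omega>: "\<omega> \<in> S"
    have P: "\<omega> \<in> P" using openin_subset[OF S] \<omega> topspace_seq_topology by auto
    obtain n where n: "\<And>\<omega>'. \<omega>' \<in> P \<Longrightarrow> (\<And>i. i < n \<Longrightarrow> \<omega>' i = \<omega> i) \<Longrightarrow> \<omega>' \<in> S"
      using openin_contains_cylinder[OF S \<omega>] by blast
    have "map \<omega> [0..<n] \<in> ?L"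
      using n seqs[OF P] by (auto simp: seq_cylinder_def in_lists_conv_set)
    then show "\<omega> \<in> (\<Union>l\<in>?L. seq_cylinder P l)" using seq_cylinder_map[OF P] by blast
  qed auto
  moreover have "countable ?L"
    using countable_lists[OF countable_finite[OF finite_alphabet]] by (rule countable_subset[rotated]) auto
  then have "(\<Union>l\<in>?L. seq_cylinder P l) \<in> sigma_sets P (range (seq_cylinder P))"
    by (intro sigma_sets_UNION) auto
  ultimately show "S \<in> sigma_sets P (range (seq_cylinder P))" by simp
next
  fix S assume "S \<in> range (seq_cylinder P)"
  then show "S \<in> sigma_sets P {S. openin (seq_topology A P) S}"
    using openin_seq_cylinder by auto
qed

lemma seq_cylinder_sets: "seq_cylinder P l \<in> sets (borel_of_topology (seq_topology A P))"
  by (rule openin_sets_borel_of_topology[OF openin_seq_cylinder])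

text \<open>Cylinders are nested or disjoint according to whether the words agree on their common
  length. The empty set is added since it need not be a cylinder.\<close>

lemma seq_cylinder_Int: "seq_cylinder P l \<inter> seq_cylinder P l' \<in> insert {} (range (seq_cylinder P))"
proof -
  have *: "seq_cylinder P l \<inter> seq_cylinder P l' \<in> insert {} (range (seq_cylinder P))"
    if "length l \<le> length l'" for l l' :: "'a list"
  proof (cases "\<forall>i<length l. l ! i = l' ! i")
    case True
    then have "seq_cylinder P l \<inter> seq_cylinder P l' = seq_cylinder P l'"
      using that by (auto simp: seq_cylinder_def)
    then show ?thesis by simp
  next
    case False
    then have "seq_cylinder P l \<inter> seq_cylinder P l' = {}"
      using that by (fastforce simp: seq_cylinder_def)
    then show ?thesis by simp
  qed
  show ?thesis using *[of l l'] *[of l' l] by (cases "length l \<le> length l'") (auto simp: Int_commute)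
qed

lemma measure_eqI_cylinders:
  assumes "borel_prob_on (seq_topology A P) M" "borel_prob_on (seq_topology A P) N"
    and eq: "\<And>l. measure M (seq_cylinder P l) = measure N (seq_cylinder P l)"
  shows "M = N"
proof -
  interpret M: prob_space M using assms(1) by (simp add: borel_prob_on_def)
  interpret N: prob_space N using assms(2) by (simp add: borel_prob_on_def)
  have s: "sets M = sigma_sets P (insert {} (range (seq_cylinder P)))"
    "sets N = sigma_sets P (insert {} (range (seq_cylinder P)))"
    using assms by (auto simp: borel_prob_on_def sets_seq_topology intro!: sigma_sets_eqI intro: sigma_sets.Empty)
  show ?thesis
  proof (rule measure_eqI_generator_eq[where A = "\<lambda>_. P", OF _ _ _ s])
    show "Int_stable (insert {} (range (seq_cylinder P)))"
      using seq_cylinder_Int by (auto simp: Int_stable_def)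
    show "insert {} (range (seq_cylinder P)) \<subseteq> Pow P" by (auto simp: seq_cylinder_def)
    show "emeasure M X = emeasure N X" if "X \<in> insert {} (range (seq_cylinder P))" for X
      using that eq by (auto simp: M.emeasure_eq_measure N.emeasure_eq_measure)
    have "P = seq_cylinder P []" by (simp add: seq_cylinder_def)
    then show "range (\<lambda>_. P) \<subseteq> insert {} (range (seq_cylinder P))" by auto
  qed (auto simp: M.emeasure_eq_measure)
qed

end

subsection \<open>Existence and uniqueness of path measures\<close>

lemma infinite_paths_topology_eq:
  "infinite_paths_topology V w x = seq_topology V (infinite_paths_from V w x)"
  by (simp add: infinite_paths_topology_def seq_topology_def)

lemma cylinder_eq_seq_cylinder: "cylinder V w x u = seq_cylinder (infinite_paths_from V w x) u"
  by (simp add: cylinder_def seq_cylinder_def)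

lemma seq_space_infinite_paths: "finite V \<Longrightarrow> seq_space V (infinite_paths_from V w x)"
  by unfold_locales (auto simp: infinite_paths_from_def)

lemma prefix_finite_path:
  assumes "\<omega> \<in> infinite_paths_from V w x" "0 < n"
  shows "map \<omega> [0..<n] \<in> finite_paths_from V w x"
  using assms
  by (auto simp: infinite_paths_from_def finite_paths_from_def finite_path_def successively_conv_nth hd_map)

lemma seq_cylinder_not_path:
  assumes "u \<noteq> []" "u \<notin> finite_paths_from V w x"
  shows "seq_cylinder (infinite_paths_from V w x) u = {}"
proof (rule ccontr)
  assume "seq_cylinder (infinite_paths_from V w x) u \<noteq> {}"
  then obtain \<omega> where \<omega>: "\<omega> \<in> infinite_paths_from V w x" "\<And>i. i < length u \<Longrightarrow> \<omega> i = u ! i"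
    by (auto simp: seq_cylinder_def)
  have "map \<omega> [0..<length u] = u" by (rule nth_equalityI) (auto simp: \<omega>(2))
  then show False using prefix_finite_path[OF \<omega>(1), of "length u"] assms by simp
qed

text \<open>Cylinders of finite paths generate the Borel sets; the other words are
  \<open>[]\<close>, settled by the total mass, and words that are not paths, whose cylinders are
  empty.\<close>

lemma path_measure_unique:
  assumes "finite V"
    and M: "borel_prob_on (infinite_paths_topology V w x) M"
    and N: "borel_prob_on (infinite_paths_topology V w x) N"
    and eq: "\<And>u. u \<in> finite_paths_from V w x \<Longrightarrow> measure M (cylinder V w x u) = measure N (cylinder V w x u)"
  shows "M = N"
proof -
  interpret seq_space V "infinite_paths_from V w x" by (rule seq_space_infinite_paths[OF assms(1)])
  show ?thesis
  proof (rule measure_eqI_cylinders)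
    fix l
    consider "l = []" | "l \<noteq> []" "l \<notin> finite_paths_from V w x" | "l \<in> finite_paths_from V w x" by blast
    then show "measure M (seq_cylinder (infinite_paths_from V w x) l)
        = measure N (seq_cylinder (infinite_paths_from V w x) l)"
    proof cases
      case 1
      have "space M = infinite_paths_from V w x" "space N = infinite_paths_from V w x"
        using M N sets_eq_imp_space_eq[of M] sets_eq_imp_space_eq[of N]
        by (auto simp: borel_prob_on_def infinite_paths_topology_eq topspace_seq_topology)
      moreover have "seq_cylinder (infinite_paths_from V w x) l = infinite_paths_from V w x"
        using 1 by (simp add: seq_cylinder_def)
      ultimately show ?thesis
        using M N prob_space.prob_space[of M] prob_space.prob_space[of N] by (simp add: borel_prob_on_def)
    next
      case 2
      then show ?thesis by (simp add: seq_cylinder_not_path)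
    next
      case 3
      then show ?thesis using eq by (simp add: cylinder_eq_seq_cylinder)
    qed
  qed (use M N in \<open>simp_all add: infinite_paths_topology_eq\<close>)
qed

section \<open>A Markov chain with prescribed kernel\<close>

primrec chain :: "(nat \<times> 'v \<Rightarrow> 'v) \<Rightarrow> 'v \<Rightarrow> nat \<Rightarrow> 'v" where
  "chain X x 0 = x"
| "chain X x (Suc n) = X (n, chain X x n)"

locale markov_kernel =
  fixes U :: "'v set" and w q :: "'v \<Rightarrow> 'v \<Rightarrow> real"
  assumes finite_states: "finite U"
    and q_nonneg: "\<And>x y. x \<in> U \<Longrightarrow> y \<in> U \<Longrightarrow> 0 \<le> q x y"
    and q_edges: "\<And>x y. x \<in> U \<Longrightarrow> y \<in> U \<Longrightarrow> 0 < q x y \<longleftrightarrow> 0 < w x y"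
    and q_sum: "\<And>x. x \<in> U \<Longrightarrow> (\<Sum>y\<in>U. q x y) = 1"
begin

text \<open>Restricting to edges makes every sample, not just almost every one, an infinite path.
  Outside \<open>U\<close> a self-loop is a dummy value: the product is indexed by all vertices of
  the type and needs a probability measure at each.\<close>

definition succs :: "'v \<Rightarrow> 'v set" where
  "succs x = (if x \<in> U then {y \<in> U. 0 < w x y} else {x})"

definition step_measure :: "'v \<Rightarrow> 'v measure" where
  "step_measure x = point_measure (succs x) (\<lambda>y. ennreal (if x \<in> U then q x y else 1))"

text \<open>
  Independent choices of a successor for every time and every vertex; the chain started at a
  vertex follows the choices that it meets.
\<close>

definition choices :: "(nat \<times> 'v \<Rightarrow> 'v) measure" where
  "choices = PiM UNIV (\<lambda>(n, x). step_measure x)"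

lemma finite_succs: "finite (succs x)"
  using finite_states by (simp add: succs_def)

lemma space_step_measure [simp]: "space (step_measure x) = succs x"
  by (simp add: step_measure_def space_point_measure)

lemma sets_step_measure [simp]: "sets (step_measure x) = Pow (succs x)"
  by (simp add: step_measure_def sets_point_measure)

lemma prob_space_step_measure: "prob_space (step_measure x)"
proof
  show "emeasure (step_measure x) (space (step_measure x)) = 1"
  proof (cases "x \<in> U")
    case True
    have "(\<Sum>y\<in>succs x. q x y) = (\<Sum>y\<in>U. q x y)"
      using finite_states q_nonneg[OF True] q_edges[OF True] True
      by (intro sum.mono_neutral_left) (auto simp: succs_def less_le)
    then have "(\<Sum>y\<in>succs x. ennreal (q x y)) = 1"
      using True q_nonneg[OF True] q_sum[OF True] by (subst sum_ennreal) (auto simp: succs_def)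
    then show ?thesis
      unfolding space_step_measure unfolding step_measure_def using True finite_succs
      by (subst emeasure_point_measure_finite) auto
  next
    case False
    then show ?thesis
      unfolding space_step_measure unfolding step_measure_def using finite_succs
      by (subst emeasure_point_measure_finite) (auto simp: succs_def)
  qed
qed

sublocale choices: product_prob_space "\<lambda>(n, x). step_measure x" "UNIV :: (nat \<times> 'v) set"
  by (rule product_prob_spaceI) (auto split: prod.split intro: prob_space_step_measure)

lemma space_choices: "X \<in> space choices \<Longrightarrow> X (n, x) \<in> succs x"
  by (auto simp: choices_def space_PiM PiE_def Pi_def)

lemma chain_infinite_path:
  assumes "x \<in> U" "X \<in> space choices"
  shows "chain X x \<in> infinite_paths_from U w x"
proof -
  have "chain X x i \<in> U" for i
  proof (induction i)
    case (Suc i)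
    then show ?case using space_choices[OF assms(2), of i "chain X x i"] by (auto simp: succs_def)
  qed (use assms(1) in simp)
  moreover have "0 < w (chain X x i) (chain X x (Suc i))" for i
    using space_choices[OF assms(2), of i "chain X x i"] calculation[of i] by (auto simp: succs_def)
  ultimately show ?thesis by (auto simp: infinite_paths_from_def)
qed

lemma finite_paths_from_nth:
  assumes u: "u \<in> finite_paths_from U w x"
  shows "u ! 0 = x" "length u = Suc (path_len u)" "\<And>i. i \<le> path_len u \<Longrightarrow> u ! i \<in> U"
    "\<And>i. i < path_len u \<Longrightarrow> u ! Suc i \<in> succs (u ! i)"
proof -
  have ne: "u \<noteq> []" "set u \<subseteq> U" "hd u = x" and s: "successively (\<lambda>x y. 0 < w x y) u"
    using u by (auto simp: finite_paths_from_def finite_path_def)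
  show "u ! 0 = x" using ne by (simp add: hd_conv_nth)
  show len: "length u = Suc (path_len u)" using ne by (simp add: path_len_def)
  show U: "u ! i \<in> U" if "i \<le> path_len u" for i
    using that ne(2) len nth_mem[of i u] by (auto simp: less_Suc_eq_le)
  show "u ! Suc i \<in> succs (u ! i)" if "i < path_len u" for i
    using that U[of i] U[of "Suc i"] s len by (auto simp: succs_def successively_conv_nth)
qed

text \<open>Following \<open>u\<close> means that finitely many choices take prescribed values. The
  time component makes the coordinates \<open>(i, u ! i)\<close> distinct even if \<open>u\<close>
  revisits a vertex, so independence gives the product.\<close>

lemma chain_cylinder:
  assumes u: "u \<in> finite_paths_from U w x" and x: "x \<in> U"
  defines "S \<equiv> {X \<in> space choices. chain X x \<in> seq_cylinder (infinite_paths_from U w x) u}"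
  shows "S \<in> sets choices" "measure choices S = (\<Prod>i<path_len u. q (u ! i) (u ! Suc i))"
proof -
  note nth = finite_paths_from_nth[OF u]
  define J where "J = (\<lambda>i. (i, u ! i)) ` {..<path_len u}"
  have inj: "inj_on (\<lambda>i. (i, u ! i)) {..<path_len u}" by (auto simp: inj_on_def)
  have "S = {X \<in> space choices. \<forall>i<path_len u. X (i, u ! i) = u ! Suc i}"
  proof (intro equalityI subsetI)
    fix X assume "X \<in> S"
    then have X: "X \<in> space choices" "\<And>i. i \<le> path_len u \<Longrightarrow> chain X x i = u ! i"
      using nth(2) by (auto simp: S_def seq_cylinder_def)
    have "X (i, u ! i) = u ! Suc i" if "i < path_len u" for i
      using X(2)[of i] X(2)[of "Suc i"] that by simp
    then show "X \<in> {X \<in> space choices. \<forall>i<path_len u. X (i, u ! i) = u ! Suc i}" using X(1) by simp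
  next
    fix X assume X: "X \<in> {X \<in> space choices. \<forall>i<path_len u. X (i, u ! i) = u ! Suc i}"
    have "chain X x i = u ! i" if "i \<le> path_len u" for i
      using that by (induction i) (use X nth(1) in auto)
    then show "X \<in> S" using X chain_infinite_path[OF x] nth(2) by (auto simp: S_def seq_cylinder_def)
  qed
  also have "\<dots> = prod_emb UNIV (\<lambda>(n, x). step_measure x) J (\<Pi>\<^sub>E (i, a)\<in>J. {u ! Suc i})"
  proof -
    have *: "restrict X J \<in> (\<Pi>\<^sub>E (i, a)\<in>J. {u ! Suc i}) \<longleftrightarrow> (\<forall>i<path_len u. X (i, u ! i) = u ! Suc i)" for X
      unfolding PiE_iff J_def by auto
    show ?thesis
      by (rule Set.set_eqI) (auto simp only: mem_Collect_eq prod_emb_def Int_iff vimage_eq * choices_def space_PiM)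
  qed
  finally have S: "S = prod_emb UNIV (\<lambda>(n, x). step_measure x) J (\<Pi>\<^sub>E (i, a)\<in>J. {u ! Suc i})" .
  have sets: "(case j of (i, a) \<Rightarrow> {u ! Suc i}) \<in> sets (case j of (n, x) \<Rightarrow> step_measure x)" if "j \<in> J" for j
  proof -
    obtain i where "i < path_len u" "j = (i, u ! i)" using \<open>j \<in> J\<close> unfolding J_def by blast
    then show ?thesis using nth(4)[of i] by simp
  qed
  show "S \<in> sets choices"
    unfolding S choices_def by (intro sets_PiM_I sets) (auto simp: J_def nth(4))
  have "emeasure choices S = (\<Prod>j\<in>J. emeasure (case j of (n, x) \<Rightarrow> step_measure x) (case j of (i, a) \<Rightarrow> {u ! Suc i}))"
    unfolding S choices_def by (intro choices.emeasure_PiM_emb sets) (simp_all add: J_def)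
  also have "\<dots> = (\<Prod>i<path_len u. emeasure (step_measure (u ! i)) {u ! Suc i})"
    unfolding J_def by (subst prod.reindex[OF inj]) simp
  also have "\<dots> = (\<Prod>i<path_len u. ennreal (q (u ! i) (u ! Suc i)))"
  proof (rule prod.cong)
    fix i assume i: "i \<in> {..<path_len u}"
    then show "emeasure (step_measure (u ! i)) {u ! Suc i} = ennreal (q (u ! i) (u ! Suc i))"
      unfolding step_measure_def using nth(4)[of i] nth(3)[of i] finite_succs
      by (subst emeasure_point_measure_finite) auto
  qed simp
  also have "\<dots> = ennreal (\<Prod>i<path_len u. q (u ! i) (u ! Suc i))"
    using nth(3) q_nonneg by (intro prod_ennreal) auto
  finally show "measure choices S = (\<Prod>i<path_len u. q (u ! i) (u ! Suc i))"
    using nth(3) q_nonneg by (auto simp: measure_def intro!: enn2real_ennreal prod_nonneg)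
qed

definition chain_measure :: "'v \<Rightarrow> (nat \<Rightarrow> 'v) measure" where
  "chain_measure x = distr choices (borel_of_topology (infinite_paths_topology U w x)) (\<lambda>X. chain X x)"

lemma chain_measurable:
  assumes x: "x \<in> U"
  shows "(\<lambda>X. chain X x) \<in> measurable choices (borel_of_topology (infinite_paths_topology U w x))"
proof -
  interpret seq_space U "infinite_paths_from U w x" by (rule seq_space_infinite_paths[OF finite_states])
  show ?thesis
    unfolding infinite_paths_topology_eq
  proof (rule measurable_sigma_sets[OF sets_seq_topology])
    show "range (seq_cylinder (infinite_paths_from U w x)) \<subseteq> Pow (infinite_paths_from U w x)"
      by (auto simp: seq_cylinder_def)
    show "(\<lambda>X. chain X x) \<in> space choices \<rightarrow> infinite_paths_from U w x"
      using chain_infinite_path[OF x] by auto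
    fix S assume "S \<in> range (seq_cylinder (infinite_paths_from U w x))"
    then obtain l where S: "S = seq_cylinder (infinite_paths_from U w x) l" by auto
    have eq: "(\<lambda>X. chain X x) -` S \<inter> space choices = {X \<in> space choices. chain X x \<in> S}" by auto
    consider "l = []" | "l \<noteq> []" "l \<notin> finite_paths_from U w x" | "l \<in> finite_paths_from U w x" by blast
    then show "(\<lambda>X. chain X x) -` S \<inter> space choices \<in> sets choices"
    proof cases
      case 1
      then have "{X \<in> space choices. chain X x \<in> S} = space choices"
        using chain_infinite_path[OF x] by (auto simp: S seq_cylinder_def)
      then show ?thesis unfolding eq by simp
    next
      case 2
      then show ?thesis unfolding eq unfolding S by (simp add: seq_cylinder_not_path)
    next
      case 3
      then show ?thesis unfolding eq unfolding S by (intro chain_cylinder(1) x)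
    qed
  qed
qed

lemma borel_prob_on_chain_measure:
  assumes x: "x \<in> U"
  shows "borel_prob_on (infinite_paths_topology U w x) (chain_measure x)"
proof -
  have "prob_space choices" unfolding choices_def by (rule choices.prob_space_axioms)
  then show ?thesis
    unfolding borel_prob_on_def chain_measure_def
    by (auto intro!: prob_space.prob_space_distr chain_measurable x)
qed

lemma measure_chain_measure:
  assumes x: "x \<in> U" and u: "u \<in> finite_paths_from U w x"
  shows "measure (chain_measure x) (cylinder U w x u) = (\<Prod>i<path_len u. q (u ! i) (u ! Suc i))"
proof -
  interpret seq_space U "infinite_paths_from U w x" by (rule seq_space_infinite_paths[OF finite_states])
  have eq: "(\<lambda>X. chain X x) -` S \<inter> space choices = {X \<in> space choices. chain X x \<in> S}" for S by auto
  show ?thesis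
    unfolding chain_measure_def cylinder_eq_seq_cylinder
    using chain_cylinder(2)[OF u x] seq_cylinder_sets
    by (subst measure_distr[OF chain_measurable[OF x]]) (auto simp: eq infinite_paths_topology_eq)
qed

end

subsection \<open>Weak convergence from convergence on cylinders\<close>

context seq_space
begin

lemma borel_prob_on_measurable:
  assumes "borel_prob_on (seq_topology A P) M"
  shows "space M = P" "seq_cylinder P l \<in> sets M"
    "continuous_map (seq_topology A P) euclideanreal f \<Longrightarrow> f \<in> borel_measurable M"
proof -
  have s: "sets M = sets (borel_of_topology (seq_topology A P))"
    using assms by (simp add: borel_prob_on_def)
  show "space M = P" using sets_eq_imp_space_eq[OF s] by (simp add: topspace_seq_topology)
  show "seq_cylinder P l \<in> sets M" using s seq_cylinder_sets by simp
  show "f \<in> borel_measurable M" if "continuous_map (seq_topology A P) euclideanreal f"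
    using continuous_map_borel_measurable[OF that] measurable_cong_sets[OF s refl] by blast
qed

text \<open>One half of the convergence; the other follows by applying it to \<open>- f\<close>.
  Minorants of \<open>f\<close> suffice for a one-sided bound, so pointwise approximation combined
  with dominated convergence under the single measure \<open>N\<close> is enough.\<close>

lemma eventually_integral_gt:
  assumes M: "\<And>k. borel_prob_on (seq_topology A P) (M k)" and N: "borel_prob_on (seq_topology A P) N"
    and cyl: "\<And>l. (\<lambda>k. measure (M k) (seq_cylinder P l)) \<longlonglongrightarrow> measure N (seq_cylinder P l)"
    and f: "continuous_map (seq_topology A P) euclideanreal f" and bdd: "\<And>\<omega>. \<omega> \<in> P \<Longrightarrow> \<bar>f \<omega>\<bar> \<le> K"
    and \<epsilon>: "0 < \<epsilon>"
  shows "\<forall>\<^sub>F k in sequentially. integral\<^sup>L N f - \<epsilon> < integral\<^sup>L (M k) f"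
proof -
  define L where "L n = {l. set l \<subseteq> A \<and> length l = n}" for n
  have finL: "finite (L n)" for n
    unfolding L_def using finite_lists_length_eq[OF finite_alphabet] by simp
  define G where "G l = Inf (f ` seq_cylinder P l)" for l
  \<comment> \<open>a locally constant function of the first \<open>n\<close> letters that increases to \<open>f\<close> with \<open>n\<close>\<close>
  define g where "g n \<omega> = (\<Sum>l\<in>L n. G l * indicator (seq_cylinder P l) \<omega>)" for n \<omega>
  have cylP: "seq_cylinder P l \<subseteq> P" for l by (auto simp: seq_cylinder_def)
  have bb: "bdd_below (f ` seq_cylinder P l)" for l
    using bdd cylP by (intro bdd_belowI[of _ "- K"]) (auto dest!: subsetD abs_le_D2 simp: minus_le_iff)
  have g_eq: "g n \<omega> = G (map \<omega> [0..<n])" if \<omega>: "\<omega> \<in> P" for n \<omega>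
  proof -
    have mem: "map \<omega> [0..<n] \<in> L n" using seqs[OF \<omega>] by (auto simp: L_def)
    have "G l * indicator (seq_cylinder P l) \<omega> = 0" if "l \<in> L n - {map \<omega> [0..<n]}" for l
    proof -
      have "\<omega> \<notin> seq_cylinder P l"
      proof
        assume "\<omega> \<in> seq_cylinder P l"
        then have "l = map \<omega> [0..<n]" using that by (intro nth_equalityI) (auto simp: L_def seq_cylinder_def)
        then show False using that by simp
      qed
      then show ?thesis by simp
    qed
    then have "g n \<omega> = (\<Sum>l\<in>{map \<omega> [0..<n]}. G l * indicator (seq_cylinder P l) \<omega>)"
      unfolding g_def using finL mem by (intro sum.mono_neutral_right) auto
    then show ?thesis using seq_cylinder_map[OF \<omega>] by simp
  qed
  have g_le: "g n \<omega> \<le> f \<omega>" and g_ge: "- K \<le> g n \<omega>" if \<omega>: "\<omega> \<in> P" for n \<omega>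
  proof -
    show "g n \<omega> \<le> f \<omega>"
      unfolding g_eq[OF \<omega>] G_def using seq_cylinder_map[OF \<omega>] bb by (intro cINF_lower)
    show "- K \<le> g n \<omega>"
      unfolding g_eq[OF \<omega>] G_def
    proof (rule cINF_greatest)
      fix \<omega>' assume "\<omega>' \<in> seq_cylinder P (map \<omega> [0..<n])"
      then have "\<omega>' \<in> P" using cylP by blast
      then show "- K \<le> f \<omega>'" using bdd[of \<omega>'] by (simp add: abs_le_iff)
    qed (use seq_cylinder_map[OF \<omega>] in blast)
  qed
  have g_lim: "(\<lambda>n. g n \<omega>) \<longlonglongrightarrow> f \<omega>" if \<omega>: "\<omega> \<in> P" for \<omega>
  proof (rule LIMSEQ_I)
    fix e :: real assume e: "0 < e"
    have "openin (seq_topology A P) {\<omega>' \<in> topspace (seq_topology A P). f \<omega>' \<in> ball (f \<omega>) (e / 2)}"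
      using f by (rule openin_continuous_map_preimage) simp
    moreover have "\<omega> \<in> {\<omega>' \<in> topspace (seq_topology A P). f \<omega>' \<in> ball (f \<omega>) (e / 2)}"
      using \<omega> e by (simp add: topspace_seq_topology)
    ultimately obtain n0 where n0: "\<And>\<omega>'. \<omega>' \<in> P \<Longrightarrow> (\<And>i. i < n0 \<Longrightarrow> \<omega>' i = \<omega> i) \<Longrightarrow>
        \<omega>' \<in> {\<omega>' \<in> topspace (seq_topology A P). f \<omega>' \<in> ball (f \<omega>) (e / 2)}"
      using openin_contains_cylinder by metis
    show "\<exists>n0. \<forall>n\<ge>n0. norm (g n \<omega> - f \<omega>) < e"
    proof (intro exI[of _ n0] allI impI)
      fix n assume n: "n0 \<le> n"
      have "f \<omega> - e / 2 \<le> g n \<omega>"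
        unfolding g_eq[OF \<omega>] G_def
      proof (rule cINF_greatest)
        fix \<omega>' assume "\<omega>' \<in> seq_cylinder P (map \<omega> [0..<n])"
        then have "f \<omega>' \<in> ball (f \<omega>) (e / 2)" using n0[of \<omega>'] n by (auto simp: seq_cylinder_def)
        then have "\<bar>f \<omega> - f \<omega>'\<bar> < e / 2" by (simp add: dist_real_def)
        then show "f \<omega> - e / 2 \<le> f \<omega>'" by linarith
      qed (use seq_cylinder_map[OF \<omega>] in blast)
      then show "norm (g n \<omega> - f \<omega>) < e" using g_le[OF \<omega>, of n] e by simp
    qed
  qed
  have int_g: "integrable Q (g n)" "integral\<^sup>L Q (g n) = (\<Sum>l\<in>L n. G l * measure Q (seq_cylinder P l))"
    if Q: "borel_prob_on (seq_topology A P) Q" for Q n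
  proof -
    interpret prob_space Q using Q by (simp add: borel_prob_on_def)
    have i: "integrable Q (\<lambda>\<omega>. G l * indicator (seq_cylinder P l) \<omega>)" for l
      using borel_prob_on_measurable(2)[OF Q]
      by (intro integrable_mult_right integrable_real_indicator) (auto simp: emeasure_eq_measure)
    then show "integrable Q (g n)" unfolding g_def by (intro Bochner_Integration.integrable_sum)
    have "integral\<^sup>L Q (g n) = (\<Sum>l\<in>L n. integral\<^sup>L Q (\<lambda>\<omega>. G l * indicator (seq_cylinder P l) \<omega>))"
      unfolding g_def using i by (intro Bochner_Integration.integral_sum)
    then show "integral\<^sup>L Q (g n) = (\<Sum>l\<in>L n. G l * measure Q (seq_cylinder P l))"
      using borel_prob_on_measurable(1,2)[OF Q] cylP by (simp add: Int_absorb2)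
  qed
  have int_f: "integrable Q f" if Q: "borel_prob_on (seq_topology A P) Q" for Q
  proof -
    interpret prob_space Q using Q by (simp add: borel_prob_on_def)
    show ?thesis
      using borel_prob_on_measurable[OF Q] f bdd by (intro integrable_const_bound[of _ K]) auto
  qed
  have "(\<lambda>n. integral\<^sup>L N (g n)) \<longlonglongrightarrow> integral\<^sup>L N f"
  proof (rule integral_dominated_convergence[where w = "\<lambda>_. K"])
    interpret prob_space N using N by (simp add: borel_prob_on_def)
    show "integrable N (\<lambda>_. K)" by simp
    show "f \<in> borel_measurable N" by (rule borel_prob_on_measurable(3)[OF N f])
    show "g n \<in> borel_measurable N" for n using int_g(1)[OF N, of n] by simp
    show "AE \<omega> in N. (\<lambda>n. g n \<omega>) \<longlonglongrightarrow> f \<omega>"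
      using g_lim borel_prob_on_measurable(1)[OF N] by (intro AE_I2) simp
    show "AE \<omega> in N. norm (g n \<omega>) \<le> K" for n
    proof (rule AE_I2)
      fix \<omega> assume "\<omega> \<in> space N"
      then have \<omega>: "\<omega> \<in> P" using borel_prob_on_measurable(1)[OF N] by simp
      show "norm (g n \<omega>) \<le> K"
        using g_le[OF \<omega>, of n] g_ge[OF \<omega>, of n] bdd[OF \<omega>] by (simp add: abs_le_iff)
    qed
  qed
  \<comment> \<open>The depth \<open>n\<close> is fixed through \<open>N\<close> alone, before
    \<open>k\<close> varies. For fixed \<open>n\<close> the integral of \<open>g n\<close> is a
    finite combination of cylinder masses, which converge.\<close>
  then obtain n where n: "\<bar>integral\<^sup>L N (g n) - integral\<^sup>L N f\<bar> < \<epsilon> / 2"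
    using LIMSEQ_D[of _ _ "\<epsilon> / 2"] \<epsilon> by (metis half_gt_zero order_refl real_norm_def)
  have "(\<lambda>k. \<Sum>l\<in>L n. G l * measure (M k) (seq_cylinder P l)) \<longlonglongrightarrow> (\<Sum>l\<in>L n. G l * measure N (seq_cylinder P l))"
    by (intro tendsto_sum tendsto_mult tendsto_const cyl)
  then have "(\<lambda>k. integral\<^sup>L (M k) (g n)) \<longlonglongrightarrow> integral\<^sup>L N (g n)"
    by (simp add: int_g(2) M N)
  then have "\<forall>\<^sub>F k in sequentially. integral\<^sup>L N (g n) - \<epsilon> / 2 < integral\<^sup>L (M k) (g n)"
    by (rule order_tendstoD(1)) (use \<epsilon> in simp)
  then show ?thesis
  proof eventually_elim
    case (elim k)
    have "integral\<^sup>L (M k) (g n) \<le> integral\<^sup>L (M k) f"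
      using g_le borel_prob_on_measurable(1)[OF M] by (intro integral_mono int_g int_f M) auto
    then show ?case using elim n by linarith
  qed
qed

lemma weakly_converges_cylinders:
  assumes M: "\<And>k. borel_prob_on (seq_topology A P) (M k)" and N: "borel_prob_on (seq_topology A P) N"
    and cyl: "\<And>l. (\<lambda>k. measure (M k) (seq_cylinder P l)) \<longlonglongrightarrow> measure N (seq_cylinder P l)"
  shows "weakly_converges (seq_topology A P) M N"
  unfolding weakly_converges_def
proof (intro conjI allI impI M N)
  fix f :: "(nat \<Rightarrow> 'a) \<Rightarrow> real"
  assume "continuous_map (seq_topology A P) euclideanreal f \<and> bounded (f ` topspace (seq_topology A P))"
  then obtain K where f: "continuous_map (seq_topology A P) euclideanreal f"
    and K: "\<And>\<omega>. \<omega> \<in> P \<Longrightarrow> \<bar>f \<omega>\<bar> \<le> K"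
    by (auto simp: bounded_iff topspace_seq_topology)
  show "(\<lambda>k. integral\<^sup>L (M k) f) \<longlonglongrightarrow> integral\<^sup>L N f"
  proof (rule tendstoI)
    fix e :: real assume e: "0 < e"
    have "\<forall>\<^sub>F k in sequentially. integral\<^sup>L N (\<lambda>\<omega>. - f \<omega>) - e < integral\<^sup>L (M k) (\<lambda>\<omega>. - f \<omega>)"
      using K by (intro eventually_integral_gt[OF M N cyl, of _ K] e) (auto intro: continuous_map_minus f)
    moreover have "\<forall>\<^sub>F k in sequentially. integral\<^sup>L N f - e < integral\<^sup>L (M k) f"
      using K by (intro eventually_integral_gt[OF M N cyl f, of K] e)
    ultimately show "\<forall>\<^sub>F k in sequentially. dist (integral\<^sup>L (M k) f) (integral\<^sup>L N f) < e"
      by eventually_elim (simp add: dist_real_def; linarith)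
  qed
qed

end

subsection \<open>Sums over finite paths\<close>

lemma path_weight_Cons: "u \<noteq> [] \<Longrightarrow> path_weight w (x # u) = w x (hd u) * path_weight w u"
  unfolding path_weight_def
  by (cases u) (simp_all add: path_len_def prod.lessThan_Suc_shift del: prod.lessThan_Suc)

lemma path_len_Cons: "u \<noteq> [] \<Longrightarrow> path_len (x # u) = Suc (path_len u)"
  by (cases u) (simp_all add: path_len_def)

lemma path_weight_pos: "finite_path V w u \<Longrightarrow> 0 < path_weight w u"
proof (induction u)
  case (Cons x u)
  show ?case
  proof (cases "u = []")
    case True
    then show ?thesis by (simp add: path_weight_def path_len_def)
  next
    case False
    then show ?thesis using Cons by (auto simp: finite_path_Cons path_weight_Cons)
  qed
qed (simp add: finite_path_def)

lemma finite_finite_paths_len: "finite V \<Longrightarrow> finite (finite_paths_len V w x k)"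
  by (rule finite_subset[OF _ finite_lists_length_eq[of V "Suc k"]])
    (auto simp: finite_paths_len_def finite_paths_from_def finite_path_def path_len_def
      Suc_diff_Suc[symmetric])

lemma finite_paths_len_0: "x \<in> V \<Longrightarrow> finite_paths_len V w x 0 = {[x]}"
  by (auto simp: finite_paths_len_def finite_paths_from_def finite_path_def path_len_def
      length_Suc_conv le_Suc_eq hd_conv_nth)

lemma finite_paths_len_Suc:
  assumes "x \<in> V"
  shows "finite_paths_len V w x (Suc k) = (\<Union>y\<in>{y \<in> V. 0 < w x y}. (#) x ` finite_paths_len V w y k)"
proof (intro equalityI subsetI)
  fix p assume p: "p \<in> finite_paths_len V w x (Suc k)"
  then have "length p = Suc (Suc k)" "hd p = x"
    by (auto simp: finite_paths_len_def finite_paths_from_def path_len_def)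
  then obtain u where u: "p = x # u" "u \<noteq> []"
    by (auto simp: length_Suc_conv)
  then have "finite_path V w u" "0 < w x (hd u)" "path_len u = k"
    using p by (auto simp: finite_paths_len_def finite_paths_from_def finite_path_Cons path_len_Cons)
  moreover from this have "hd u \<in> V" using finite_path_edges by blast
  ultimately show "p \<in> (\<Union>y\<in>{y \<in> V. 0 < w x y}. (#) x ` finite_paths_len V w y k)"
    using u by (auto simp: finite_paths_len_def finite_paths_from_def)
next
  fix p assume "p \<in> (\<Union>y\<in>{y \<in> V. 0 < w x y}. (#) x ` finite_paths_len V w y k)"
  then obtain u where u: "p = x # u" "finite_path V w u" "0 < w x (hd u)" "path_len u = k"
    by (auto simp: finite_paths_len_def finite_paths_from_def)
  moreover have "u \<noteq> []" using u by (auto simp: finite_path_def)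
  ultimately show "p \<in> finite_paths_len V w x (Suc k)"
    using assms by (auto simp: finite_paths_len_def finite_paths_from_def finite_path_Cons path_len_Cons)
qed

lemma sum_Cons_path_weight:
  assumes "\<And>p. p \<in> S \<Longrightarrow> p \<noteq> [] \<and> hd p = y"
  shows "(\<Sum>p\<in>(#) x ` S. path_weight w p) = w x y * (\<Sum>p\<in>S. path_weight w p)"
proof -
  have "(\<Sum>p\<in>(#) x ` S. path_weight w p) = (\<Sum>p\<in>S. path_weight w (x # p))"
    by (subst sum.reindex) auto
  also have "\<dots> = (\<Sum>p\<in>S. w x y * path_weight w p)"
    using assms by (intro sum.cong) (auto simp: path_weight_Cons)
  finally show ?thesis by (simp add: sum_distrib_left)
qed

lemma finite_paths_len_hd: "p \<in> finite_paths_len V w y k \<Longrightarrow> p \<noteq> [] \<and> hd p = y"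
  by (auto simp: finite_paths_len_def finite_paths_from_def finite_path_def)

lemma partition_fn_eq:
  assumes wd: "weighted_digraph V w" and "x \<in> V"
  shows "partition_fn V w x k = ((adj_op V w) ^^ k) (\<lambda>_. 1) x"
  using assms(2)
proof (induction k arbitrary: x)
  case 0
  then show ?case by (simp add: partition_fn_def finite_paths_len_0 path_weight_def path_len_def)
next
  case (Suc k)
  have fin: "finite V" using wd by (simp add: weighted_digraph_def)
  have "partition_fn V w x (Suc k)
      = (\<Sum>y\<in>{y \<in> V. 0 < w x y}. \<Sum>p\<in>(#) x ` finite_paths_len V w y k. path_weight w p)"
    unfolding partition_fn_def finite_paths_len_Suc[OF Suc.prems]
    using fin by (intro sum.UNION_disjoint) (auto intro: finite_finite_paths_len dest: finite_paths_len_hd)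
  also have "\<dots> = (\<Sum>y\<in>{y \<in> V. 0 < w x y}. w x y * ((adj_op V w) ^^ k) (\<lambda>_. 1) y)"
  proof (rule sum.cong)
    fix y assume "y \<in> {y \<in> V. 0 < w x y}"
    then show "(\<Sum>p\<in>(#) x ` finite_paths_len V w y k. path_weight w p) = w x y * ((adj_op V w) ^^ k) (\<lambda>_. 1) y"
      using Suc.IH[of y] by (subst sum_Cons_path_weight) (auto simp: partition_fn_def dest: finite_paths_len_hd)
  qed simp
  also have "\<dots> = (\<Sum>y\<in>V. w x y * ((adj_op V w) ^^ k) (\<lambda>_. 1) y)"
    using fin wd Suc.prems
    by (intro sum.mono_neutral_left) (auto simp: weighted_digraph_def less_le)
  finally show ?case
    by (simp only: funpow.simps comp_apply adj_op_def[of V w "((adj_op V w) ^^ k) (\<lambda>_. 1)"])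
qed

text \<open>A path with prefix \<open>u\<close> is \<open>u\<close> joined at \<open>last u\<close>
  to an arbitrary path of length \<open>k\<close> from there, and weights multiply.\<close>

lemma sum_path_weight_extensions:
  assumes "u \<in> finite_paths_from V w x"
  shows "(\<Sum>p\<in>{p \<in> finite_paths_len V w x (k + path_len u). take (length u) p = u}. path_weight w p)
    = path_weight w u * partition_fn V w (last u) k"
  using assms
proof (induction u arbitrary: x)
  case (Cons a u)
  then have a: "a = x" "x \<in> V" by (auto simp: finite_paths_from_def finite_path_Cons)
  show ?case
  proof (cases "u = []")
    case True
    have "{p \<in> finite_paths_len V w x k. take 1 p = [x]} = finite_paths_len V w x k"
      using finite_paths_len_hd[of _ V w x k] by (auto simp: take_Suc)
    then show ?thesis
      using True a by (simp add: path_weight_def path_len_def partition_fn_def)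
  next
    case False
    then have u: "u \<in> finite_paths_from V w (hd u)" "0 < w x (hd u)" "hd u \<in> V"
      using Cons.prems a finite_path_edges[of V w u] by (auto simp: finite_paths_from_def finite_path_Cons)
    let ?S = "{p \<in> finite_paths_len V w (hd u) (k + path_len u). take (length u) p = u}"
    have "{p \<in> finite_paths_len V w x (k + path_len (a # u)). take (length (a # u)) p = a # u} = (#) x ` ?S"
    proof (intro equalityI subsetI)
      fix p assume p: "p \<in> {p \<in> finite_paths_len V w x (k + path_len (a # u)). take (length (a # u)) p = a # u}"
      then obtain y p' where p': "p = x # p'" "p' \<in> finite_paths_len V w y (k + path_len u)"
        using False a by (auto simp: path_len_Cons finite_paths_len_Suc)
      have "take (length u) p' = u" using p p' by simp
      moreover from this have "hd p' = hd u" using False by (metis hd_take length_greater_0_conv)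
      ultimately show "p \<in> (#) x ` ?S" using p' finite_paths_len_hd[OF p'(2)] by auto
    next
      fix p assume "p \<in> (#) x ` ?S"
      then show "p \<in> {p \<in> finite_paths_len V w x (k + path_len (a # u)). take (length (a # u)) p = a # u}"
        using False a u by (auto simp: path_len_Cons finite_paths_len_Suc)
    qed
    moreover have "(\<Sum>p\<in>(#) x ` ?S. path_weight w p) = w x (hd u) * (\<Sum>p\<in>?S. path_weight w p)"
      by (rule sum_Cons_path_weight) (auto dest: finite_paths_len_hd)
    ultimately show ?thesis
      using Cons.IH[OF u(1)] False a by (simp add: path_weight_Cons)
  qed
qed (simp add: finite_paths_from_def finite_path_def)

text \<open>The cocycle relation telescopes the product; the value 1 on the diagonal covers the path
  of length 0.\<close>

lemma cocycle_path_product: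
  assumes \<Gamma>: "cocycle U w \<Gamma>" "\<And>x. x \<in> U \<Longrightarrow> \<Gamma> x x = 1" and u: "finite_path U w u"
  shows "(\<Prod>i<path_len u. cocycle_kernel w r \<Gamma> (u ! i) (u ! Suc i))
    = inverse r ^ path_len u * path_weight w u * \<Gamma> (hd u) (last u)"
  using u
proof (induction u)
  case (Cons x u)
  show ?case
  proof (cases "u = []")
    case True
    then show ?thesis
      using Cons.prems \<Gamma>(2) by (simp add: path_len_def path_weight_def finite_path_Cons)
  next
    case False
    then have u: "finite_path U w u" "x \<in> U" "0 < w x (hd u)" "hd u \<in> U"
      using Cons.prems finite_path_edges[of U w u] by (auto simp: finite_path_Cons)
    have "accessible U w x (hd u)" using u accessible_edge[of x U "hd u" w] by blast
    moreover have "accessible U w (hd u) (last u)" using u(1) by (auto simp: accessible_def)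
    ultimately have "\<Gamma> x (last u) = \<Gamma> x (hd u) * \<Gamma> (hd u) (last u)"
      using \<Gamma>(1) by (auto simp: cocycle_def)
    moreover have "(\<Prod>i<path_len (x # u). cocycle_kernel w r \<Gamma> ((x # u) ! i) ((x # u) ! Suc i))
        = cocycle_kernel w r \<Gamma> x (hd u) * (\<Prod>i<path_len u. cocycle_kernel w r \<Gamma> (u ! i) (u ! Suc i))"
      using False by (simp add: path_len_Cons prod.lessThan_Suc_shift hd_conv_nth del: prod.lessThan_Suc)
    moreover have "cocycle_kernel w r \<Gamma> x (hd u) * (inverse r ^ path_len u * path_weight w u * \<Gamma> (hd u) (last u))
        = inverse r ^ Suc (path_len u) * (w x (hd u) * path_weight w u) * (\<Gamma> x (hd u) * \<Gamma> (hd u) (last u))"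
      by (simp only: cocycle_kernel_def power_Suc ac_simps)
    ultimately show ?thesis
      using False by (simp only: Cons.IH[OF u(1)] path_len_Cons[OF False] path_weight_Cons[OF False] list.sel last.simps if_False)
  qed
qed (simp add: finite_path_def)

lemma complete_cocycle_refl:
  assumes "cocycle U w \<Gamma>" "\<And>x y. accessible U w x y \<Longrightarrow> 0 < \<Gamma> x y" "x \<in> U"
  shows "\<Gamma> x x = 1"
proof -
  have acc: "accessible U w x x" using assms(3) by (rule accessible_refl)
  then have "\<Gamma> x x = \<Gamma> x x * \<Gamma> x x" using assms(1) unfolding cocycle_def by blast
  then show ?thesis using assms(2)[OF acc] by simp
qed

text \<open>The cylinder masses depend on the kernel only, whatever \<rho> and \<Gamma> witness it;
  this gives uniqueness of the measure with a given kernel.\<close>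

lemma complete_cocycle_measure_cylinder:
  assumes \<nu>: "complete_cocycle_measure_with_kernel U w q \<nu>" and x: "x \<in> U"
    and u: "u \<in> finite_paths_from U w x"
  shows "measure (\<nu> x) (cylinder U w x u) = (\<Prod>i<path_len u. q (u ! i) (u ! Suc i))"
proof -
  obtain r \<Gamma> where \<Gamma>: "complete_cocycle_measure U w r \<Gamma> \<nu>"
    and q: "\<And>x y. x \<in> U \<Longrightarrow> y \<in> U \<Longrightarrow> q x y = cocycle_kernel w r \<Gamma> x y"
    using \<nu> by (auto simp: complete_cocycle_measure_with_kernel_def)
  have coc: "cocycle U w \<Gamma>" and pos: "\<And>x y. accessible U w x y \<Longrightarrow> 0 < \<Gamma> x y"
    and m: "measure (\<nu> x) (cylinder U w x u) = inverse r ^ path_len u * path_weight w u * \<Gamma> x (last u)"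
    using \<Gamma> x u by (auto simp: complete_cocycle_measure_def cocycle_measure_def)
  have p: "finite_path U w u" "hd u = x" using u by (auto simp: finite_paths_from_def)
  then have "length u = Suc (path_len u)" "set u \<subseteq> U" by (auto simp: finite_path_def path_len_def)
  then have "u ! i \<in> U" if "i \<le> path_len u" for i
    using that nth_mem[of i u] by auto
  then have "(\<Prod>i<path_len u. q (u ! i) (u ! Suc i)) = (\<Prod>i<path_len u. cocycle_kernel w r \<Gamma> (u ! i) (u ! Suc i))"
    by (intro prod.cong) (auto simp: q)
  then show ?thesis
    unfolding m using cocycle_path_product[OF coc complete_cocycle_refl[OF coc pos] p(1)] p(2) by simp
qed

subsection \<open>The limit measure on finite and infinite paths\<close>

lemma all_paths_topology_eq:
  "all_paths_topology V w x = seq_topology (insert None (Some ` V)) (all_paths_from V w x)"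
  by (simp add: all_paths_topology_def seq_topology_def)

lemma seq_space_all_paths: "finite V \<Longrightarrow> seq_space (insert None (Some ` V)) (all_paths_from V w x)"
proof
  fix \<omega> i assume "\<omega> \<in> all_paths_from V w x"
  then consider u where "\<omega> = pad_finite u" "set u \<subseteq> V"
    | \<omega>' where "\<omega> = embed_infinite \<omega>'" "\<omega>' i \<in> V"
    by (auto simp: all_paths_from_def finite_paths_from_def finite_path_def infinite_paths_from_def)
  then show "\<omega> i \<in> insert None (Some ` V)"
    by cases (auto simp: pad_finite_def embed_infinite_def dest: nth_mem)
qed simp

lemma infinite_paths_from_mono: "U \<subseteq> V \<Longrightarrow> infinite_paths_from U w x \<subseteq> infinite_paths_from V w x"
  by (auto simp: infinite_paths_from_def)

lemma embed_infinite_in_all_paths: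
  assumes "U \<subseteq> V" "\<omega> \<in> infinite_paths_from U w x"
  shows "embed_infinite \<omega> \<in> all_paths_from V w x"
  using imageI[OF subsetD[OF infinite_paths_from_mono[OF assms(1)] assms(2)], of embed_infinite]
  by (simp add: all_paths_from_def)

lemma embed_infinite_cylinder:
  assumes "U \<subseteq> V"
  shows "{\<omega> \<in> infinite_paths_from U w x. embed_infinite \<omega> \<in> seq_cylinder (all_paths_from V w x) l}
    = (if None \<in> set l then {} else seq_cylinder (infinite_paths_from U w x) (map the l))"
proof -
  have "(\<forall>i<length l. Some (\<omega> i) = l ! i) \<longleftrightarrow> None \<notin> set l \<and> (\<forall>i<length l. \<omega> i = the (l ! i))" for \<omega>
  proof -
    have "Some a = b \<longleftrightarrow> b \<noteq> None \<and> a = the b" for a :: 'a and b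
      by (cases b) auto
    then show ?thesis by (auto simp: in_set_conv_nth)
  qed
  moreover have "embed_infinite \<omega> \<in> all_paths_from V w x" if "\<omega> \<in> infinite_paths_from U w x" for \<omega>
    using that by (rule embed_infinite_in_all_paths[OF assms])
  ultimately show ?thesis
    by (auto simp: seq_cylinder_def embed_infinite_def)
qed

lemma
  assumes fin: "finite V" and UV: "U \<subseteq> V" and M: "borel_prob_on (infinite_paths_topology U w x) M"
  shows borel_prob_on_view_on_all_paths: "borel_prob_on (all_paths_topology V w x) (view_on_all_paths V w x M)"
    and measure_view_on_all_paths:
      "measure (view_on_all_paths V w x M) (seq_cylinder (all_paths_from V w x) l)
        = (if None \<in> set l then 0 else measure M (seq_cylinder (infinite_paths_from U w x) (map the l)))"
proof -
  interpret U: seq_space U "infinite_paths_from U w x"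
    by (rule seq_space_infinite_paths) (use fin UV in \<open>auto intro: finite_subset\<close>)
  interpret V: seq_space "insert None (Some ` V)" "all_paths_from V w x"
    by (rule seq_space_all_paths[OF fin])
  note M' = M[unfolded infinite_paths_topology_eq]
  have space: "space M = infinite_paths_from U w x" by (rule U.borel_prob_on_measurable(1)[OF M'])
  have vimage: "embed_infinite -` seq_cylinder (all_paths_from V w x) l \<inter> space M
      = (if None \<in> set l then {} else seq_cylinder (infinite_paths_from U w x) (map the l))" for l
    unfolding embed_infinite_cylinder[OF UV, symmetric] space by auto
  have meas: "embed_infinite \<in> measurable M (borel_of_topology (all_paths_topology V w x))"
    unfolding all_paths_topology_eq
  proof (rule measurable_sigma_sets[OF V.sets_seq_topology])
    show "range (seq_cylinder (all_paths_from V w x)) \<subseteq> Pow (all_paths_from V w x)"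
      by (auto simp: seq_cylinder_def)
    show "embed_infinite \<in> space M \<rightarrow> all_paths_from V w x"
      using embed_infinite_in_all_paths[OF UV] by (auto simp: space)
    fix S assume "S \<in> range (seq_cylinder (all_paths_from V w x))"
    then show "embed_infinite -` S \<inter> space M \<in> sets M"
      using U.borel_prob_on_measurable(2)[OF M'] by (auto simp: vimage)
  qed
  show "borel_prob_on (all_paths_topology V w x) (view_on_all_paths V w x M)"
    using M meas by (auto simp: borel_prob_on_def view_on_all_paths_def intro: prob_space.prob_space_distr)
  show "measure (view_on_all_paths V w x M) (seq_cylinder (all_paths_from V w x) l)
        = (if None \<in> set l then 0 else measure M (seq_cylinder (infinite_paths_from U w x) (map the l)))"
    unfolding view_on_all_paths_def using V.seq_cylinder_sets
    by (subst measure_distr[OF meas]) (simp_all add: vimage all_paths_topology_eq)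
qed

text \<open>A path of length \<open>k\<close> has \<open>Suc k\<close> vertices, so a word of at
  most that length does not see the padding.\<close>

lemma pad_finite_in_cylinder:
  assumes p: "p \<in> finite_paths_len V w x k" and l: "length l \<le> Suc k"
  shows "pad_finite p \<in> seq_cylinder (all_paths_from V w x) l \<longleftrightarrow> map Some (take (length l) p) = l"
proof -
  have len: "length p = Suc k"
    using p by (auto simp: finite_paths_len_def finite_paths_from_def finite_path_def path_len_def)
  have "pad_finite p \<in> all_paths_from V w x"
    using p by (auto simp: all_paths_from_def finite_paths_len_def)
  then show ?thesis
    using l len by (auto simp: seq_cylinder_def pad_finite_def list_eq_iff_nth_eq)
qed

lemma take_finite_path:
  assumes "p \<in> finite_paths_from V w x" "0 < n"
  shows "take n p \<in> finite_paths_from V w x"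
  using assms set_take_subset[of n p]
  by (auto simp: finite_paths_from_def finite_path_def successively_conv_nth hd_take)

lemma
  assumes fin: "finite V" and Z: "0 < partition_fn V w x k"
  shows borel_prob_on_uniform_dist: "borel_prob_on (all_paths_topology V w x) (uniform_dist V w x k)"
    and measure_uniform_dist: "length l \<le> Suc k \<Longrightarrow>
      measure (uniform_dist V w x k) (seq_cylinder (all_paths_from V w x) l)
      = (\<Sum>p\<in>{p \<in> finite_paths_len V w x k. map Some (take (length l) p) = l}. path_weight w p) / partition_fn V w x k"
proof -
  interpret V: seq_space "insert None (Some ` V)" "all_paths_from V w x"
    by (rule seq_space_all_paths[OF fin])
  let ?O = "finite_paths_len V w x k"
  let ?M = "point_measure ?O (\<lambda>u. ennreal (path_weight w u / partition_fn V w x k))"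
  have finO: "finite ?O" by (rule finite_finite_paths_len[OF fin])
  have nn: "0 \<le> path_weight w p / partition_fn V w x k" if "p \<in> ?O" for p
    using that Z path_weight_pos[of V w p] by (auto simp: finite_paths_len_def finite_paths_from_def)
  have em: "emeasure ?M S = ennreal (\<Sum>p\<in>S. path_weight w p / partition_fn V w x k)" if "S \<subseteq> ?O" for S
    using that finO nn by (subst emeasure_point_measure_finite) (auto intro!: sum_ennreal)
  have prob: "prob_space ?M"
  proof
    have "(\<Sum>p\<in>?O. path_weight w p / partition_fn V w x k) = 1"
      using Z by (simp add: partition_fn_def flip: sum_divide_distrib)
    then show "emeasure ?M (space ?M) = 1" by (simp add: space_point_measure em)
  qed
  have meas: "pad_finite \<in> measurable ?M (borel_of_topology (all_paths_topology V w x))"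
    unfolding measurable_point_measure_eq1 space_borel_of_topology all_paths_topology_eq V.topspace_seq_topology
    by (auto simp: all_paths_from_def finite_paths_len_def)
  show "borel_prob_on (all_paths_topology V w x) (uniform_dist V w x k)"
    using prob meas by (auto simp: borel_prob_on_def uniform_dist_def intro: prob_space.prob_space_distr)
  assume l: "length l \<le> Suc k"
  have vimage: "pad_finite -` seq_cylinder (all_paths_from V w x) l \<inter> space ?M
      = {p \<in> ?O. map Some (take (length l) p) = l}"
    using pad_finite_in_cylinder[OF _ l] by (auto simp: space_point_measure)
  have "measure (uniform_dist V w x k) (seq_cylinder (all_paths_from V w x) l)
      = measure ?M {p \<in> ?O. map Some (take (length l) p) = l}"
    unfolding uniform_dist_def using V.seq_cylinder_sets
    by (subst measure_distr[OF meas]) (simp_all only: vimage all_paths_topology_eq)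
  also have "\<dots> = (\<Sum>p\<in>{p \<in> ?O. map Some (take (length l) p) = l}. path_weight w p / partition_fn V w x k)"
    unfolding measure_def using nn by (subst em) (auto intro!: enn2real_ennreal sum_nonneg)
  finally show "measure (uniform_dist V w x k) (seq_cylinder (all_paths_from V w x) l)
      = (\<Sum>p\<in>{p \<in> ?O. map Some (take (length l) p) = l}. path_weight w p) / partition_fn V w x k"
    by (simp add: sum_divide_distrib)
qed

section \<open>The limiting cocycle measure on the umbrella digraph\<close>

context residual_digraph
begin

definition umbrella :: "'a set" where "umbrella = {y \<in> V. 0 < c y}"

text \<open>The Doob transform of the weights by the harmonic vector \<open>c\<close>.\<close>

definition kernel :: "'a \<Rightarrow> 'a \<Rightarrow> real" where
  "kernel x y = inverse \<rho> * w x y * (c y / c x)"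

lemma umbrella_subset: "umbrella \<subseteq> V"
  by (auto simp: umbrella_def)

sublocale markov: markov_kernel umbrella w kernel
proof
  show "finite umbrella" using fin umbrella_subset by (rule finite_subset[rotated])
  fix x assume x: "x \<in> umbrella"
  show "0 \<le> kernel x y" "0 < kernel x y \<longleftrightarrow> 0 < w x y" if "y \<in> umbrella" for y
    using x that radius_pos w_nonneg[of x y]
    by (auto simp: kernel_def umbrella_def zero_less_mult_iff zero_less_divide_iff)
  \<comment> \<open>Outside the umbrella digraph \<open>c\<close> vanishes, so harmonicity on
    \<open>V\<close> restricts to it and makes the kernel stochastic.\<close>
  have "(\<Sum>y\<in>umbrella. w x y * c y) = (\<Sum>y\<in>V. w x y * c y)"
    using fin c_nonneg by (intro sum.mono_neutral_left) (auto simp: umbrella_def less_le)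
  also have "\<dots> = \<rho> * c x" using c_harmonic[of x] x by (simp add: umbrella_def)
  finally have "(\<Sum>y\<in>umbrella. w x y * c y) / (\<rho> * c x) = 1"
    using x radius_pos by (simp add: umbrella_def)
  moreover have "(\<Sum>y\<in>umbrella. kernel x y) = (\<Sum>y\<in>umbrella. w x y * c y) / (\<rho> * c x)"
    unfolding sum_divide_distrib by (intro sum.cong) (auto simp: kernel_def divide_inverse mult_ac)
  ultimately show "(\<Sum>y\<in>umbrella. kernel x y) = 1" by (simp only:)
qed

lemma cocycle_umbrella: "cocycle umbrella w (\<lambda>x y. c y / c x)"
  unfolding cocycle_def by (auto dest!: accessible_in simp: umbrella_def)

lemma complete_cocycle_chain_measure:
  "complete_cocycle_measure umbrella w \<rho> (\<lambda>x y. c y / c x) markov.chain_measure"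
  unfolding complete_cocycle_measure_def cocycle_measure_def
proof (intro conjI ballI allI impI radius_pos cocycle_umbrella markov.borel_prob_on_chain_measure)
  fix x y assume "accessible umbrella w x y"
  then show "0 < c y / c x" by (auto dest!: accessible_in simp: umbrella_def)
next
  fix x u assume x: "x \<in> umbrella" and u: "u \<in> finite_paths_from umbrella w x"
  have "(\<Prod>i<path_len u. kernel (u ! i) (u ! Suc i))
      = (\<Prod>i<path_len u. cocycle_kernel w \<rho> (\<lambda>x y. c y / c x) (u ! i) (u ! Suc i))"
    by (simp add: kernel_def cocycle_kernel_def)
  also have "\<dots> = inverse \<rho> ^ path_len u * path_weight w u * (c (last u) / c (hd u))"
    by (rule cocycle_path_product[OF cocycle_umbrella]) (use u in \<open>auto simp: umbrella_def finite_paths_from_def\<close>)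
  finally show "measure (markov.chain_measure x) (cylinder umbrella w x u)
      = inverse \<rho> ^ path_len u * path_weight w u * (c (last u) / c x)"
    using markov.measure_chain_measure[OF x u] u by (simp add: finite_paths_from_def)
qed

lemma complete_cocycle_kernel_chain_measure:
  "complete_cocycle_measure_with_kernel umbrella w kernel markov.chain_measure"
  unfolding complete_cocycle_measure_with_kernel_def
  using complete_cocycle_chain_measure
  by (intro exI[of _ \<rho>] exI[of _ "\<lambda>x y. c y / c x"]) (auto simp: kernel_def cocycle_kernel_def)

lemma chain_measure_unique:
  assumes \<nu>: "complete_cocycle_measure_with_kernel umbrella w kernel \<nu>" and x: "x \<in> umbrella"
  shows "\<nu> x = markov.chain_measure x"
proof (rule path_measure_unique[OF markov.finite_states _ markov.borel_prob_on_chain_measure[OF x]])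
  show "borel_prob_on (infinite_paths_topology umbrella w x) (\<nu> x)"
    using \<nu> x by (auto simp: complete_cocycle_measure_with_kernel_def complete_cocycle_measure_def cocycle_measure_def)
  show "measure (\<nu> x) (cylinder umbrella w x u) = measure (markov.chain_measure x) (cylinder umbrella w x u)"
    if "u \<in> finite_paths_from umbrella w x" for u
    using complete_cocycle_measure_cylinder[OF \<nu> x that] markov.measure_chain_measure[OF x that] by simp
qed

lemma partition_fn_z: "x \<in> V \<Longrightarrow> partition_fn V w x k = \<rho> ^ k * z x k"
  using radius_pos by (simp add: partition_fn_eq[OF wd] z_def)

lemma partition_fn_x0_pos: "0 < partition_fn V w x0 k"
  using x0 radius_pos z_x0_pos by (simp add: partition_fn_z)

lemma uniform_dist_cylinder_tendsto:
  "(\<lambda>k. measure (uniform_dist V w x0 k) (seq_cylinder (all_paths_from V w x0) l)) \<longlonglongrightarrow>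
    measure (view_on_all_paths V w x0 (markov.chain_measure x0)) (seq_cylinder (all_paths_from V w x0) l)"
proof -
  have x0U: "x0 \<in> umbrella" using x0 c_x0_pos by (simp add: umbrella_def)
  let ?P = "infinite_paths_from umbrella w x0"
  note prob = markov.borel_prob_on_chain_measure[OF x0U]
  have lim: "measure (view_on_all_paths V w x0 (markov.chain_measure x0)) (seq_cylinder (all_paths_from V w x0) l)
      = (if None \<in> set l then 0 else measure (markov.chain_measure x0) (seq_cylinder ?P (map the l)))"
    by (rule measure_view_on_all_paths[OF fin umbrella_subset prob])
  \<comment> \<open>Once \<open>k\<close> is at least the length of the word, padding can no longer
    match any of its letters.\<close>
  have ev: "\<forall>\<^sub>F k in sequentially. measure (uniform_dist V w x0 k) (seq_cylinder (all_paths_from V w x0) l)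
      = (\<Sum>p\<in>{p \<in> finite_paths_len V w x0 k. map Some (take (length l) p) = l}. path_weight w p) / partition_fn V w x0 k"
    using eventually_ge_at_top[of "length l"]
    by eventually_elim (intro measure_uniform_dist fin partition_fn_x0_pos, simp)
  define u where "u = map the l"
  consider "l = []" | "l \<noteq> []" "None \<in> set l \<or> u \<notin> finite_paths_from V w x0"
    | "None \<notin> set l" "u \<in> finite_paths_from V w x0"
    by blast
  then show ?thesis
  proof cases
    case 1
    have "measure (markov.chain_measure x0) (seq_cylinder ?P []) = 1"
    proof -
      interpret U: seq_space umbrella ?P by (rule seq_space_infinite_paths[OF markov.finite_states])
      have "space (markov.chain_measure x0) = ?P"
        using U.borel_prob_on_measurable(1) prob by (simp add: infinite_paths_topology_eq)
      then show ?thesis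
        using prob_space.prob_space[of "markov.chain_measure x0"] prob
        by (simp add: borel_prob_on_def seq_cylinder_def)
    qed
    then have "measure (view_on_all_paths V w x0 (markov.chain_measure x0)) (seq_cylinder (all_paths_from V w x0) l) = 1"
      using lim 1 by simp
    moreover have "\<forall>\<^sub>F k in sequentially. measure (uniform_dist V w x0 k) (seq_cylinder (all_paths_from V w x0) l) = 1"
      using ev by eventually_elim (use 1 partition_fn_x0_pos in \<open>simp add: partition_fn_def less_le\<close>)
    ultimately show ?thesis by (simp add: tendsto_eventually)
  next
    case 2
    \<comment> \<open>A word containing \<open>None\<close>, or one that is not a path of
      \<open>V\<close>, is a prefix of no finite path; the limit measure gives it mass 0 as
      well.\<close>
    have empty: "{p \<in> finite_paths_len V w x0 k. map Some (take (length l) p) = l} = {}" for k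
    proof -
      have False if p: "p \<in> finite_paths_from V w x0" "map Some (take (length l) p) = l" for p
      proof -
        have "None \<notin> set l" by (subst p(2)[symmetric]) auto
        moreover have "u = take (length l) p" unfolding u_def by (subst p(2)[symmetric]) (simp add: comp_def)
        then have "u \<in> finite_paths_from V w x0" using take_finite_path[OF p(1)] 2(1) by simp
        ultimately show False using 2(2) by blast
      qed
      then show ?thesis by (auto simp: finite_paths_len_def)
    qed
    have "u \<notin> finite_paths_from umbrella w x0" if "None \<notin> set l"
      using that 2(2) umbrella_subset by (auto simp: finite_paths_from_def finite_path_def)
    then have "measure (view_on_all_paths V w x0 (markov.chain_measure x0)) (seq_cylinder (all_paths_from V w x0) l) = 0"
      using lim seq_cylinder_not_path[of u umbrella w x0] 2(1) by (simp add: u_def)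
    moreover have "\<forall>\<^sub>F k in sequentially. measure (uniform_dist V w x0 k) (seq_cylinder (all_paths_from V w x0) l) = 0"
      using ev by eventually_elim (simp only: empty, simp)
    ultimately show ?thesis by (simp add: tendsto_eventually)
  next
    case 3
    have lu: "l = map Some u" using 3(1) by (auto simp: u_def intro!: nth_equalityI) (metis nth_mem option.collapse)
    have last: "last u \<in> V" using 3(2) finite_path_edges[of V w u] by (auto simp: finite_paths_from_def)
    let ?n = "path_len u"
    have set_eq: "{p \<in> finite_paths_len V w x0 k. map Some (take (length l) p) = l}
        = {p \<in> finite_paths_len V w x0 k. take (length u) p = u}" for k
      by (simp add: lu inj_map_eq_map)
    have "\<forall>\<^sub>F j in sequentially. inverse \<rho> ^ ?n * path_weight w u * (z (last u) j / z x0 (j + ?n))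
        = measure (uniform_dist V w x0 (j + ?n)) (seq_cylinder (all_paths_from V w x0) l)"
      using sequentially_offset[OF ev, of ?n]
    proof eventually_elim
      case (elim j)
      have "measure (uniform_dist V w x0 (j + ?n)) (seq_cylinder (all_paths_from V w x0) l)
          = path_weight w u * (\<rho> ^ j * z (last u) j) / (\<rho> ^ (j + ?n) * z x0 (j + ?n))"
        unfolding elim set_eq sum_path_weight_extensions[OF 3(2)]
        by (simp add: partition_fn_z x0 last)
      also have "\<dots> = inverse \<rho> ^ ?n * path_weight w u * (z (last u) j / z x0 (j + ?n))"
        using radius_pos by (simp add: power_add power_inverse field_simps)
      finally show ?case by simp
    qed
    moreover have "(\<lambda>j. inverse \<rho> ^ ?n * path_weight w u * (z (last u) j / z x0 (j + ?n)))
        \<longlonglongrightarrow> inverse \<rho> ^ ?n * path_weight w u * (c (last u) / c x0)"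
      by (intro tendsto_mult tendsto_const z_ratio_tendsto last)
    ultimately have "(\<lambda>j. measure (uniform_dist V w x0 (j + ?n)) (seq_cylinder (all_paths_from V w x0) l))
        \<longlonglongrightarrow> inverse \<rho> ^ ?n * path_weight w u * (c (last u) / c x0)"
      by (rule Lim_transform_eventually[rotated])
    then have "(\<lambda>k. measure (uniform_dist V w x0 k) (seq_cylinder (all_paths_from V w x0) l))
        \<longlonglongrightarrow> inverse \<rho> ^ ?n * path_weight w u * (c (last u) / c x0)"
      by (rule LIMSEQ_offset)
    moreover have "measure (markov.chain_measure x0) (seq_cylinder ?P u)
        = inverse \<rho> ^ ?n * path_weight w u * (c (last u) / c x0)"
    \<comment> \<open>The support of \<open>c\<close> is closed under predecessors. So if
      \<open>c\<close> is positive at the end of \<open>u\<close>, the whole of \<open>u\<close>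
      lies in the umbrella digraph and the cocycle formula applies; otherwise \<open>u\<close> is
      not a path of it and both sides are 0.\<close>
    proof (cases "0 < c (last u)")
      case True
      have "y \<in> umbrella" if "y \<in> set u" for y
      proof -
        obtain ys zs where split: "u = ys @ y # zs" using \<open>y \<in> set u\<close> by (meson split_list)
        have "finite_path V w (y # zs)"
          using 3(2) by (auto simp: split finite_paths_from_def finite_path_def successively_append_iff)
        moreover have "y \<in> V"
          using 3(2) \<open>y \<in> set u\<close> by (auto simp: finite_paths_from_def finite_path_def)
        ultimately have "accessible V w y (last (y # zs))" "y \<in> V" by (auto simp: accessible_def)
        then show ?thesis
          using True c_pos_accessible[of y "last u"] by (auto simp: split umbrella_def)
      qed
      then have "u \<in> finite_paths_from umbrella w x0"
        using 3(2) by (auto simp: finite_paths_from_def finite_path_def)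
      then show ?thesis
        using complete_cocycle_chain_measure x0U
        by (auto simp: complete_cocycle_measure_def cocycle_measure_def cylinder_eq_seq_cylinder)
    next
      case False
      then have "last u \<notin> umbrella" by (simp add: umbrella_def)
      have "u \<noteq> []" using 3(2) by (auto simp: finite_paths_from_def finite_path_def)
      have "\<not> set u \<subseteq> umbrella"
        using last_in_set[OF \<open>u \<noteq> []\<close>] \<open>last u \<notin> umbrella\<close> by blast
      then have "u \<notin> finite_paths_from umbrella w x0"
        by (auto simp: finite_paths_from_def finite_path_def)
      then have "seq_cylinder ?P u = {}" using \<open>u \<noteq> []\<close> by (rule seq_cylinder_not_path[rotated])
      moreover have "c (last u) = 0" using False c_nonneg[OF last] by simp
      ultimately show ?thesis by simp
    qed
    ultimately show ?thesis using lim 3(1) by (simp add: u_def)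
  qed
qed

lemma uniform_dist_weakly_converges:
  "weakly_converges (all_paths_topology V w x0) (uniform_dist V w x0)
    (view_on_all_paths V w x0 (markov.chain_measure x0))"
proof -
  interpret seq_space "insert None (Some ` V)" "all_paths_from V w x0"
    by (rule seq_space_all_paths[OF fin])
  have x0U: "x0 \<in> umbrella" using x0 c_x0_pos by (simp add: umbrella_def)
  show ?thesis
    unfolding all_paths_topology_eq
  proof (rule weakly_converges_cylinders)
    show "borel_prob_on (seq_topology (insert None (Some ` V)) (all_paths_from V w x0)) (uniform_dist V w x0 k)" for k
      using borel_prob_on_uniform_dist[OF fin partition_fn_x0_pos] by (simp add: all_paths_topology_eq)
    show "borel_prob_on (seq_topology (insert None (Some ` V)) (all_paths_from V w x0))
        (view_on_all_paths V w x0 (markov.chain_measure x0))"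
      using borel_prob_on_view_on_all_paths[OF fin umbrella_subset markov.borel_prob_on_chain_measure[OF x0U]]
      by (simp add: all_paths_topology_eq)
  qed (rule uniform_dist_cylinder_tendsto)
qed

end

theorem theorem5p5:
  fixes V :: "'v set" and w :: "'v \<Rightarrow> 'v \<Rightarrow> real"
    and \<rho> :: real and \<Theta> \<Gamma> q :: "'v \<Rightarrow> 'v \<Rightarrow> real" and x0 :: 'v and U :: "'v set"
  assumes "weighted_digraph V w"
    and "\<rho> = digraph_spectral_radius V w" and "0 < \<rho>"
    and "is_residual_matrix V w \<Theta>"
    and "x0 \<in> V" and "\<forall>y\<in>V. accessible V w x0 y"
    and "\<forall>C. basic_class V w C \<longrightarrow> aperiodic_class w C"
    and "U = spanned_umbrella V w x0"
    and "\<forall>x y. \<Gamma> x y = mult_ones V \<Theta> y / mult_ones V \<Theta> x"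
    and "\<forall>x y. q x y = inverse \<rho> * w x y * \<Gamma> x y"
  shows "\<exists>\<mu>. complete_cocycle_measure U w \<rho> \<Gamma> \<mu>
           \<and> complete_cocycle_measure_with_kernel U w q \<mu>
           \<and> (\<forall>\<nu>. complete_cocycle_measure_with_kernel U w q \<nu> \<longrightarrow> (\<forall>x\<in>U. \<nu> x = \<mu> x))
           \<and> weakly_converges (all_paths_topology V w x0)
               (\<lambda>k. uniform_dist V w x0 k) (view_on_all_paths V w x0 (\<mu> x0))"
proof -
  interpret residual_digraph V w \<Theta> x0
    by unfold_locales (use assms in auto)
  have \<Gamma>: "\<Gamma> = (\<lambda>x y. c y / c x)" using assms(9) by (simp add: fun_eq_iff c_def)
  have q: "q = kernel" using assms(2,10) by (simp add: fun_eq_iff kernel_def \<Gamma>)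
  have U: "U = umbrella" using assms(8) spanned_umbrella_eq by (simp add: umbrella_def)
  show ?thesis
    unfolding \<Gamma> q U assms(2)
    using complete_cocycle_chain_measure complete_cocycle_kernel_chain_measure
      chain_measure_unique uniform_dist_weakly_converges
    by blast
qed

end
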